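(* Let $g_n\colon\mathbb{D}\to\mathbb{D}$, $n\in\mathbb{N}$, be inner functions with $g_n(0)=0$. Let $G_n = g_n\circ\cdots\circ g_1$ for $n\ge 1$. (i) Assume $g_n'(0)>0$ for all $n\ge1$. Then the sequence $\{\widehat G_n\}_{n\in\mathbb{N}}$ is ergodic if and only if $$\lim_{N\to\infty}\prod_{k=\lfloor N(1-\varepsilon)\rfloor}^{N}g_k'(0)=0$$ for any $0<\varepsilon<1$. (ii) Assume $g_n'(0)>0$ for all $n\ge1$. Then the sequence $\{\widehat G_n\}_{n\in\mathbb{N}}$ is mixing if and only if for every $\epsilon>0$ there exists $M_0$ such that, for any $N>M>M_0$, we have $$\prod_{k=N-M}^{N}g_k'(0)<\epsilon.$$ (iii) Assume the sequence $\{g_n\}_{n\in\mathbb{N}}$ is not contracting. Then the sequence $\{\widehat G_n\}_{n\in\mathbb{N}}$ is ergodic if and only if the sequence $\{e^{i\arg G_n'(0)}\}_{n\in\mathbb{N}}$ is equidistributed on $\partial\mathbb{D}$.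
   Context: $\mathbb{D}$ is the open unit disc in $\mathbb{C}$, $m$ is normalised Lebesgue measure on $\partial\mathbb{D}$, and $\mathbb{N}=\{1,2,3,\dots\}$. An analytic map $g\colon\mathbb{D}\to\mathbb{D}$ is inner if $\hat g(e^{i\theta})=\lim_{r\nearrow 1}g(re^{i\theta})$ exists and has modulus one for $m$-almost every $e^{i\theta}\in\partial\mathbb{D}$; $\hat g$ is its (a.e. defined) boundary map, and $\widehat G_n$ denotes the boundary map of the inner function $G_n$. If $g(0)=0$, then $\hat g$ preserves $m$. Let $(X,\mathcal{A},\mu)$ be a probability space, let $f_n\colon X\to X$ be measurable, measure-preserving transformations, and let $T_n=f_n\circ\cdots\circ f_1$, $n\in\mathbb{N}$. The sequence $\{T_n\}_{n\in\mathbb{N}}$ is called ergodic if $\lim_{N\to\infty}\left\|\frac1N\sum_{n=1}^N\varphi\circ T_n-\int_X\varphi\,d\mu\right\|_{2}=0$ for every complex-valued $\varphi\in L^2(\mu)$, where $\|\cdot\|_2$ is the $L^2(\mu)$ norm, and it is called mixing if all its subsequences are ergodic. For boundary maps this is applied with $(X,\mu)=(\partial\mathbb{D},m)$. The sequence $\{g_n\}_{n\in\mathbb{N}}$ is contracting if $G_n\to0$ uniformly on compact subsets of $\mathbb{D}$ as $n\to\infty$. A sequence $\{z_n\}_{n\in\mathbb{N}}\subset\partial\mathbb{D}$ is equidistributed on $\partial\mathbb{D}$ if for every arc $S\subset\partial\mathbb{D}$, the proportion of indices $1\le j\le n$ with $z_j\in S$ tends to $m(S)$ as $n\to\infty$.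
   Formalization: In (iii) it is additionally assumed that G_n'(0) ≠ 0 for all n ≥ 1, so that arg G_n'(0) is defined; without it (g_1(z) = z², later g_n a fixed irrational rotation) the sequence is not contracting and arg G_n'(0) is undefined. *)

theory Defs
  imports "HOL-Probability.Probability" "HOL-Complex_Analysis.Complex_Analysis"
begin

section \<open>The unit circle and inner functions\<close>

text \<open>Normalised Lebesgue measure, as a Borel measure whose space is the unit circle.\<close>

definition circle_measure :: "complex measure" where
  "circle_measure =
     distr (uniform_measure lborel {0..<2 * pi}) (restrict_space borel (sphere 0 1)) cis"

definition has_radial_limit :: "(complex \<Rightarrow> complex) \<Rightarrow> complex \<Rightarrow> complex \<Rightarrow> bool" where
  "has_radial_limit g \<zeta> l \<longleftrightarrow> ((\<lambda>r::real. g (of_real r * \<zeta>)) \<longlongrightarrow> l) (at_left 1)"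

text \<open>Functions on the disc are total functions on the complex plane whose values outside
  the open unit disc play no role.\<close>

definition inner_function :: "(complex \<Rightarrow> complex) \<Rightarrow> bool" where
  "inner_function g \<longleftrightarrow>
     g holomorphic_on ball 0 1 \<and> g ` ball 0 1 \<subseteq> ball 0 1 \<and>
     (AE \<zeta> in circle_measure. \<exists>l. norm l = 1 \<and> has_radial_limit g \<zeta> l)"

text \<open>The boundary map is only defined almost everywhere. On the exceptional null set it is
  given the value 1, which makes it a Borel map of the circle to itself.\<close>

definition boundary_map :: "(complex \<Rightarrow> complex) \<Rightarrow> complex \<Rightarrow> complex" where
  "boundary_map g \<zeta> =
     (if \<exists>l. norm l = 1 \<and> has_radial_limit g \<zeta> l
      then Lim (at_left 1) (\<lambda>r::real. g (of_real r * \<zeta>)) else 1)"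

text \<open>Sequences are indexed from 1, so \<open>g 0\<close> is never used:
  \<open>comp_seq g n = g n \<circ> \<dots> \<circ> g 1\<close>.\<close>

primrec comp_seq :: "(nat \<Rightarrow> 'a \<Rightarrow> 'a) \<Rightarrow> nat \<Rightarrow> 'a \<Rightarrow> 'a" where
  "comp_seq g 0 = id"
| "comp_seq g (Suc n) = g (Suc n) \<circ> comp_seq g n"

definition contracting :: "(nat \<Rightarrow> complex \<Rightarrow> complex) \<Rightarrow> bool" where
  "contracting g \<longleftrightarrow>
     (\<forall>K. compact K \<and> K \<subseteq> ball 0 1 \<longrightarrow> uniform_limit K (comp_seq g) (\<lambda>_. 0) sequentially)"

section \<open>Ergodic and mixing sequences of maps\<close>

definition square_integrable :: "'a measure \<Rightarrow> ('a \<Rightarrow> complex) \<Rightarrow> bool" where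
  "square_integrable M \<phi> \<longleftrightarrow>
     \<phi> \<in> borel_measurable M \<and> integrable M (\<lambda>x. (norm (\<phi> x))\<^sup>2)"

definition l2_norm :: "'a measure \<Rightarrow> ('a \<Rightarrow> complex) \<Rightarrow> real" where
  "l2_norm M \<phi> = sqrt (\<integral>x. (norm (\<phi> x))\<^sup>2 \<partial>M)"

text \<open>Meant for a probability space \<open>M\<close> and measure-preserving \<open>T n\<close>; then the function
  whose norm is taken is square integrable.\<close>

definition ergodic_seq :: "'a measure \<Rightarrow> (nat \<Rightarrow> 'a \<Rightarrow> 'a) \<Rightarrow> bool" where
  "ergodic_seq M T \<longleftrightarrow>
     (\<forall>\<phi>. square_integrable M \<phi> \<longrightarrow>
       (\<lambda>N. l2_norm M (\<lambda>x. (\<Sum>n=1..N. \<phi> (T n x)) / of_nat N - (\<integral>y. \<phi> y \<partial>M)))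
         \<longlonglongrightarrow> 0)"

text \<open>A strictly increasing \<open>r\<close> has \<open>r 1 \<ge> 1\<close>, and \<open>ergodic_seq\<close> ignores the index 0, so
  this ranges over exactly the subsequences of \<open>T 1, T 2, \<dots>\<close>.\<close>

definition mixing_seq :: "'a measure \<Rightarrow> (nat \<Rightarrow> 'a \<Rightarrow> 'a) \<Rightarrow> bool" where
  "mixing_seq M T \<longleftrightarrow> (\<forall>r. strict_mono r \<longrightarrow> ergodic_seq M (\<lambda>k. T (r k)))"

section \<open>Equidistribution\<close>

text \<open>Arcs may be open, closed, half-open or degenerate, and may be the whole circle.\<close>

definition circle_arc :: "complex set \<Rightarrow> bool" where
  "circle_arc S \<longleftrightarrow> (\<exists>I::real set. is_interval I \<and> S = cis ` I)"

definition equidistributed :: "(nat \<Rightarrow> complex) \<Rightarrow> bool" where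
  "equidistributed z \<longleftrightarrow>
     (\<forall>S. circle_arc S \<longrightarrow>
       (\<lambda>n. real (card {j \<in> {1..n}. z j \<in> S}) / real n) \<longlonglongrightarrow> measure circle_measure S)"

end

theory Submission
  imports Defs "HOL-Library.Log_Nat"
begin

text \<open>
  If \<open>h\<close> is inner with \<open>h 0 = 0\<close> and \<open>h'\<close> is its derivative at \<open>0\<close>, then \<open>(h z / z) ^ k\<close> is bounded
  holomorphic with value \<open>h' ^ k\<close> at \<open>0\<close>, so the mean of \<open>\<zeta> \<mapsto> h \<zeta> ^ k * cnj \<zeta> ^ k\<close> over the circle is
  \<open>h' ^ k\<close>. As boundary maps preserve the measure and compose almost everywhere, the correlation of
  the \<open>k\<close>-th powers of the boundary maps of \<open>G m\<close> and \<open>G n\<close>, \<open>m \<le> n\<close>, is the \<open>k\<close>-th power of the product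
  of the derivatives at \<open>0\<close> of \<open>g (m + 1), \<dots>, g n\<close>. Trigonometric polynomials are dense in \<open>L2\<close>, so
  ergodicity says that for every \<open>k \<ge> 1\<close> these correlations average to \<open>0\<close> over \<open>m, n \<le> N\<close>. For positive
  derivatives only \<open>k = 1\<close> matters and (i), (ii) are statements about products of numbers in \<open>(0, 1]\<close>.
  If the sequence is not contracting, the moduli of the derivatives of \<open>G n\<close> have a positive limit, the
  correlations are asymptotic to those of their arguments, and (iii) is Weyl's criterion.

  That composites of inner functions are inner, with boundary maps composing, is Fatou's theorem: a
  composite is the Poisson integral of the composed boundary maps, and Poisson integrals converge
  radially at Lebesgue points.
\<close>

section \<open>The Poisson formula\<close>

text \<open>Composing boundary maps is delicate because \<open>g (r * \<zeta>)\<close> approaches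
  its limit along a curve that need not be a radius, so a radial limit of \<open>f\<close> at that
  point says nothing directly about \<open>f \<circ> g\<close>. Poisson integrals remove the curve
  from the argument. First powers suffice for positive derivatives because p ^ k \<le> p for p in
  [0, 1]. In (i), a last block holding a fixed fraction of the indices bounds a double Cesaro mean
  from below, and if its product is small it leaves few large terms. In (ii), skipping indices only
  lengthens products; if the condition fails, one bad subsequence spends the later half of the times
  up to each 2 ^ k inside a single long block with large product. In (iii), the moduli have a
  positive limit by a quantitative Schwarz-Pick estimate: if the product of the nonzero |g_n'(0)|
  tends to 0, the sum of 1 - |g_n'(0)| ^ 2 diverges and compact sets shrink to 0. Density is used
  through two induction principles: closure under bounded pointwise limits serves integrals, closure
  under uniform limits serves averages along a sequence of points.\<close>

abbreviation \<mu> :: "complex measure" where "\<mu> \<equiv> circle_measure"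

lemma measurable_cis: "cis \<in> measurable borel (restrict_space borel (sphere 0 1))"
  by (intro measurable_restrict_space2 borel_measurable_continuous_onI continuous_intros) auto

lemma space_circle_measure [simp]: "space \<mu> = sphere 0 1"
  by (simp add: circle_measure_def space_restrict_space)

lemma sets_circle_measure [measurable_cong]:
  "sets \<mu> = sets (restrict_space borel (sphere 0 1))"
  by (simp add: circle_measure_def)

lemma prob_space_circle_measure: "prob_space \<mu>"
proof -
  have "prob_space (uniform_measure lborel {0..<2 * pi})"
    by (rule prob_space_uniform_measure) auto
  thus ?thesis
    unfolding circle_measure_def using measurable_cis
    by (intro prob_space.prob_space_distr) simp_all
qed

interpretation circle: prob_space \<mu>
  by (rule prob_space_circle_measure)

lemma borel_measurable_circle_continuous:
  "continuous_on (sphere 0 1) f \<Longrightarrow> f \<in> borel_measurable \<mu>"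
  by (simp add: measurable_cong_sets[OF sets_circle_measure refl]
      borel_measurable_continuous_on_restrict)

lemma borel_measurable_circle_iff:
  "f \<in> borel_measurable \<mu> \<longleftrightarrow> f \<in> borel_measurable (restrict_space borel (sphere 0 1))"
  by (simp add: measurable_cong_sets[OF sets_circle_measure refl])

lemma borel_measurable_circle_cis:
  assumes "f \<in> borel_measurable \<mu>"
  shows "(\<lambda>t. f (cis t)) \<in> borel_measurable borel"
  using measurable_compose[OF measurable_cis, of f borel] assms
  by (simp add: borel_measurable_circle_iff)

lemma integral_circle_measure:
  fixes f :: "complex \<Rightarrow> 'b::{banach, second_countable_topology}"
  assumes "f \<in> borel_measurable \<mu>"
  shows "(\<integral>x. f x \<partial>\<mu>) = (LINT t:{0..<2 * pi}|lborel. f (cis t)) /\<^sub>R (2 * pi)"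
proof -
  have [measurable]: "(\<lambda>t. f (cis t)) \<in> borel_measurable borel"
    using assms by (rule borel_measurable_circle_cis)
  have eq: "uniform_measure lborel {0..<2 * pi} =
      density lborel (\<lambda>t. ennreal (indicator {0..<2 * pi} t / (2 * pi)))"
    unfolding uniform_measure_def
    by (intro density_cong AE_I2) (auto simp: indicator_def divide_ennreal simp flip: ennreal_1)
  have "(\<integral>x. f x \<partial>\<mu>) = (\<integral>t. f (cis t) \<partial>uniform_measure lborel {0..<2 * pi})"
    unfolding circle_measure_def
    using assms measurable_cis
    by (intro integral_distr)
       (simp_all add: borel_measurable_circle_iff measurable_cong_sets[OF sets_uniform_measure refl])
  also have "\<dots> = (\<integral>t. (indicator {0..<2 * pi} t / (2 * pi)) *\<^sub>R f (cis t) \<partial>lborel)"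
    unfolding eq by (rule integral_density) auto
  also have "\<dots> = (LINT t:{0..<2 * pi}|lborel. f (cis t)) /\<^sub>R (2 * pi)"
  proof -
    have "(\<integral>t. (indicator {0..<2 * pi} t / (2 * pi)) *\<^sub>R f (cis t) \<partial>lborel) =
        (\<integral>t. inverse (2 * pi) *\<^sub>R indicator {0..<2 * pi} t *\<^sub>R f (cis t) \<partial>lborel)"
      by (intro Bochner_Integration.integral_cong refl) (simp add: indicator_def inverse_eq_divide)
    thus ?thesis
      unfolding set_lebesgue_integral_def integral_scaleR_right .
  qed
  finally show ?thesis .
qed

text \<open>Fatou's theorem is obtained almost everywhere in the angle; this carries it to the
  circle. Measurability of the set is what the transfer through \<open>distr\<close> in both
  directions needs.\<close>

lemma AE_circle_measure_iff:
  assumes "{x \<in> sphere 0 1. P x} \<in> sets \<mu>"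
  shows "(AE x in \<mu>. P x) \<longleftrightarrow> (AE t in lborel. t \<in> {0..<2 * pi} \<longrightarrow> P (cis t))"
  using assms unfolding circle_measure_def
  by (subst AE_distr_iff)
     (auto simp: space_restrict_space measurable_cis AE_uniform_measure
        measurable_cong_sets[OF sets_uniform_measure refl])

lemma integrable_circle_bounded:
  fixes f :: "complex \<Rightarrow> 'b::{banach, second_countable_topology}"
  assumes "f \<in> borel_measurable \<mu>" "\<And>x. norm x = 1 \<Longrightarrow> norm (f x) \<le> B"
  shows "integrable \<mu> f"
  using assms by (intro circle.integrable_const_bound[of _ B]) (auto intro!: AE_I2)

definition poisson_kernel :: "complex \<Rightarrow> complex \<Rightarrow> real" where
  "poisson_kernel z \<zeta> = (1 - (norm z)\<^sup>2) / (norm (\<zeta> - z))\<^sup>2"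

text \<open>Cauchy's formula at z for \<open>K\<close>, which is \<phi> times a multiplier that is
  holomorphic on the closed disc and equals 1 at z. On the circle, the multiplier together with the
  factor w / (w - z) from the contour integral is exactly the Poisson kernel.\<close>

lemma poisson_formula_holomorphic:
  assumes "\<phi> holomorphic_on ball 0 R" "R > 1" "norm z < 1"
  shows "(\<integral>\<zeta>. poisson_kernel z \<zeta> *\<^sub>R \<phi> \<zeta> \<partial>\<mu>) = \<phi> z"
proof -
  define K where "K w = \<phi> w * (1 - (norm z)\<^sup>2) / (1 - cnj z * w)" for w
  have nz: "1 - cnj z * w \<noteq> 0" if "norm w \<le> 1" for w
  proof
    assume "1 - cnj z * w = 0"
    hence "1 = norm z * norm w" by (metis eq_iff_diff_eq_0 complex_mod_cnj norm_mult norm_one)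
    also have "\<dots> \<le> norm z * 1" using that by (intro mult_left_mono) auto
    finally show False using assms by simp
  qed
  have hol: "\<phi> holomorphic_on cball 0 1"
    using assms by (auto intro: holomorphic_on_subset)
  have "K holomorphic_on cball 0 1"
    unfolding K_def using hol nz by (auto intro!: holomorphic_intros)
  hence "continuous_on (cball 0 1) K" "K holomorphic_on ball 0 1"
    by (auto intro: holomorphic_on_imp_continuous_on holomorphic_on_subset)
  hence "((\<lambda>u. K u / (u - z)) has_contour_integral (2 * of_real pi * \<i> * K z)) (circlepath 0 1)"
    using Cauchy_integral_circlepath[of 0 1 K z] assms by (simp add: dist_norm)
  hence 1: "((\<lambda>t. K (cis t) / (cis t - z) * \<i> * cis t) has_integral (2 * of_real pi * \<i> * K z)) {0..2 * pi}"
    unfolding circlepath_def by (subst (asm) has_contour_integral_part_circlepath_iff) auto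
  have Kz: "K z = \<phi> z"
  proof -
    have "1 - cnj z * z = 1 - of_real ((norm z)\<^sup>2)"
      using complex_norm_square[of z] by (simp add: mult.commute)
    thus ?thesis using nz[of z] assms by (simp add: K_def)
  qed
  have eq: "K (cis t) / (cis t - z) * \<i> * cis t = \<i> * (poisson_kernel z (cis t) *\<^sub>R \<phi> (cis t))" for t
  proof -
    \<comment> \<open>On the circle the conjugate of w is 1 / w, so |w - z| ^ 2 = (w - z) (1 - cnj z
      w) / w: this matches the denominators of the Cauchy and Poisson kernels.\<close>
    have "of_real ((norm (cis t - z))\<^sup>2) = (cis t - z) * (cnj (cis t) - cnj z)"
      using complex_norm_square[of "cis t - z"] by simp
    also have "\<dots> = (cis t - z) * (1 - cnj z * cis t) / cis t"
      by (simp add: cis_cnj field_simps flip: cis_inverse)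
    finally have "complex_of_real ((norm (cis t - z))\<^sup>2) = (cis t - z) * (1 - cnj z * cis t) / cis t" .
    moreover have "cis t \<noteq> z" using assms by auto
    moreover have "1 - cnj z * cis t \<noteq> 0" using nz[of "cis t"] by simp
    ultimately show ?thesis
      by (simp add: K_def poisson_kernel_def scaleR_conv_of_real mult_ac)
  qed
  have cont: "continuous_on (sphere 0 1) (\<lambda>\<zeta>. poisson_kernel z \<zeta> *\<^sub>R \<phi> \<zeta>)"
    unfolding poisson_kernel_def using assms(3) holomorphic_on_imp_continuous_on[OF hol]
    by (intro continuous_intros) (auto intro: continuous_on_subset)
  have meas: "(\<lambda>\<zeta>. poisson_kernel z \<zeta> *\<^sub>R \<phi> \<zeta>) \<in> borel_measurable \<mu>"
    by (rule borel_measurable_circle_continuous[OF cont])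
  let ?f = "\<lambda>t. poisson_kernel z (cis t) *\<^sub>R \<phi> (cis t)"
  have contf: "continuous_on {0..2 * pi} ?f"
    by (rule continuous_on_compose2[OF cont]) (auto intro!: continuous_intros)
  have "(?f has_integral (2 * of_real pi * \<phi> z)) {0..2 * pi}"
    using has_integral_mult_right[OF 1, of "- \<i>"] unfolding eq Kz by (simp add: mult_ac)
  hence "(LINT t:{0..2 * pi}|lborel. ?f t) = 2 * of_real pi * \<phi> z"
    using set_borel_integral_eq_integral(2)[OF borel_integrable_atLeastAtMost'[OF contf]]
    by (simp add: integral_unique)
  moreover have [measurable]: "?f \<in> borel_measurable borel"
    by (rule borel_measurable_circle_cis[OF meas])
  have "(LINT t:{0..<2 * pi}|lborel. ?f t) = (LINT t:{0..2 * pi}|lborel. ?f t)"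
  proof (rule set_integral_cong_set)
    show "AE x in lborel. (x \<in> {0..2 * pi}) = (x \<in> {0..<2 * pi})"
      using AE_lborel_singleton[of "2 * pi"] by eventually_elim auto
  qed (unfold set_borel_measurable_def, measurable)
  ultimately have "(LINT t:{0..<2 * pi}|lborel. ?f t) = 2 * of_real pi * \<phi> z"
    by metis
  hence "(\<integral>\<zeta>. poisson_kernel z \<zeta> *\<^sub>R \<phi> \<zeta> \<partial>\<mu>) =
      (2 * of_real pi * \<phi> z) /\<^sub>R (2 * pi)"
    using integral_circle_measure[OF meas] by argo
  also have "\<dots> = \<phi> z"
    by (simp add: scaleR_conv_of_real)
  finally show ?thesis .
qed

section \<open>Classes of functions on the circle\<close>

text \<open>Continuous functions lying above the indicator of a closed set and tending to it
  pointwise; off the set the distance is positive, so they are eventually 0. They serve both to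
  reach Borel sets from continuous functions and to bound frequencies from above.\<close>

lemma infdist_bump_tendsto:
  assumes "closed C" "C \<noteq> {}"
  shows "(\<lambda>i. max 0 (1 - real i * infdist x C)) \<longlonglongrightarrow> indicator C x"
proof (cases "x \<in> C")
  case False
  hence pos: "infdist x C > 0"
    using assms in_closed_iff_infdist_zero[of C x] infdist_nonneg[of x C] by fastforce
  have "eventually (\<lambda>i. max 0 (1 - real i * infdist x C) = 0) sequentially"
    using eventually_ge_at_top[of "nat \<lceil>1 / infdist x C\<rceil>"]
  proof eventually_elim
    case (elim i)
    hence "real i \<ge> 1 / infdist x C" by linarith
    hence "real i * infdist x C \<ge> 1" using pos by (simp add: field_simps)
    thus ?case by simp
  qed
  thus ?thesis using False by (simp add: tendsto_eventually)
qed simp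

lemma inverse_eq_cnj: "norm x = 1 \<Longrightarrow> inverse x = cnj x"
  by (rule inverse_unique) (use complex_norm_square[of x] in simp)

text \<open>An induction principle for continuous functions on the circle. Products are deliberately
  absent from the axioms: the properties of interest concern integrals or averages and are only
  linear.\<close>

locale circle_uniform_class =
  fixes P :: "(complex \<Rightarrow> complex) \<Rightarrow> bool"
  assumes pow: "\<And>k. P (\<lambda>z. z ^ k)"
    and cnj_pow: "\<And>k. P (\<lambda>z. cnj z ^ k)"
    and add: "\<And>f g. P f \<Longrightarrow> P g \<Longrightarrow> P (\<lambda>z. f z + g z)"
    and scale: "\<And>f c. P f \<Longrightarrow> P (\<lambda>z. c * f z)"
    and uniform_lim: "\<And>f s B. (\<And>i. P (s i)) \<Longrightarrow> (\<And>i x. norm x = 1 \<Longrightarrow> norm (s i x) \<le> B)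
      \<Longrightarrow> uniform_limit (sphere 0 1) s f sequentially \<Longrightarrow> P f"
begin

text \<open>A constant sequence converges uniformly on the circle to every function that agrees with
  it there. So \<open>P\<close> sees only values on the circle; the bound is asked for by the axiom
  on limits.\<close>

lemma cong:
  assumes "P f" "\<And>x. norm x = 1 \<Longrightarrow> norm (f x) \<le> B" "\<And>x. norm x = 1 \<Longrightarrow> f x = g x"
  shows "P g"
  by (rule uniform_lim[of "\<lambda>_. f" B]) (use assms in \<open>auto simp: uniform_limit_iff\<close>)

lemma sum: "P (\<lambda>z. \<Sum>i\<in>A. f i z)" if "finite A" "\<And>i. i \<in> A \<Longrightarrow> P (f i)"
  using that
proof (induction A rule: finite_induct)
  case empty
  show ?case using scale[OF pow[of 0], of 0] by simp
next
  case (insert x F)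
  thus ?case by (simp add: add)
qed

text \<open>Since \<open>P\<close> is not closed under products, polynomials in the two real
  coordinates are reached by a stronger invariant: all integer power multiples of f satisfy
  \<open>P\<close> at once. This is stable under multiplication by z and its inverse. The bound is
  there so that \<open>cong\<close> applies.\<close>

definition P_powi :: "(complex \<Rightarrow> complex) \<Rightarrow> bool" where
  "P_powi f \<longleftrightarrow> (\<forall>j::int. P (\<lambda>z. z powi j * f z)) \<and> (\<exists>B. \<forall>x. norm x = 1 \<longrightarrow> norm (f x) \<le> B)"

lemma P_powi_one: "P_powi (\<lambda>_. 1)"
  unfolding P_powi_def
proof (intro conjI allI)
  fix j :: int
  show "P (\<lambda>z. z powi j * 1)"
  proof (cases "j \<ge> 0")
    case True
    thus ?thesis using pow[of "nat j"] by (simp add: power_int_def)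
  next
    case False
    show ?thesis
    proof (rule cong[OF cnj_pow[of "nat (- j)"], of 1])
      fix x :: complex
      assume x: "norm x = 1"
      hence "inverse x = cnj x" by (rule inverse_eq_cnj)
      thus "cnj x ^ nat (- j) = x powi j * 1" using False by (simp add: power_int_def)
    qed (simp add: norm_power)
  qed
qed auto

lemma P_powi_add: "P_powi f \<Longrightarrow> P_powi g \<Longrightarrow> P_powi (\<lambda>z. f z + g z)"
  unfolding P_powi_def
proof (intro conjI allI; elim conjE exE)
  fix j :: int
  assume "\<forall>j. P (\<lambda>z. z powi j * f z)" "\<forall>j. P (\<lambda>z. z powi j * g z)"
  thus "P (\<lambda>z. z powi j * (f z + g z))" by (simp add: add ring_distribs)
next
  fix B B' assume "\<forall>x. norm x = 1 \<longrightarrow> norm (f x) \<le> B" "\<forall>x. norm x = 1 \<longrightarrow> norm (g x) \<le> B'"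
  thus "\<exists>B. \<forall>x. norm x = 1 \<longrightarrow> norm (f x + g x) \<le> B"
    by (intro exI[of _ "B + B'"]) (auto intro!: norm_triangle_le add_mono)
qed

lemma P_powi_scale:
  assumes "P_powi f" shows "P_powi (\<lambda>z. c * f z)"
  unfolding P_powi_def
proof (intro conjI allI)
  fix j :: int
  show "P (\<lambda>z. z powi j * (c * f z))"
    using assms scale[of "\<lambda>z. z powi j * f z" c] by (simp add: P_powi_def mult_ac)
next
  from assms obtain B where "\<And>x. norm x = 1 \<Longrightarrow> norm (f x) \<le> B" by (auto simp: P_powi_def)
  thus "\<exists>B. \<forall>x. norm x = 1 \<longrightarrow> norm (c * f x) \<le> B"
    by (intro exI[of _ "norm c * B"]) (auto simp: norm_mult intro!: mult_left_mono)
qed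

lemma P_powi_powi:
  assumes "P_powi f" shows "P_powi (\<lambda>z. z powi j * f z)"
  unfolding P_powi_def
proof (intro conjI allI)
  from assms obtain B where B: "\<And>x. norm x = 1 \<Longrightarrow> norm (f x) \<le> B" by (auto simp: P_powi_def)
  thus "\<exists>B. \<forall>x. norm x = 1 \<longrightarrow> norm (x powi j * f x) \<le> B"
    by (intro exI[of _ B]) (auto simp: norm_mult norm_power_int)
  fix i :: int
  have 1: "P (\<lambda>z. z powi (i + j) * f z)" using assms by (simp add: P_powi_def)
  show "P (\<lambda>z. z powi i * (z powi j * f z))"
  proof (rule cong[OF 1, of B])
    fix x :: complex
    assume x: "norm x = 1"
    hence "x \<noteq> 0" by auto
    thus "x powi (i + j) * f x = x powi i * (x powi j * f x)"
      by (simp add: power_int_add mult.assoc)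
  qed (auto simp: norm_mult norm_power_int B)
qed

lemma P_powi_cong:
  assumes "P_powi f" "\<And>x. norm x = 1 \<Longrightarrow> f x = g x"
  shows "P_powi g"
  unfolding P_powi_def
proof (intro conjI allI)
  from assms obtain B where B: "\<And>x. norm x = 1 \<Longrightarrow> norm (f x) \<le> B" by (auto simp: P_powi_def)
  thus "\<exists>B. \<forall>x. norm x = 1 \<longrightarrow> norm (g x) \<le> B" using assms(2) by metis
  fix i :: int
  have 1: "P (\<lambda>z. z powi i * f z)" using assms by (simp add: P_powi_def)
  show "P (\<lambda>z. z powi i * g z)"
    by (rule cong[OF 1, of B])
       (auto simp: norm_mult norm_power_int B simp flip: assms(2))
qed

text \<open>The factor f is kept arbitrary so that a product p * q is handled one factor at a time,
  q * f being the new factor.\<close>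

lemma P_powi_real_polynomial:
  assumes "real_polynomial_function p" "P_powi f"
  shows "P_powi (\<lambda>z. of_real (p z) * f z)"
  using assms
proof (induction p arbitrary: f rule: real_polynomial_function.induct)
  case (linear h)
  \<comment> \<open>A linear functional is h 1 * Re z + h \<i> * Im z, and on the circle Re z and Im
    z are (z + 1 / z) / 2 and (z - 1 / z) / (2 \<i>).\<close>
  let ?g = "\<lambda>z. (of_real (h 1) / 2) * (z powi 1 * f z + z powi (-1) * f z)
     + (of_real (h \<i>) / (2 * \<i>)) * (z powi 1 * f z + (-1) * (z powi (-1) * f z))"
  have "P_powi ?g"
    by (intro P_powi_add P_powi_scale P_powi_powi linear.prems)
  thus ?case
  proof (rule P_powi_cong)
    fix z :: complex
    assume z: "norm z = 1"
    interpret h: bounded_linear h by fact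
    have "h (Re z *\<^sub>R 1 + Im z *\<^sub>R \<i>) = Re z * h 1 + Im z * h \<i>"
      by (simp only: h.add h.scaleR real_scaleR_def)
    moreover have "Re z *\<^sub>R 1 + Im z *\<^sub>R \<i> = z"
      by (simp add: complex_eq_iff)
    ultimately have hz: "h z = Re z * h 1 + Im z * h \<i>"
      by metis
    have "z powi (-1) = cnj z"
      using z by (simp add: power_int_minus inverse_eq_cnj)
    hence "?g z = (of_real (h 1) / 2) * ((z + cnj z) * f z) + (of_real (h \<i>) / (2 * \<i>)) * ((z - cnj z) * f z)"
      by (simp add: algebra_simps)
    moreover have "z + cnj z = 2 * of_real (Re z)" "z - cnj z = (2 * \<i>) * of_real (Im z)"
      by (simp_all add: complex_eq_iff)
    ultimately show "?g z = of_real (h z) * f z"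
      unfolding hz by (simp add: algebra_simps)
  qed
next
  case (add p q)
  thus ?case by (simp add: P_powi_add ring_distribs)
next
  case (mult p q)
  thus ?case by (simp add: mult.assoc)
qed (auto intro: P_powi_scale)

lemma continuous:
  assumes "continuous_on (sphere 0 1) f"
  shows "P f"
proof -
  obtain g where g: "uniform_limit (sphere 0 1) g f sequentially" "\<And>n::nat. polynomial_function (g n)"
    using Stone_Weierstrass_uniform_limit[OF _ assms] by auto
  have Pg: "P (g n)" for n
  proof -
    have "real_polynomial_function (Re \<circ> g n)" "real_polynomial_function (Im \<circ> g n)"
      using g(2)[of n] unfolding polynomial_function_def by (auto simp: bounded_linear_Re bounded_linear_Im)
    hence "P_powi (\<lambda>z. of_real (Re (g n z)) * 1 + \<i> * (of_real (Im (g n z)) * 1))"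
      using P_powi_one by (intro P_powi_add P_powi_scale P_powi_real_polynomial) (auto simp: o_def)
    hence "P_powi (g n)" by (simp flip: complex_eq)
    hence "P (\<lambda>z. z powi 0 * g n z)" unfolding P_powi_def by blast
    thus ?thesis by simp
  qed
  have "eventually (\<lambda>n. \<forall>x\<in>sphere 0 1. dist (g n x) (f x) < 1) sequentially"
    using uniform_limitD[OF g(1), of 1] by simp
  then obtain N where N: "\<And>n x. n \<ge> N \<Longrightarrow> norm x = 1 \<Longrightarrow> dist (g n x) (f x) < 1"
    unfolding eventually_sequentially by (metis mem_sphere_0)
  obtain B where "\<forall>y\<in>f ` sphere 0 1. norm y \<le> B"
    using compact_imp_bounded[OF compact_continuous_image[OF assms compact_sphere]]
    unfolding bounded_iff by blast
  hence B: "norm (f x) \<le> B" if "norm x = 1" for x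
    using that by simp
  show ?thesis
  \<comment> \<open>The first N approximants are dropped: only from N on are they within 1 of f,
    which gives the common bound B + 1.\<close>
  proof (rule uniform_lim[of "\<lambda>i. g (i + N)" "B + 1" f])
    show "P (g (i + N))" for i by (rule Pg)
    show "norm (g (i + N) x) \<le> B + 1" if "norm x = 1" for i x
      using N[of "i + N" x] B[of x] that norm_triangle_sub[of "g (i + N) x" "f x"]
      by (auto simp: dist_norm)
    show "uniform_limit (sphere 0 1) (\<lambda>i. g (i + N)) f sequentially"
      using g(1) filterlim_add_const_nat_at_top[of N] by (rule filterlim_compose)
  qed
qed

end

text \<open>Bounded pointwise limits, as dominated convergence permits them, carry a property beyond
  continuous functions to Borel indicators and simple functions.\<close>

locale circle_function_class =
  fixes P :: "(complex \<Rightarrow> complex) \<Rightarrow> bool"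
  assumes pow: "\<And>k. P (\<lambda>z. z ^ k)"
    and cnj_pow: "\<And>k. P (\<lambda>z. cnj z ^ k)"
    and add: "\<And>f g. P f \<Longrightarrow> P g \<Longrightarrow> P (\<lambda>z. f z + g z)"
    and scale: "\<And>f c. P f \<Longrightarrow> P (\<lambda>z. c * f z)"
    and lim: "\<And>f s B. (\<And>i. P (s i)) \<Longrightarrow> (\<And>i x. norm x = 1 \<Longrightarrow> norm (s i x) \<le> B)
      \<Longrightarrow> (\<And>x. norm x = 1 \<Longrightarrow> (\<lambda>i::nat. s i x) \<longlonglongrightarrow> f x) \<Longrightarrow> P f"
begin

sublocale uniform?: circle_uniform_class P
proof
  fix f s B
  assume s: "\<And>i::nat. P (s i)" "\<And>i x. norm x = 1 \<Longrightarrow> norm (s i x) \<le> B"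
    and f: "uniform_limit (sphere 0 1) s f sequentially"
  show "P f"
    by (rule lim[OF s]) (use tendsto_uniform_limitI[OF f] in simp_all)
qed (rule pow cnj_pow add scale; assumption?)+

text \<open>Dynkin's theorem with the closed sets as generator stable under intersections; closed
  sets are reached through the bump functions.\<close>

lemma indicator:
  assumes "A \<in> sets borel"
  shows "P (indicator A)"
proof -
  have "Int_stable (Collect closed :: complex set set)"
    by (auto simp: Int_stable_def)
  moreover have "Collect closed \<subseteq> Pow (UNIV :: complex set)"
    by simp
  moreover have "A \<in> sigma_sets UNIV (Collect closed)"
    using assms by (simp add: borel_eq_closed)
  ultimately show ?thesis
  proof (induction A rule: sigma_sets_induct_disjoint)
    case (basic C)
    hence C: "closed C" by simp
    show ?case
    proof (cases "C = {}")
      case True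
      thus ?thesis using scale[OF pow[of 0], of 0] by (simp add: indicator_def)
    next
      case False
      show ?thesis
      proof (rule lim[of "\<lambda>i z. of_real (max 0 (1 - real i * infdist z C))" 1])
        show "P (\<lambda>z. of_real (max 0 (1 - real i * infdist z C)))" for i
          by (intro continuous continuous_intros)
        show "norm (complex_of_real (max 0 (1 - real i * infdist x C))) \<le> 1" for i x
          by (simp add: infdist_nonneg)
        show "(\<lambda>i. complex_of_real (max 0 (1 - real i * infdist x C))) \<longlonglongrightarrow> indicator C x" for x
          using tendsto_of_real[OF infdist_bump_tendsto[OF C False, of x]] by (simp add: of_real_indicator)
      qed
    qed
  next
    case empty
    show ?case using scale[OF pow[of 0], of 0] by (simp add: indicator_def)
  next
    case (compl A)
    have "P (\<lambda>z. 1 + (-1) * indicator A z)"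
      using pow[of 0] by (intro add scale compl) auto
    moreover have "(\<lambda>z. 1 + (-1) * indicator A z) = (indicator (UNIV - A) :: complex \<Rightarrow> complex)"
      by (auto simp: indicator_def)
    ultimately show ?case by simp
  next
    case (union A)
    show ?case
    proof (rule lim[of "\<lambda>n z. \<Sum>i<n. indicator (A i) z" 1])
      show "P (\<lambda>z. \<Sum>i<n. indicator (A i) z)" for n
        by (rule sum) (use union in auto)
      \<comment> \<open>Disjointness makes every partial sum an indicator, hence bounded by 1 as
        \<open>lim\<close> requires.\<close>
      have eq: "(\<Sum>i<n. indicator (A i) x) = (indicator (\<Union>i<n. A i) x :: complex)" for n x
        using union(1)
        by (subst indicator_UN_disjoint)
           (auto simp: disjoint_family_on_def)
      show "cmod (\<Sum>i<n. indicator (A i) x) \<le> 1" for n x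
        unfolding eq by (simp add: indicator_def)
      show "(\<lambda>n. \<Sum>i<n. indicator (A i) x) \<longlonglongrightarrow> (indicator (\<Union> (range A)) x :: complex)" for x
        unfolding eq by (rule LIMSEQ_indicator_UN)
    qed
  qed
qed

lemma simple_function:
  assumes "simple_function \<mu> f"
  shows "P f"
proof -
  let ?g = "\<lambda>x. \<Sum>y\<in>f ` sphere 0 1. y * indicator (f -` {y} \<inter> sphere 0 1) x"
  have fin: "finite (f ` sphere 0 1)"
    using simple_functionD(1)[OF assms] by simp
  have Pg: "P ?g"
  proof (intro sum scale indicator fin)
    fix y
    have "f -` {y} \<inter> sphere 0 1 \<in> sets \<mu>"
      using simple_functionD(2)[OF assms, of "{y}"] by simp
    thus "f -` {y} \<inter> sphere 0 1 \<in> sets borel"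
      by (auto simp: sets_circle_measure sets_restrict_space_iff)
  qed
  have eq: "f x = ?g x" if "norm x = 1" for x
  proof -
    have "f x = (\<Sum>y\<in>f ` space \<mu>. indicator (f -` {y} \<inter> space \<mu>) x *\<^sub>R y)"
      by (rule simple_function_indicator_representation_banach[OF assms]) (use that in simp)
    also have "\<dots> = ?g x"
      unfolding space_circle_measure by (intro sum.cong refl) (simp add: indicator_def)
    finally show ?thesis .
  qed
  obtain B where "\<forall>y\<in>f ` sphere 0 1. norm y \<le> B"
    using finite_imp_bounded[OF fin] unfolding bounded_iff by blast
  hence B: "norm (f x) \<le> B" if "norm x = 1" for x
    using that by simp
  show ?thesis
    by (rule cong[OF Pg, of B]) (use B eq in metis)+
qed

end

section \<open>Measure-preserving maps and boundary maps\<close>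

lemma mean_value_circle:
  assumes "\<phi> holomorphic_on ball 0 R" "R > 1"
  shows "(\<integral>\<zeta>. \<phi> \<zeta> \<partial>\<mu>) = \<phi> 0"
proof -
  have "(\<integral>\<zeta>. \<phi> \<zeta> \<partial>\<mu>) = (\<integral>\<zeta>. poisson_kernel 0 \<zeta> *\<^sub>R \<phi> \<zeta> \<partial>\<mu>)"
    by (intro Bochner_Integration.integral_cong) (auto simp: poisson_kernel_def)
  thus ?thesis
    using poisson_formula_holomorphic[OF assms, of 0] by simp
qed

lemma integral_circle_power:
  assumes "k > 0"
  shows "(\<integral>\<zeta>. \<zeta> ^ k \<partial>\<mu>) = 0" "(\<integral>\<zeta>. cnj \<zeta> ^ k \<partial>\<mu>) = 0"
proof -
  show *: "(\<integral>\<zeta>. \<zeta> ^ k \<partial>\<mu>) = 0"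
    using mean_value_circle[of "\<lambda>\<zeta>. \<zeta> ^ k" 2] assms by (simp add: holomorphic_intros)
  have "(\<integral>\<zeta>. cnj \<zeta> ^ k \<partial>\<mu>) = (\<integral>\<zeta>. cnj (\<zeta> ^ k) \<partial>\<mu>)"
    by simp
  also have "\<dots> = cnj (\<integral>\<zeta>. \<zeta> ^ k \<partial>\<mu>)"
    by (rule Bochner_Integration.integral_cnj)
  finally show "(\<integral>\<zeta>. cnj \<zeta> ^ k \<partial>\<mu>) = 0" using * by simp
qed

definition circle_preserving :: "(complex \<Rightarrow> complex) \<Rightarrow> bool" where
  "circle_preserving T \<longleftrightarrow> T \<in> measurable \<mu> \<mu> \<and>
     distr \<mu> \<mu> T = \<mu>"

lemma circle_preserving_borel:
  "circle_preserving T \<Longrightarrow> f \<in> borel_measurable \<mu> \<Longrightarrow>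
     (\<lambda>x. f (T x)) \<in> borel_measurable \<mu>"
  using measurable_compose by (auto simp: circle_preserving_def)

lemma circle_preserving_integral:
  fixes f :: "complex \<Rightarrow> 'b::{banach, second_countable_topology}"
  assumes "circle_preserving T" "f \<in> borel_measurable \<mu>"
  shows "(\<integral>x. f (T x) \<partial>\<mu>) = (\<integral>x. f x \<partial>\<mu>)"
  using integral_distr[of T \<mu> \<mu> f] assms
  by (simp add: circle_preserving_def)

lemma circle_preserving_integrable:
  fixes f :: "complex \<Rightarrow> 'b::{banach, second_countable_topology}"
  assumes "circle_preserving T" "integrable \<mu> f"
  shows "integrable \<mu> (\<lambda>x. f (T x))"
  using integrable_distr[of T \<mu> \<mu> f] assms
  by (simp add: circle_preserving_def)

lemma circle_preserving_AE:
  assumes "circle_preserving T" "AE x in \<mu>. P x"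
  shows "AE x in \<mu>. P (T x)"
  using assms by (metis AE_distrD circle_preserving_def)

text \<open>A probability measure on the circle is determined by its moments, and negative moments
  are conjugates of positive ones. The bounded functions whose integral T leaves unchanged form a
  \<open>circle_function_class\<close>, which therefore contains all Borel indicators.\<close>

lemma circle_preservingI:
  assumes T: "T \<in> measurable \<mu> \<mu>"
    and mom: "\<And>k. k > 0 \<Longrightarrow> (\<integral>\<zeta>. T \<zeta> ^ k \<partial>\<mu>) = 0"
  shows "circle_preserving T"
proof -
  have norm_T: "norm (T \<zeta>) = 1" if "norm \<zeta> = 1" for \<zeta>
    using measurable_space[OF T, of \<zeta>] that by simp
  have comp: "(\<lambda>x. f (T x)) \<in> borel_measurable \<mu>"
    if "f \<in> borel_measurable \<mu>" for f :: "complex \<Rightarrow> complex"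
    using measurable_compose[OF T that] .
  define P where "P f \<longleftrightarrow> f \<in> borel_measurable \<mu> \<and>
     (\<exists>B. \<forall>x. norm x = 1 \<longrightarrow> norm (f x) \<le> B) \<and>
     (\<integral>x. f (T x) \<partial>\<mu>) = (\<integral>x. f x \<partial>\<mu>)" for f :: "complex \<Rightarrow> complex"
  have int: "integrable \<mu> f" "integrable \<mu> (\<lambda>x. f (T x))" if f: "P f" for f
  proof -
    obtain B where B: "\<And>x. norm x = 1 \<Longrightarrow> norm (f x) \<le> B"
      using f by (auto simp: P_def)
    show "integrable \<mu> f"
      by (rule integrable_circle_bounded[of _ B]) (use f B in \<open>auto simp: P_def\<close>)
    show "integrable \<mu> (\<lambda>x. f (T x))"
      by (rule integrable_circle_bounded[of _ B]) (use f B norm_T comp in \<open>auto simp: P_def\<close>)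
  qed
  interpret circle_function_class P
  proof
    fix k :: nat
    have meas: "(\<lambda>z. z ^ k) \<in> borel_measurable \<mu>"
      by (intro borel_measurable_circle_continuous continuous_intros)
    show "P (\<lambda>z. z ^ k)"
      unfolding P_def using meas mom[of k] integral_circle_power[of k]
      by (cases "k = 0") (auto simp: norm_power intro!: exI[of _ 1])
    have meas': "(\<lambda>z. cnj z ^ k) \<in> borel_measurable \<mu>"
      by (intro borel_measurable_circle_continuous continuous_intros)
    have "(\<integral>\<zeta>. cnj (T \<zeta>) ^ k \<partial>\<mu>) = cnj (\<integral>\<zeta>. T \<zeta> ^ k \<partial>\<mu>)"
      by (subst Bochner_Integration.integral_cnj[symmetric]) simp
    thus "P (\<lambda>z. cnj z ^ k)"
      unfolding P_def using meas' mom[of k] integral_circle_power[of k]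
      by (cases "k = 0") (auto simp: norm_power intro!: exI[of _ 1])
  next
    fix f g assume fg: "P f" "P g"
    then obtain B B' where "\<And>x. norm x = 1 \<Longrightarrow> norm (f x) \<le> B" "\<And>x. norm x = 1 \<Longrightarrow> norm (g x) \<le> B'"
      by (auto simp: P_def)
    hence "\<exists>B. \<forall>x. norm x = 1 \<longrightarrow> norm (f x + g x) \<le> B"
      by (intro exI[of _ "B + B'"]) (auto intro!: norm_triangle_le add_mono)
    thus "P (\<lambda>z. f z + g z)"
      using fg int[OF fg(1)] int[OF fg(2)] unfolding P_def by simp
  next
    fix f c assume f: "P f"
    then obtain B where "\<And>x. norm x = 1 \<Longrightarrow> norm (f x) \<le> B"
      by (auto simp: P_def)
    hence "\<exists>B. \<forall>x. norm x = 1 \<longrightarrow> norm (c * f x) \<le> B"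
      by (intro exI[of _ "norm c * B"]) (auto simp: norm_mult intro!: mult_left_mono)
    thus "P (\<lambda>z. c * f z)"
      using f int[OF f] unfolding P_def by simp
  next
    fix f s B
    assume s: "\<And>i::nat. P (s i)" and B: "\<And>i x. norm x = 1 \<Longrightarrow> norm (s i x) \<le> B"
      and lim: "\<And>x. norm x = 1 \<Longrightarrow> (\<lambda>i. s i x) \<longlonglongrightarrow> f x"
    have s_meas: "s i \<in> borel_measurable \<mu>" for i
      using s by (simp add: P_def)
    have f_meas: "f \<in> borel_measurable \<mu>"
      by (rule borel_measurable_LIMSEQ_metric[of s]) (use s_meas lim in auto)
    have "norm (f x) \<le> B" if "norm x = 1" for x
      using lim[OF that] B[OF that] by (intro Lim_norm_ubound[of sequentially]) auto
    moreover have "(\<lambda>i. \<integral>x. s i x \<partial>\<mu>) \<longlonglongrightarrow> (\<integral>x. f x \<partial>\<mu>)"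
      by (rule integral_dominated_convergence[where w = "\<lambda>_. B"])
         (use s_meas f_meas lim B in auto)
    moreover have "(\<lambda>i. \<integral>x. s i (T x) \<partial>\<mu>) \<longlonglongrightarrow> (\<integral>x. f (T x) \<partial>\<mu>)"
      by (rule integral_dominated_convergence[where w = "\<lambda>_. B"])
         (use s_meas f_meas lim B comp norm_T in auto)
    ultimately show "P f"
      using f_meas s unfolding P_def by (auto intro!: LIMSEQ_unique)
  qed
  have "distr \<mu> \<mu> T = \<mu>"
  proof (rule measure_eqI)
    fix A assume A: "A \<in> sets (distr \<mu> \<mu> T)"
    hence A': "A \<in> sets \<mu>" by simp
    hence "A \<in> sets borel" by (auto simp: sets_circle_measure sets_restrict_space_iff)
    hence "P (indicator A)" by (rule indicator)
    hence eq: "(\<integral>x. indicator A (T x) \<partial>\<mu>) = (\<integral>x. indicator A x \<partial>\<mu> :: complex)"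
      by (simp add: P_def)
    have ind: "(\<integral>x. indicator B x \<partial>\<mu>) = (of_real (measure \<mu> B) :: complex)"
      if "B \<in> sets \<mu>" for B
    proof -
      have "(\<integral>x. complex_of_real (indicator B x) \<partial>\<mu>) = of_real (measure \<mu> B)"
        using that sets.sets_into_space[OF that]
        by (subst integral_complex_of_real) (simp add: Int_absorb1 Int_absorb2)
      thus ?thesis by (simp add: of_real_indicator)
    qed
    have "(\<integral>x. indicator A (T x) \<partial>\<mu>) =
        (\<integral>x. indicator (T -` A \<inter> space \<mu>) x \<partial>\<mu> :: complex)"
      by (intro Bochner_Integration.integral_cong) (auto simp: indicator_def)
    hence "of_real (measure \<mu> (T -` A \<inter> space \<mu>)) =
        (of_real (measure \<mu> A) :: complex)"
      using eq ind[OF A'] ind[OF measurable_sets[OF T A']] by simp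
    hence "measure \<mu> (T -` A \<inter> space \<mu>) = measure \<mu> A"
      by simp
    thus "emeasure (distr \<mu> \<mu> T) A = emeasure \<mu> A"
      using A' T by (simp add: emeasure_distr circle.emeasure_eq_measure)
  qed simp
  thus ?thesis using T by (simp add: circle_preserving_def)
qed

section \<open>Radial limits and measurability of the boundary map\<close>

definition has_unit_radial_limit :: "(complex \<Rightarrow> complex) \<Rightarrow> complex \<Rightarrow> bool" where
  "has_unit_radial_limit g \<zeta> \<longleftrightarrow> (\<exists>l. norm l = 1 \<and> has_radial_limit g \<zeta> l)"

lemma boundary_map_eq:
  assumes "has_radial_limit g \<zeta> l" "norm l = 1"
  shows "boundary_map g \<zeta> = l"
  using assms unfolding boundary_map_def has_radial_limit_def
  by (auto intro!: tendsto_Lim)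

lemma norm_boundary_map [simp]: "norm (boundary_map g \<zeta>) = 1"
proof (cases "\<exists>l. norm l = 1 \<and> has_radial_limit g \<zeta> l")
  case True
  thus ?thesis using boundary_map_eq by blast
qed (auto simp: boundary_map_def)

text \<open>A fixed sequence of radii for the arguments that need countability, namely measurability
  and dominated convergence. The shift by 2 makes even \<open>rho 0\<close> positive.\<close>

definition rho :: "nat \<Rightarrow> real" where "rho n = 1 - 1 / real (n + 2)"

lemma rho_pos: "rho n > 0" and rho_less_1: "rho n < 1"
  by (auto simp: rho_def field_simps)

lemma norm_rho_mult_less:
  assumes "norm w \<le> 1"
  shows "norm (of_real (rho n) * w :: complex) < 1"
proof -
  have "norm (of_real (rho n) * w) \<le> rho n * 1"
    using assms rho_pos[of n] unfolding norm_mult by (intro mult_mono) auto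
  thus ?thesis using rho_less_1[of n] by simp
qed

lemma rho_tendsto: "rho \<longlonglongrightarrow> 1"
  unfolding rho_def by real_asymp

lemma filterlim_rho: "filterlim rho (at_left 1) sequentially"
proof (rule tendsto_imp_filterlim_at_left)
  show "rho \<longlonglongrightarrow> 1" by (rule rho_tendsto)
  show "\<forall>\<^sub>F n in sequentially. rho n < 1" using rho_less_1 by simp
qed

lemma has_radial_limit_rho:
  "has_radial_limit g \<zeta> l \<Longrightarrow> (\<lambda>n. g (of_real (rho n) * \<zeta>)) \<longlonglongrightarrow> l"
  unfolding has_radial_limit_def by (rule filterlim_compose[OF _ filterlim_rho])

lemma of_real_mult_in_ball: "0 \<le> r \<Longrightarrow> r < 1 \<Longrightarrow> norm \<zeta> = 1 \<Longrightarrow> of_real r * \<zeta> \<in> ball 0 (1::real)"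
  for \<zeta> :: complex
  by (simp add: norm_mult)

lemma continuous_on_radial:
  fixes g :: "complex \<Rightarrow> complex"
  assumes "continuous_on (ball 0 1) g" "0 \<le> r" "r < 1"
  shows "continuous_on (sphere 0 1) (\<lambda>\<zeta>. g (of_real r * \<zeta>))"
  by (rule continuous_on_compose2[OF assms(1)])
     (use assms of_real_mult_in_ball in \<open>auto intro!: continuous_intros\<close>)

text \<open>Only the threshold n and the tolerance k need countable ranges. With a nonstrict
  inequality the condition on \<zeta> is closed for each pair p, q, so intersecting over uncountably
  many pairs does no harm to measurability.\<close>

lemma has_radial_limit_iff_cauchy:
  "(\<exists>l. has_radial_limit g \<zeta> l) \<longleftrightarrow>
   (\<forall>k. \<exists>n. \<forall>p\<in>{rho n<..<1}. \<forall>q\<in>{rho n<..<1}.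
      dist (g (of_real p * \<zeta>)) (g (of_real q * \<zeta>)) \<le> 1 / real (Suc k))"
  (is "?L = ?R")
proof
  assume ?L
  then obtain l where l: "((\<lambda>r. g (of_real r * \<zeta>)) \<longlongrightarrow> l) (at_left (1::real))"
    by (auto simp: has_radial_limit_def)
  show ?R
  proof
    fix k
    have "eventually (\<lambda>r. dist (g (of_real r * \<zeta>)) l < 1 / (2 * real (Suc k))) (at_left (1::real))"
      by (rule tendstoD[OF l]) simp
    then obtain b where b: "b < 1" "\<And>r. b < r \<Longrightarrow> r < 1 \<Longrightarrow> dist (g (of_real r * \<zeta>)) l < 1 / (2 * real (Suc k))"
      using eventually_at_left[of 0 "1::real"] by (auto simp: eventually_at_left_field)
    have "eventually (\<lambda>n. rho n > b) sequentially"
      using order_tendstoD(1)[OF rho_tendsto b(1)] .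
    then obtain n where n: "rho n > b" by (auto simp: eventually_sequentially)
    have "dist (g (of_real p * \<zeta>)) (g (of_real q * \<zeta>)) \<le> 1 / real (Suc k)"
      if "p \<in> {rho n<..<1}" "q \<in> {rho n<..<1}" for p q
    proof -
      have "dist (g (of_real p * \<zeta>)) (g (of_real q * \<zeta>)) \<le>
          1 / (2 * real (Suc k)) + 1 / (2 * real (Suc k))"
        using b(2)[of p] b(2)[of q] that n
        by (intro order.trans[OF dist_triangle2[of _ _ l]] add_mono) auto
      thus ?thesis by (simp add: field_simps)
    qed
    thus "\<exists>n. \<forall>p\<in>{rho n<..<1}. \<forall>q\<in>{rho n<..<1}.
      dist (g (of_real p * \<zeta>)) (g (of_real q * \<zeta>)) \<le> 1 / real (Suc k)" by blast
  qed
next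
  assume R: ?R
  have "cauchy_filter (filtermap (\<lambda>r. g (of_real r * \<zeta>)) (at_left (1::real)))"
    unfolding cauchy_filter_metric_filtermap
  proof (intro allI impI)
    fix e :: real assume "e > 0"
    then obtain k where k: "1 / real (Suc k) < e"
      using nat_approx_posE by blast
    obtain n where n: "\<And>p q. p \<in> {rho n<..<1} \<Longrightarrow> q \<in> {rho n<..<1} \<Longrightarrow>
       dist (g (of_real p * \<zeta>)) (g (of_real q * \<zeta>)) \<le> 1 / real (Suc k)"
      using R by metis
    have "eventually (\<lambda>p. p \<in> {rho n<..<1}) (at_left (1::real))"
      by (rule eventually_at_left_real) (rule rho_less_1)
    thus "\<exists>P. eventually P (at_left (1::real)) \<and> (\<forall>x y. P x \<and> P y \<longrightarrow>
        dist (g (of_real x * \<zeta>)) (g (of_real y * \<zeta>)) < e)"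
      using n k by (intro exI[of _ "\<lambda>p. p \<in> {rho n<..<1}"]) (auto intro: le_less_trans)
  qed
  moreover have "filtermap (\<lambda>r. g (of_real r * \<zeta>)) (at_left (1::real)) \<noteq> bot"
    by (simp add: filtermap_bot_iff)
  ultimately obtain l where "filtermap (\<lambda>r. g (of_real r * \<zeta>)) (at_left (1::real)) \<le> nhds l"
    using complete_UNIV[unfolded complete_uniform] by auto
  thus ?L unfolding has_radial_limit_def filterlim_def by blast
qed

lemma sets_has_radial_limit:
  assumes g: "continuous_on (ball 0 1) g"
  shows "{\<zeta> \<in> sphere 0 1. \<exists>l. has_radial_limit g \<zeta> l} \<in> sets \<mu>"
proof -
  have rho_bd: "p \<in> {rho n<..<1} \<Longrightarrow> 0 \<le> p \<and> p < 1" for p n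
    using rho_pos[of n] by auto
  have "{\<zeta> \<in> sphere 0 1. \<exists>l. has_radial_limit g \<zeta> l} =
     (\<Inter>k. \<Union>n. \<Inter>p\<in>{rho n<..<1}. \<Inter>q\<in>{rho n<..<1}.
       {\<zeta> \<in> sphere 0 1. dist (g (of_real p * \<zeta>)) (g (of_real q * \<zeta>)) \<le> 1 / real (Suc k)})"
    (is "_ = (\<Inter>k. \<Union>n. ?C n k)")
  proof (intro set_eqI)
    fix \<zeta>
    \<comment> \<open>The index sets must be nonempty: an empty intersection would be the whole
      plane and lose the condition that \<zeta> lies on the circle.\<close>
    have ex: "\<exists>p. p \<in> {rho n<..<1}" for n
      using dense[OF rho_less_1[of n]] by auto
    show "\<zeta> \<in> {\<zeta> \<in> sphere 0 1. \<exists>l. has_radial_limit g \<zeta> l} \<longleftrightarrow> \<zeta> \<in> (\<Inter>k. \<Union>n. ?C n k)"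
      unfolding mem_Collect_eq has_radial_limit_iff_cauchy INT_iff UN_iff using ex by blast
  qed
  moreover have "closed (?C n k)" for n k
  proof (intro closed_INT ballI)
    fix p q assume "p \<in> {rho n<..<1}" "q \<in> {rho n<..<1}"
    thus "closed {\<zeta> \<in> sphere 0 1. dist (g (of_real p * \<zeta>)) (g (of_real q * \<zeta>)) \<le> 1 / real (Suc k)}"
      using rho_bd by (intro continuous_on_closed_Collect_le continuous_intros continuous_on_radial[OF g]) auto
  qed
  ultimately have "{\<zeta> \<in> sphere 0 1. \<exists>l. has_radial_limit g \<zeta> l} \<in> sets borel"
    by (simp only:) (intro sets.countable_INT' sets.countable_UN' borel_closed, auto)
  thus ?thesis
    by (auto simp: sets_circle_measure sets_restrict_space_iff)
qed

text \<open>The limit along \<open>rho\<close> is measurable, but it may have modulus 1 at points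
  without a radial limit; hence the intersection with the set where the radial limit exists.\<close>

lemma radial_limit_along_rho:
  assumes g: "continuous_on (ball 0 1) g"
  defines "L \<equiv> \<lambda>\<zeta>. lim (\<lambda>n. g (of_real (rho n) * \<zeta>))"
  shows "L \<in> borel_measurable \<mu>"
    "{\<zeta> \<in> sphere 0 1. has_unit_radial_limit g \<zeta>} =
     {\<zeta> \<in> sphere 0 1. (\<exists>l. has_radial_limit g \<zeta> l)} \<inter> {\<zeta> \<in> space \<mu>. norm (L \<zeta>) = 1}"
    "has_radial_limit g \<zeta> l \<Longrightarrow> L \<zeta> = l"
proof -
  show "L \<in> borel_measurable \<mu>"
    unfolding L_def using rho_pos rho_less_1
    by (intro borel_measurable_lim_metric borel_measurable_circle_continuous continuous_on_radial g)
       (auto intro: less_imp_le)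
  show L: "L \<zeta> = l" if "has_radial_limit g \<zeta> l" for \<zeta> l
    unfolding L_def using has_radial_limit_rho[OF that] by (rule limI)
  show "{\<zeta> \<in> sphere 0 1. has_unit_radial_limit g \<zeta>} =
     {\<zeta> \<in> sphere 0 1. (\<exists>l. has_radial_limit g \<zeta> l)} \<inter> {\<zeta> \<in> space \<mu>. norm (L \<zeta>) = 1}"
    unfolding has_unit_radial_limit_def using L by auto
qed

lemma sets_has_unit_radial_limit:
  assumes "continuous_on (ball 0 1) g"
  shows "{\<zeta> \<in> sphere 0 1. has_unit_radial_limit g \<zeta>} \<in> sets \<mu>"
proof -
  note [measurable] = radial_limit_along_rho(1)[OF assms]
  show ?thesis
    unfolding radial_limit_along_rho(2)[OF assms]
    by (intro sets.Int sets_has_radial_limit assms) measurable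
qed

lemma boundary_map_measurable:
  assumes g: "continuous_on (ball 0 1) g"
  shows "boundary_map g \<in> measurable \<mu> \<mu>"
proof -
  let ?L = "\<lambda>\<zeta>. lim (\<lambda>n. g (of_real (rho n) * \<zeta>))"
  let ?A = "{\<zeta> \<in> sphere 0 1. has_unit_radial_limit g \<zeta>}"
  have eq: "boundary_map g \<zeta> = (if \<zeta> \<in> ?A then ?L \<zeta> else 1)" if "\<zeta> \<in> space \<mu>" for \<zeta>
  proof (cases "has_unit_radial_limit g \<zeta>")
    case True
    then obtain l where "norm l = 1" "has_radial_limit g \<zeta> l" by (auto simp: has_unit_radial_limit_def)
    thus ?thesis using boundary_map_eq radial_limit_along_rho(3)[OF g] True that by simp
  next
    case False
    thus ?thesis unfolding boundary_map_def has_unit_radial_limit_def by auto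
  qed
  have "(\<lambda>\<zeta>. if \<zeta> \<in> ?A then ?L \<zeta> else 1) \<in> borel_measurable \<mu>"
    using sets_has_unit_radial_limit[OF g] radial_limit_along_rho(1)[OF g]
    by (intro measurable_If_set) (auto simp: Int_absorb2 subset_eq)
  hence "boundary_map g \<in> borel_measurable \<mu>"
    by (subst measurable_cong[OF eq])
  hence "boundary_map g \<in> measurable \<mu> (restrict_space borel (sphere 0 1))"
    by (intro measurable_restrict_space2) auto
  thus ?thesis
    by (simp add: measurable_cong_sets[OF refl sets_circle_measure])
qed

section \<open>Fatou's theorem\<close>

lemma set_integrable_Icc_bounded:
  fixes f :: "real \<Rightarrow> 'b::{banach, second_countable_topology}"
  assumes "f \<in> borel_measurable borel" "\<And>x. norm (f x) \<le> B"
  shows "set_integrable lborel {a..b} f"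
  unfolding set_integrable_def
  by (rule integrableI_bounded_set_indicator[where B = B])
     (use assms in \<open>auto simp: emeasure_lborel_Icc_eq\<close>)

lemma lebesgue_differentiation_right:
  fixes f :: "real \<Rightarrow> complex"
  assumes f: "f \<in> borel_measurable borel" "\<And>x. norm (f x) \<le> B"
  shows "AE t in lborel. \<forall>e>0. \<exists>d>0. \<forall>h. 0 < h \<and> h < d \<longrightarrow>
    norm ((LINT x:{0..h}|lborel. f (t + x)) - h *\<^sub>R f t) \<le> e * h"
proof -
  have "f integrable_on cbox a b" for a b
    using set_borel_integral_eq_integral(1)[OF set_integrable_Icc_bounded[OF f]] by simp
  then obtain N where N: "negligible N"
    "\<And>x e. x \<notin> N \<Longrightarrow> 0 < e \<Longrightarrow> \<exists>d>0. \<forall>h. 0 < h \<and> h < d \<longrightarrow>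
       norm (integral (cbox x (x + h *\<^sub>R One)) f /\<^sub>R h ^ DIM(real) - f x) < e"
    using integrable_ccontinuous_explicit[of f] by blast
  have "AE t in lebesgue. t \<notin> N"
    using N(1) by (simp add: negligible_iff_null_sets AE_not_in)
  hence "AE t in lborel. t \<notin> N"
    by (simp add: AE_completion_iff)
  thus ?thesis
  proof eventually_elim
    case (elim t)
    show ?case
    proof (intro allI impI)
      fix e :: real assume "e > 0"
      then obtain d where d: "d > 0" "\<And>h. 0 < h \<Longrightarrow> h < d \<Longrightarrow>
          norm (integral {t..t + h} f /\<^sub>R h - f t) < e"
        using N(2)[OF elim, of e] by auto
      have "norm ((LINT x:{0..h}|lborel. f (t + x)) - h *\<^sub>R f t) \<le> e * h" if h: "0 < h" "h < d" for h
      proof -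
        have "(LINT x:{0..h}|lborel. f (t + x)) = integral {0..h} (\<lambda>x. f (t + x))"
          by (rule set_borel_integral_eq_integral(2)[OF set_integrable_Icc_bounded[of _ B]])
             (use f in measurable)
        also have "\<dots> = integral {t..t + h} f"
          using integral_shift_Icc_real[of 0 h f t] by (simp add: o_def add.commute)
        finally have "(LINT x:{0..h}|lborel. f (t + x)) - h *\<^sub>R f t =
            h *\<^sub>R (integral {t..t + h} f /\<^sub>R h - f t)"
          using h by (simp add: scaleR_diff_right)
        hence "norm ((LINT x:{0..h}|lborel. f (t + x)) - h *\<^sub>R f t) =
            h * norm (integral {t..t + h} f /\<^sub>R h - f t)"
          using h by simp
        thus ?thesis using d(2)[OF h] h by (simp add: mult.commute)
      qed
      thus "\<exists>d>0. \<forall>h. 0 < h \<and> h < d \<longrightarrow>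
          norm ((LINT x:{0..h}|lborel. f (t + x)) - h *\<^sub>R f t) \<le> e * h"
        using d(1) by blast
    qed
  qed
qed

text \<open>The reflection x to -x preserves Lebesgue measure and reduces this to the other
  side.\<close>

lemma lebesgue_differentiation_left:
  fixes f :: "real \<Rightarrow> complex"
  assumes f: "f \<in> borel_measurable borel" "\<And>x. norm (f x) \<le> B"
  shows "AE t in lborel. \<forall>e>0. \<exists>d>0. \<forall>h. 0 < h \<and> h < d \<longrightarrow>
    norm ((LINT x:{0..h}|lborel. f (t - x)) - h *\<^sub>R f t) \<le> e * h"
proof -
  let ?P = "\<lambda>t. \<forall>e>0. \<exists>d>0. \<forall>h. 0 < h \<and> h < d \<longrightarrow>
    norm ((LINT x:{0..h}|lborel. f (- (t + x))) - h *\<^sub>R f (- t)) \<le> e * h"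
  have "AE t in lborel. ?P t"
    by (rule lebesgue_differentiation_right[of "\<lambda>x. f (- x)" B]) (use f in \<open>auto\<close>)
  hence "AE t in distr lborel borel uminus. ?P t"
    by (subst lborel_distr_uminus)
  hence "AE t in lborel. ?P (- t)"
    by (rule AE_distrD[rotated]) simp
  thus ?thesis by simp
qed

text \<open>The norm stays outside the integral, which is weaker than the Lebesgue point condition.
  It is enough here because the Poisson kernel is even and decreasing in the angle on the half
  circle, so integration by parts involves only the primitive. \<open>h = 0\<close> is included
  because that primitive is evaluated on a closed interval starting at 0.\<close>

lemma lebesgue_differentiation_symmetric:
  fixes f :: "real \<Rightarrow> complex"
  assumes f: "f \<in> borel_measurable borel" "\<And>x. norm (f x) \<le> B"
  shows "AE t in lborel. \<forall>e>0. \<exists>d>0. \<forall>h. 0 \<le> h \<and> h < d \<longrightarrow>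
    norm (LINT x:{0..h}|lborel. f (t + x) + f (t - x) - 2 * f t) \<le> e * h"
  using lebesgue_differentiation_right[OF f] lebesgue_differentiation_left[OF f]
proof eventually_elim
  case (elim t)
  show ?case
  proof (intro allI impI)
    fix e :: real assume e: "e > 0"
    obtain d where d: "d > 0" "\<And>h. 0 < h \<Longrightarrow> h < d \<Longrightarrow>
        norm ((LINT x:{0..h}|lborel. f (t + x)) - h *\<^sub>R f t) \<le> e / 2 * h"
      using elim(1) e half_gt_zero by meson
    obtain d' where d': "d' > 0" "\<And>h. 0 < h \<Longrightarrow> h < d' \<Longrightarrow>
        norm ((LINT x:{0..h}|lborel. f (t - x)) - h *\<^sub>R f t) \<le> e / 2 * h"
      using elim(2) e half_gt_zero by meson
    have "norm (LINT x:{0..h}|lborel. f (t + x) + f (t - x) - 2 * f t) \<le> e * h"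
      if h: "0 \<le> h" "h < min d d'" for h
    proof -
      have i: "set_integrable lborel {0..h} (\<lambda>x. f (t + x))" "set_integrable lborel {0..h} (\<lambda>x. f (t - x))"
        by (rule set_integrable_Icc_bounded[of _ B]; use f in measurable)+
      have ic: "set_integrable lborel {0..h} (\<lambda>x. 2 * f t)"
        by (rule set_integrable_Icc_bounded[of _ "norm (2 * f t)"]) auto
      have "(LINT x:{0..h}|lborel. f (t + x) + f (t - x) - 2 * f t) =
          (LINT x:{0..h}|lborel. f (t + x)) + (LINT x:{0..h}|lborel. f (t - x)) - (LINT x:{0..h}|lborel. 2 * f t)"
        using i ic by (simp add: set_integral_add set_integral_diff)
      also have "(LINT x:{0..h}|lborel. 2 * f t) = (2 * h) *\<^sub>R f t"
        using h by (subst set_integral_const) (auto simp: scaleR_conv_of_real)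
      also have "(LINT x:{0..h}|lborel. f (t + x)) + (LINT x:{0..h}|lborel. f (t - x)) - (2 * h) *\<^sub>R f t =
         ((LINT x:{0..h}|lborel. f (t + x)) - h *\<^sub>R f t) + ((LINT x:{0..h}|lborel. f (t - x)) - h *\<^sub>R f t)"
        by (simp add: scaleR_2 flip: scaleR_scaleR)
      also have "norm \<dots> \<le> e / 2 * h + e / 2 * h"
      proof (cases "h = 0")
        case True
        have "(LINT x:{0..0::real}|lborel. g x) = 0" for g :: "real \<Rightarrow> complex"
        proof -
          have "AE x in lborel. indicator {0..0::real} x *\<^sub>R g x = 0"
            using AE_lborel_singleton[of "0::real"] by eventually_elim auto
          thus ?thesis unfolding set_lebesgue_integral_def by (rule integral_eq_zero_AE)
        qed
        thus ?thesis using True by simp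
      next
        case False
        thus ?thesis using h d(2)[of h] d'(2)[of h] by (intro norm_triangle_le add_mono) auto
      qed
      finally show ?thesis by simp
    qed
    thus "\<exists>d>0. \<forall>h. 0 \<le> h \<and> h < d \<longrightarrow>
        norm (LINT x:{0..h}|lborel. f (t + x) + f (t - x) - 2 * f t) \<le> e * h"
      using d(1) d'(1) by (intro exI[of _ "min d d'"]) auto
  qed
qed

text \<open>Integration by parts against a bounded Borel function, which has no antiderivative in the
  classical sense; it is Fubini's theorem on the triangle \<open>t \<le> x \<le> b\<close>.\<close>

lemma set_integral_by_parts_bounded:
  fixes h :: "real \<Rightarrow> 'b::{banach, second_countable_topology}" and p q :: "real \<Rightarrow> real"
  assumes h: "h \<in> borel_measurable borel" "\<And>x. norm (h x) \<le> M"
    and p: "\<And>x. (p has_real_derivative - q x) (at x)" and q: "continuous_on UNIV q"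
    and b: "b \<ge> 0"
  shows "(LINT t:{0..b}|lborel. p t *\<^sub>R h t) = p b *\<^sub>R (LINT t:{0..b}|lborel. h t) +
     (LINT x:{0..b}|lborel. q x *\<^sub>R (LINT t:{0..x}|lborel. h t))"
proof -
  have [measurable]: "h \<in> borel_measurable borel" "q \<in> borel_measurable borel"
    using h q by (auto intro: borel_measurable_continuous_onI)
  have cont_p: "continuous_on UNIV p"
    using p by (meson DERIV_continuous continuous_at_imp_continuous_on)
  hence [measurable]: "p \<in> borel_measurable borel"
    by (rule borel_measurable_continuous_onI)
  have cmp: "\<exists>K. \<forall>x\<in>{0..b}. norm (u x) \<le> K" if "continuous_on UNIV u" for u :: "real \<Rightarrow> real"
  proof -
    have "compact (u ` {0..b})"
      using that by (intro compact_continuous_image) (auto intro: continuous_on_subset)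
    hence "bounded (u ` {0..b})" by (rule compact_imp_bounded)
    thus ?thesis unfolding bounded_iff by blast
  qed
  obtain K where K: "\<And>x. x \<in> {0..b} \<Longrightarrow> norm (q x) \<le> K" using cmp[OF q] by blast
  obtain L where L: "\<And>x. x \<in> {0..b} \<Longrightarrow> norm (p x) \<le> L" using cmp[OF cont_p] by blast
  have KM: "K \<ge> 0" "M \<ge> 0" "L \<ge> 0"
    using K[of 0] L[of 0] b h(2)[of 0]
    by (auto intro: order.trans[OF norm_ge_zero] order.trans[OF abs_ge_zero])
  \<comment> \<open>As p' = -q, integrating out x over [t, b] gives (p t - p b) h t; integrating out
    t over [0, x] gives q x times the primitive of h.\<close>
  let ?k = "\<lambda>t x. (indicator {0..b} t * indicator {t..b} x * q x) *\<^sub>R h t"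
  have meas: "case_prod ?k \<in> borel_measurable (lborel \<Otimes>\<^sub>M lborel)"
    unfolding indicator_def atLeastAtMost_iff by measurable
  have int: "integrable (lborel \<Otimes>\<^sub>M lborel) (case_prod ?k)"
  proof (rule integrableI_bounded_set[where A = "{0..b} \<times> {0..b}" and B = "K * M"])
    show "emeasure (lborel \<Otimes>\<^sub>M lborel) ({0..b} \<times> {0..b}) < \<infinity>"
      using b by (subst lborel.emeasure_pair_measure_Times) (auto simp: ennreal_mult_less_top)
    show "AE x in lborel \<Otimes>\<^sub>M lborel. x \<in> {0..b} \<times> {0..b} \<longrightarrow> norm (case x of (t, x) \<Rightarrow> ?k t x) \<le> K * M"
    proof (intro AE_I2 impI)
      fix z assume "z \<in> {0..b} \<times> {0..b}"
      then obtain t x where z: "z = (t, x)" "t \<in> {0..b}" "x \<in> {0..b}" by auto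
      have "norm (?k t x) = (indicator {0..b} t * indicator {t..b} x) * (norm (q x) * norm (h t))"
        by (simp add: abs_mult)
      also have "\<dots> \<le> 1 * (K * M)"
        using K[OF z(3)] h(2)[of t] KM
        by (intro mult_mono) (auto simp: indicator_def)
      finally show "norm (case z of (t, x) \<Rightarrow> ?k t x) \<le> K * M" by (simp add: z)
    qed
    show "AE x in lborel \<Otimes>\<^sub>M lborel. x \<notin> {0..b} \<times> {0..b} \<longrightarrow> (case x of (t, x) \<Rightarrow> ?k t x) = 0"
      by (intro AE_I2) (auto simp: indicator_def)
  qed (use meas in auto)
  have "(\<integral>t. (\<integral>x. ?k t x \<partial>lborel) \<partial>lborel) = (\<integral>x. (\<integral>t. ?k t x \<partial>lborel) \<partial>lborel)"
    by (rule lborel_pair.Fubini_integral[symmetric, OF int])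
  also have "(\<lambda>t. \<integral>x. ?k t x \<partial>lborel) = (\<lambda>t. indicator {0..b} t *\<^sub>R ((p t - p b) *\<^sub>R h t))"
  proof
    fix t
    show "(\<integral>x. ?k t x \<partial>lborel) = indicator {0..b} t *\<^sub>R ((p t - p b) *\<^sub>R h t)"
    proof (cases "t \<in> {0..b}")
      case True
      have cq: "continuous_on {t..b} q"
        using q by (rule continuous_on_subset) simp
      have "((\<lambda>x. - p x) has_vector_derivative q x) (at x within {t..b})" for x
        using DERIV_minus[OF p[of x]]
        by (simp add: has_real_derivative_iff_has_vector_derivative has_vector_derivative_at_within)
      hence FTC: "(\<integral>x. indicator {t..b} x *\<^sub>R q x \<partial>lborel) = - p b - - p t"
        using True cq by (intro integral_FTC_atLeastAtMost) auto
      have "integrable lborel (\<lambda>x. indicator {t..b} x *\<^sub>R q x)"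
        using borel_integrable_atLeastAtMost'[OF cq] unfolding set_integrable_def .
      hence "(\<integral>x. (indicator {t..b} x *\<^sub>R q x) *\<^sub>R h t \<partial>lborel) = (- p b - - p t) *\<^sub>R h t"
        unfolding FTC[symmetric] by (intro integral_scaleR_left)
      thus ?thesis using True by simp
    qed simp
  qed
  also have "(\<lambda>x. \<integral>t. ?k t x \<partial>lborel) = (\<lambda>x. indicator {0..b} x *\<^sub>R (q x *\<^sub>R (LINT t:{0..x}|lborel. h t)))"
  proof
    fix x
    have "(\<integral>t. ?k t x \<partial>lborel) = (\<integral>t. (indicator {0..b} x * q x) *\<^sub>R (indicator {0..x} t *\<^sub>R h t) \<partial>lborel)"
      by (intro Bochner_Integration.integral_cong refl) (auto simp: indicator_def)
    thus "(\<integral>t. ?k t x \<partial>lborel) = indicator {0..b} x *\<^sub>R (q x *\<^sub>R (LINT t:{0..x}|lborel. h t))"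
      unfolding set_lebesgue_integral_def integral_scaleR_right by simp
  qed
  finally have eq: "(LINT t:{0..b}|lborel. (p t - p b) *\<^sub>R h t) =
      (LINT x:{0..b}|lborel. q x *\<^sub>R (LINT t:{0..x}|lborel. h t))"
    unfolding set_lebesgue_integral_def .
  have i1: "set_integrable lborel {0..b} (\<lambda>t. p t *\<^sub>R h t)"
    unfolding set_integrable_def
  proof (rule integrableI_bounded_set_indicator[where B = "L * M"])
    show "AE x in lborel. x \<in> {0..b} \<longrightarrow> norm (p x *\<^sub>R h x) \<le> L * M"
      unfolding norm_scaleR using L h(2) KM by (intro AE_I2 impI mult_mono) auto
  qed (auto simp: emeasure_lborel_Icc_eq)
  have i2: "set_integrable lborel {0..b} (\<lambda>t. p b *\<^sub>R h t)"
    by (rule set_integrable_Icc_bounded[of _ "\<bar>p b\<bar> * M"]) (use h in \<open>auto intro!: mult_left_mono\<close>)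
  have "(LINT t:{0..b}|lborel. (p t - p b) *\<^sub>R h t) =
      (LINT t:{0..b}|lborel. p t *\<^sub>R h t) - (LINT t:{0..b}|lborel. p b *\<^sub>R h t)"
    using set_integral_diff(2)[OF i1 i2] by (simp add: scaleR_diff_left)
  thus ?thesis using eq by simp
qed

lemma continuous_on_poisson_kernel:
  assumes "norm z < 1"
  shows "continuous_on (sphere 0 1) (poisson_kernel z)"
proof -
  have "\<zeta> \<noteq> z" if "norm \<zeta> = 1" for \<zeta> using that assms by auto
  thus ?thesis
    unfolding poisson_kernel_def[abs_def] by (intro continuous_intros) auto
qed

lemma poisson_kernel_bounded:
  assumes "norm z < 1"
  obtains K where "\<And>\<zeta>. norm \<zeta> = 1 \<Longrightarrow> \<bar>poisson_kernel z \<zeta>\<bar> \<le> K" "K \<ge> 0"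
proof -
  have "compact (poisson_kernel z ` sphere 0 1)"
    using continuous_on_poisson_kernel[OF assms] by (rule compact_continuous_image) simp
  then obtain K where K: "\<forall>y\<in>poisson_kernel z ` sphere 0 1. norm y \<le> K"
    using compact_imp_bounded bounded_iff by blast
  hence *: "\<bar>poisson_kernel z \<zeta>\<bar> \<le> K" if "norm \<zeta> = 1" for \<zeta> using that by simp
  moreover have "K \<ge> 0" using *[of 1] by simp
  ultimately show ?thesis using that by blast
qed

text \<open>Let H be the primitive of h. Integration by parts leaves p b * H b and the integral of q
  * H. On [0, d) the bound |H x| \<le> e * x is used, on [d, b] the crude bound M * b together with
  the fact that q integrates to p d - p b. These give the three terms.\<close>

lemma kernel_integral_bound:
  fixes h :: "real \<Rightarrow> complex" and p q :: "real \<Rightarrow> real"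
  assumes h: "h \<in> borel_measurable borel" "\<And>x. norm (h x) \<le> M"
    and p: "\<And>x. (p has_real_derivative - q x) (at x)" and q: "continuous_on UNIV q"
    and q_nonneg: "\<And>x. x \<in> {0..b} \<Longrightarrow> q x \<ge> 0" and p_nonneg: "\<And>x. p x \<ge> 0"
    and d: "0 < d" "d \<le> b" and e: "e \<ge> 0"
    and small: "\<And>x. 0 \<le> x \<Longrightarrow> x < d \<Longrightarrow> norm (LINT t:{0..x}|lborel. h t) \<le> e * x"
  shows "norm (LINT t:{0..b}|lborel. p t *\<^sub>R h t) \<le>
    M * b * p b + e * (LINT t:{0..b}|lborel. p t) + M * b * p d"
proof -
  let ?H = "\<lambda>x. LINT t:{0..x}|lborel. h t"
  have M: "M \<ge> 0" using h(2)[of 0] norm_ge_zero order.trans by blast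
  have b: "b \<ge> 0" using d by simp
  have H: "norm (?H x) \<le> M * x" if "x \<ge> 0" for x
  proof -
    have "norm (?H x) \<le> (LINT t:{0..x}|lborel. norm (h t))"
      by (rule set_integral_norm_bound) (rule set_integrable_Icc_bounded[OF h])
    also have "\<dots> \<le> (LINT t:{0..x}|lborel. M)"
      by (rule set_integral_mono)
         (use h M in \<open>auto intro!: set_integrable_Icc_bounded[of _ M]\<close>)
    also have "\<dots> = M * x"
      using that by (subst set_integral_const) auto
    finally show ?thesis .
  qed
  have cq: "continuous_on A q" for A
    using q by (rule continuous_on_subset) simp
  have iqx: "set_integrable lborel {0..b} (\<lambda>x. q x * x)"
    by (intro borel_integrable_atLeastAtMost' continuous_intros cq)
  have iq: "set_integrable lborel {d..b} q"
    by (intro borel_integrable_atLeastAtMost' cq)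
  have ieqx: "integrable lborel (\<lambda>x. e * (indicator {0..b} x *\<^sub>R (q x * x)))"
    using iqx unfolding set_integrable_def by (rule integrable_mult_right)
  have iMq: "integrable lborel (\<lambda>x. M * b * (indicator {d..b} x *\<^sub>R q x))"
    using iq unfolding set_integrable_def by (rule integrable_mult_right)
  have FTC: "(LINT x:{d..b}|lborel. q x) = p d - p b"
  proof -
    have "((\<lambda>x. - p x) has_vector_derivative q x) (at x within {d..b})" for x
      using DERIV_minus[OF p[of x]]
      by (simp add: has_real_derivative_iff_has_vector_derivative has_vector_derivative_at_within)
    hence "(LINT x:{d..b}|lborel. q x) = - p b - - p d"
      unfolding set_lebesgue_integral_def using d cq by (intro integral_FTC_atLeastAtMost) auto
    thus ?thesis by simp
  qed
  \<comment> \<open>Integration by parts read backwards with h = 1; the dropped boundary term b * p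
    b is nonnegative.\<close>
  have qx: "(LINT x:{0..b}|lborel. q x * x) \<le> (LINT t:{0..b}|lborel. p t)"
  proof -
    have "(LINT t:{0..b}|lborel. p t *\<^sub>R (1::real)) = p b *\<^sub>R (LINT t:{0..b}|lborel. 1) +
        (LINT x:{0..b}|lborel. q x *\<^sub>R (LINT t:{0..x}|lborel. 1))"
      by (rule set_integral_by_parts_bounded[where M = 1]) (use p q b in auto)
    also have "(LINT x:{0..b}|lborel. q x *\<^sub>R (LINT t:{0..x}|lborel. (1::real))) =
        (LINT x:{0..b}|lborel. q x * x)"
      by (rule set_lebesgue_integral_cong) (auto simp: set_integral_const)
    finally show ?thesis
      using b p_nonneg[of b] by (simp add: set_integral_const)
  qed
  have "norm (LINT x:{0..b}|lborel. q x *\<^sub>R ?H x) \<le>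
      (\<integral>x. norm (indicator {0..b} x *\<^sub>R q x *\<^sub>R ?H x) \<partial>lborel)"
    unfolding set_lebesgue_integral_def by (rule integral_norm_bound)
  also have "\<dots> \<le> (\<integral>x. e * (indicator {0..b} x *\<^sub>R (q x * x)) + M * b * (indicator {d..b} x *\<^sub>R q x) \<partial>lborel)"
  proof (rule integral_mono')
    show "integrable lborel (\<lambda>x. e * (indicator {0..b} x *\<^sub>R (q x * x)) + M * b * (indicator {d..b} x *\<^sub>R q x))"
      using ieqx iMq by (rule Bochner_Integration.integrable_add)
    fix x :: real
    have "norm (indicator {0..b} x *\<^sub>R q x *\<^sub>R ?H x) = indicator {0..b} x * (\<bar>q x\<bar> * norm (?H x))"
      by (simp add: abs_mult)
    also have "\<dots> \<le> e * (indicator {0..b} x *\<^sub>R (q x * x)) + M * b * (indicator {d..b} x *\<^sub>R q x)"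
    proof (cases "x \<in> {0..b}")
      case True
      show ?thesis
      proof (cases "x < d")
        case lt: True
        have "q x * norm (?H x) \<le> q x * (e * x)"
          using small[of x] True q_nonneg[OF True] lt by (intro mult_left_mono) auto
        thus ?thesis using True lt q_nonneg[OF True] by (simp add: mult_ac)
      next
        case False
        have "norm (?H x) \<le> M * x" using H True by simp
        also have "\<dots> \<le> M * b" using True M by (intro mult_left_mono) auto
        finally have "q x * norm (?H x) \<le> q x * (M * b)"
          using q_nonneg[OF True] by (intro mult_left_mono) auto
        moreover have "e * (q x * x) \<ge> 0" using e q_nonneg[OF True] True by simp
        ultimately show ?thesis using True False q_nonneg[OF True] by (simp add: mult_ac)
      qed
    qed (use d in auto)
    finally show "norm (indicator {0..b} x *\<^sub>R q x *\<^sub>R ?H x) \<le> 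
        e * (indicator {0..b} x *\<^sub>R (q x * x)) + M * b * (indicator {d..b} x *\<^sub>R q x)" .
    show "0 \<le> e * (indicator {0..b} x *\<^sub>R (q x * x)) + M * b * (indicator {d..b} x *\<^sub>R q x)"
      using e q_nonneg[of x] M b d by (auto simp: indicator_def)
  qed
  also have "\<dots> = e * (LINT x:{0..b}|lborel. q x * x) + M * b * (LINT x:{d..b}|lborel. q x)"
    unfolding set_lebesgue_integral_def Bochner_Integration.integral_add[OF ieqx iMq]
    by (simp only: Bochner_Integration.integral_mult_right_zero)
  also have "\<dots> \<le> e * (LINT t:{0..b}|lborel. p t) + M * b * p d"
    using qx e M b p_nonneg[of b] unfolding FTC by (intro add_mono mult_left_mono) auto
  finally have 1: "norm (LINT x:{0..b}|lborel. q x *\<^sub>R ?H x) \<le>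
     e * (LINT t:{0..b}|lborel. p t) + M * b * p d" .
  have 2: "norm (p b *\<^sub>R ?H b) \<le> M * b * p b"
    using mult_left_mono[OF H[OF b] p_nonneg[of b]] p_nonneg[of b] by (simp add: mult_ac)
  show ?thesis
    unfolding set_integral_by_parts_bounded[OF h p q b]
    using 1 2 norm_triangle_ineq[of "p b *\<^sub>R ?H b" "LINT x:{0..b}|lborel. q x *\<^sub>R ?H x"] by linarith
qed

text \<open>The substitution x to 2 pi - x moves the lower half circle to (0, pi). Pairing
  \<open>cis x\<close> with \<open>cis (- x)\<close> suits a kernel that is even in the angle and
  leaves symmetric differences to estimate.\<close>

lemma integral_circle_fold:
  assumes f: "f \<in> borel_measurable \<mu>" "\<And>x. norm x = 1 \<Longrightarrow> norm (f x) \<le> B"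
  shows "(\<integral>x. f x \<partial>\<mu>) = (LINT x:{0..pi}|lborel. f (cis x) + f (cis (- x)) :: complex) /\<^sub>R (2 * pi)"
proof -
  let ?F = "\<lambda>x. f (cis x)"
  have F [measurable]: "?F \<in> borel_measurable borel"
    using f by (intro borel_measurable_circle_cis)
  have i: "set_integrable lborel {a..b} (\<lambda>x. ?F x)" "set_integrable lborel {a..b} (\<lambda>x. ?F (- x))" for a b
    by (rule set_integrable_Icc_bounded[of _ B]; use f in \<open>measurable | simp\<close>)+
  have "(LINT x:{0..<2*pi}|lborel. ?F x) = (LINT x:{0..pi} \<union> {pi<..<2*pi}|lborel. ?F x)"
  proof (rule arg_cong[where f = "\<lambda>A. set_lebesgue_integral lborel A ?F"], intro set_eqI)
    fix x show "x \<in> {0..<2*pi} \<longleftrightarrow> x \<in> {0..pi} \<union> {pi<..<2*pi}"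
      unfolding Un_iff atLeastLessThan_iff atLeastAtMost_iff greaterThanLessThan_iff
      using pi_gt_zero by linarith
  qed
  also have "\<dots> = (LINT x:{0..pi}|lborel. ?F x) + (LINT x:{pi<..<2*pi}|lborel. ?F x)"
    by (rule set_integral_Un) (auto intro: set_integrable_subset[OF i(1)[of pi "2 * pi"]] i)
  also have "(LINT x:{pi<..<2*pi}|lborel. ?F x) = (LINT x:{0<..<pi}|lborel. ?F (- x))"
  proof -
    have "(LINT x:{pi<..<2*pi}|lborel. ?F x) =
        \<bar>-1\<bar> *\<^sub>R (\<integral>x. indicator {pi<..<2*pi} (2 * pi + (-1) * x) *\<^sub>R ?F (2 * pi + (-1) * x) \<partial>lborel)"
      unfolding set_lebesgue_integral_def by (rule lborel_integral_real_affine) simp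
    also have "\<dots> = (LINT x:{0<..<pi}|lborel. ?F (- x))"
      unfolding set_lebesgue_integral_def
      by (simp, intro Bochner_Integration.integral_cong)
         (auto simp: indicator_def inverse_eq_divide cis_divide[symmetric] cis_cnj simp flip: cis_inverse)
    finally show ?thesis .
  qed
  also have "\<dots> = (LINT x:{0..pi}|lborel. ?F (- x))"
  proof (rule set_integral_cong_set)
    show "AE x in lborel. (x \<in> {0..pi}) = (x \<in> {0<..<pi})"
      using AE_lborel_singleton[of "0::real"] AE_lborel_singleton[of pi] by eventually_elim auto
  qed (unfold set_borel_measurable_def, measurable)
  also have "(LINT x:{0..pi}|lborel. ?F x) + \<dots> = (LINT x:{0..pi}|lborel. ?F x + ?F (- x))"
    by (rule set_integral_add(2)[symmetric]) (rule i)+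
  finally show ?thesis
    unfolding integral_circle_measure[OF f(1)] by simp
qed

lemma circle_preserving_rotation:
  assumes "norm \<omega> = 1"
  shows "circle_preserving (\<lambda>\<zeta>. \<omega> * \<zeta>)"
proof (rule circle_preservingI)
  have "(\<lambda>\<zeta>. \<omega> * \<zeta>) \<in> borel_measurable \<mu>"
    by (intro borel_measurable_circle_continuous continuous_intros)
  hence "(\<lambda>\<zeta>. \<omega> * \<zeta>) \<in> measurable \<mu> (restrict_space borel (sphere 0 1))"
    using assms by (intro measurable_restrict_space2) (auto simp: norm_mult)
  thus "(\<lambda>\<zeta>. \<omega> * \<zeta>) \<in> measurable \<mu> \<mu>"
    by (simp add: measurable_cong_sets[OF refl sets_circle_measure])
  show "(\<integral>\<zeta>. (\<omega> * \<zeta>) ^ k \<partial>\<mu>) = 0" if "k > 0" for k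
    using that by (simp add: power_mult_distrib integral_circle_power)
qed

section \<open>The Poisson kernel as a function of the angle, and its concentration\<close>

definition pker :: "real \<Rightarrow> real \<Rightarrow> real" where
  "pker r x = (1 - r\<^sup>2) / (1 - 2 * r * cos x + r\<^sup>2)"

text \<open>Minus the derivative of \<open>pker r\<close>, so that it is nonnegative on [0, pi],
  where the kernel decreases.\<close>

definition pker_deriv :: "real \<Rightarrow> real \<Rightarrow> real" where
  "pker_deriv r x = (1 - r\<^sup>2) * (2 * r * sin x) / (1 - 2 * r * cos x + r\<^sup>2)\<^sup>2"

lemma pker_denom_pos:
  fixes r x :: real
  assumes "0 \<le> r" "r < 1"
  shows "1 - 2 * r * cos x + r\<^sup>2 > 0"
proof -
  have "r * cos x \<le> r * 1" using assms by (intro mult_left_mono) auto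
  moreover have "(1 - r)\<^sup>2 > 0" using assms by simp
  ultimately show ?thesis by (simp add: power2_eq_square algebra_simps)
qed

lemma norm_cis_minus_sq: "(norm (cis x - of_real r))\<^sup>2 = 1 - 2 * r * cos x + r\<^sup>2"
proof -
  have "(norm (cis x - of_real r))\<^sup>2 = (cos x - r)\<^sup>2 + (sin x)\<^sup>2"
    by (simp add: cmod_power2)
  also have "\<dots> = ((sin x)\<^sup>2 + (cos x)\<^sup>2) - 2 * r * cos x + r\<^sup>2"
    by (simp add: power2_eq_square algebra_simps)
  finally show ?thesis by simp
qed

lemma poisson_kernel_rotate:
  assumes "norm \<omega> = 1"
  shows "poisson_kernel (of_real r * \<omega>) (\<omega> * cis x) = pker r x"
proof -
  have "\<omega> * cis x - of_real r * \<omega> = \<omega> * (cis x - of_real r)" by (simp add: algebra_simps)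
  hence "norm (\<omega> * cis x - of_real r * \<omega>) = norm (cis x - of_real r)"
    using assms by (simp add: norm_mult)
  thus ?thesis
    using assms by (simp add: poisson_kernel_def pker_def norm_cis_minus_sq norm_mult)
qed

lemma pker_nonneg: "0 \<le> r \<Longrightarrow> r < 1 \<Longrightarrow> pker r x \<ge> 0"
  unfolding pker_def using pker_denom_pos[of r x]
  by (intro divide_nonneg_pos) (auto simp: power_le_one)

lemma pker_uminus [simp]: "pker r (- x) = pker r x"
  by (simp add: pker_def)

lemma DERIV_pker:
  assumes "0 \<le> r" "r < 1"
  shows "(pker r has_real_derivative - pker_deriv r x) (at x)"
  unfolding pker_def[abs_def] pker_deriv_def
  using pker_denom_pos[OF assms, of x]
  by (auto intro!: derivative_eq_intros simp: power2_eq_square)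

lemma continuous_on_pker_deriv:
  assumes "0 \<le> r" "r < 1"
  shows "continuous_on UNIV (pker_deriv r)"
  unfolding pker_deriv_def[abs_def]
  using pker_denom_pos[OF assms] by (intro continuous_intros) (metis less_irrefl power_zero_numeral zero_eq_power2)

lemma continuous_on_pker:
  assumes "0 \<le> r" "r < 1"
  shows "continuous_on UNIV (pker r)"
  unfolding pker_def[abs_def]
  using pker_denom_pos[OF assms] by (intro continuous_intros) (metis less_irrefl)

lemma pker_deriv_nonneg:
  assumes "0 \<le> r" "r < 1" "x \<in> {0..pi}"
  shows "pker_deriv r x \<ge> 0"
  unfolding pker_deriv_def using assms
  by (intro divide_nonneg_nonneg mult_nonneg_nonneg) (auto simp: power_le_one sin_ge_zero)

lemma pker_tendsto_0:
  assumes "0 < d" "d \<le> pi"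
  shows "((\<lambda>r. pker r d) \<longlongrightarrow> 0) (at_left 1)"
proof -
  have "cos d < 1" using cos_monotone_0_pi[of 0 d] assms by simp
  thus ?thesis unfolding pker_def by (auto intro!: tendsto_eq_intros)
qed

text \<open>Rotation invariance of the measure moves the boundary point \<omega> to 1, where the
  kernel depends on the angle alone and the circle can be folded.\<close>

lemma poisson_integral_rotate:
  fixes f :: "complex \<Rightarrow> complex"
  assumes f: "f \<in> borel_measurable \<mu>" "\<And>x. norm x = 1 \<Longrightarrow> norm (f x) \<le> B"
    and r: "0 \<le> r" "r < 1" and \<omega>: "norm \<omega> = 1"
  shows "(\<integral>\<zeta>. poisson_kernel (of_real r * \<omega>) \<zeta> *\<^sub>R f \<zeta> \<partial>\<mu>) =
    (LINT x:{0..pi}|lborel. pker r x *\<^sub>R (f (\<omega> * cis x) + f (\<omega> * cis (- x)))) /\<^sub>R (2 * pi)"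
proof -
  let ?g = "\<lambda>\<zeta>. poisson_kernel (of_real r * \<omega>) \<zeta> *\<^sub>R f \<zeta>"
  have z: "norm (of_real r * \<omega>) < 1" using r \<omega> by (simp add: norm_mult)
  obtain K where K: "\<And>\<zeta>. norm \<zeta> = 1 \<Longrightarrow> \<bar>poisson_kernel (of_real r * \<omega>) \<zeta>\<bar> \<le> K" "K \<ge> 0"
    using poisson_kernel_bounded[OF z] by metis
  have g: "?g \<in> borel_measurable \<mu>"
    using f(1) borel_measurable_circle_continuous[OF continuous_on_poisson_kernel[OF z]] by measurable
  have rot: "circle_preserving (\<lambda>\<zeta>. \<omega> * \<zeta>)"
    by (rule circle_preserving_rotation[OF \<omega>])
  have "(\<integral>\<zeta>. ?g \<zeta> \<partial>\<mu>) = (\<integral>\<zeta>. ?g (\<omega> * \<zeta>) \<partial>\<mu>)"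
    by (rule circle_preserving_integral[OF rot g, symmetric])
  also have "\<dots> = (LINT x:{0..pi}|lborel. ?g (\<omega> * cis x) + ?g (\<omega> * cis (- x))) /\<^sub>R (2 * pi)"
  proof (rule integral_circle_fold[where B = "K * B"])
    show "(\<lambda>\<zeta>. ?g (\<omega> * \<zeta>)) \<in> borel_measurable \<mu>"
      by (rule circle_preserving_borel[OF rot g])
    show "norm (?g (\<omega> * x)) \<le> K * B" if "norm x = 1" for x
    proof -
      have 1: "norm (\<omega> * x) = 1" using that \<omega> by (simp add: norm_mult)
      show ?thesis unfolding norm_scaleR
        using f(2)[OF 1] K(1)[OF 1] K(2) by (intro mult_mono) auto
    qed
  qed
  finally show ?thesis
    by (simp only: poisson_kernel_rotate[OF \<omega>] pker_uminus scaleR_add_right)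
qed

text \<open>The Poisson formula for the constant 1; folding doubles the integrand, so the half
  circle carries the mass pi.\<close>

lemma integral_pker:
  assumes "0 \<le> r" "r < 1"
  shows "(LINT x:{0..pi}|lborel. pker r x) = pi"
proof -
  have "(\<integral>\<zeta>. poisson_kernel (of_real r * 1) \<zeta> *\<^sub>R 1 \<partial>\<mu>) = (1 :: complex)"
    by (rule poisson_formula_holomorphic[of "\<lambda>_. 1" 2]) (use assms in auto)
  also have "(\<integral>\<zeta>. poisson_kernel (of_real r * 1) \<zeta> *\<^sub>R (1 :: complex) \<partial>\<mu>) =
      (LINT x:{0..pi}|lborel. pker r x *\<^sub>R (1 + 1)) /\<^sub>R (2 * pi)"
    by (rule poisson_integral_rotate[where B = 1]) (use assms in auto)
  also have "(LINT x:{0..pi}|lborel. pker r x *\<^sub>R (1 + 1 :: complex)) =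
      (LINT x:{0..pi}|lborel. complex_of_real (2 * pker r x))"
    by (simp add: scaleR_conv_of_real mult.commute)
  also have "\<dots> = complex_of_real (LINT x:{0..pi}|lborel. 2 * pker r x)"
    by (rule set_integral_complex_of_real)
  also have "(LINT x:{0..pi}|lborel. 2 * pker r x) = 2 * (LINT x:{0..pi}|lborel. pker r x)"
    by simp
  finally have "complex_of_real ((LINT x:{0..pi}|lborel. pker r x) / pi) = 1"
    by (simp add: scaleR_conv_of_real field_simps)
  thus ?thesis by (simp only: of_real_eq_1_iff) simp
qed

text \<open>Subtracting f (cis t) and folding turns the error into the integral of
  \<open>pker r\<close> against the symmetric difference \<open>?h\<close>, whose primitive is small
  compared with its length for almost every t. The boundary terms of
  \<open>kernel_integral_bound\<close> vanish as r tends to 1 because \<open>pker r x\<close> does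
  for each fixed x in (0, pi].\<close>

lemma fatou_poisson:
  fixes f :: "complex \<Rightarrow> complex"
  assumes f: "f \<in> borel_measurable \<mu>" "\<And>x. norm x = 1 \<Longrightarrow> norm (f x) \<le> B"
  shows "AE t in lborel.
    ((\<lambda>r::real. \<integral>\<zeta>. poisson_kernel (of_real r * cis t) \<zeta> *\<^sub>R f \<zeta> \<partial>\<mu>) \<longlongrightarrow> f (cis t)) (at_left 1)"
proof -
  have F: "(\<lambda>x. f (cis x)) \<in> borel_measurable borel" "\<And>x. norm (f (cis x)) \<le> B"
    using f by (auto intro!: borel_measurable_circle_cis)
  have B: "B \<ge> 0" using F(2)[of 0] norm_ge_zero order.trans by blast
  show ?thesis
    using lebesgue_differentiation_symmetric[OF F]
  proof eventually_elim
    case (elim t)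
    let ?h = "\<lambda>x. f (cis (t + x)) + f (cis (t - x)) - 2 * f (cis t)"
    have h: "?h \<in> borel_measurable borel" using F(1) by measurable
    have h': "norm (?h x) \<le> 4 * B" for x
    proof -
      have "norm (?h x) \<le> norm (f (cis (t + x))) + norm (f (cis (t - x))) + norm (2 * f (cis t))"
        by (intro order.trans[OF norm_triangle_ineq4] add_right_mono norm_triangle_ineq)
      also have "norm (2 * f (cis t)) = 2 * norm (f (cis t))" by (simp add: norm_mult)
      finally show ?thesis using F(2)[of "t + x"] F(2)[of "t - x"] F(2)[of t] by linarith
    qed
    have diff: "(\<integral>\<zeta>. poisson_kernel (of_real r * cis t) \<zeta> *\<^sub>R f \<zeta> \<partial>\<mu>) - f (cis t) =
       (LINT x:{0..pi}|lborel. pker r x *\<^sub>R ?h x) /\<^sub>R (2 * pi)" if r: "0 \<le> r" "r < 1" for r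
    proof -
      let ?g = "\<lambda>x. f (cis (t + x)) + f (cis (t - x))"
      have cp: "continuous_on {0..pi} (pker r)"
        using continuous_on_pker[OF r] by (rule continuous_on_subset) simp
      obtain K where K: "\<forall>y\<in>pker r ` {0..pi}. norm y \<le> K"
        using compact_imp_bounded[OF compact_continuous_image[OF cp]] bounded_iff by (metis compact_Icc)
      have g: "norm (?g x) \<le> 2 * B" for x
        using F(2)[of "t + x"] F(2)[of "t - x"] by (intro norm_triangle_le) simp
      have [measurable]: "pker r \<in> borel_measurable borel"
        using continuous_on_pker[OF r] by (rule borel_measurable_continuous_onI)
      have i1: "set_integrable lborel {0..pi} (\<lambda>x. pker r x *\<^sub>R ?g x)"
        unfolding set_integrable_def
      proof (rule integrableI_bounded_set_indicator[where B = "K * (2 * B)"])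
        show "(\<lambda>x. pker r x *\<^sub>R ?g x) \<in> borel_measurable lborel" using F(1) by measurable
        show "AE x in lborel. x \<in> {0..pi} \<longrightarrow> norm (pker r x *\<^sub>R ?g x) \<le> K * (2 * B)"
          unfolding norm_scaleR using K g by (intro AE_I2 impI mult_mono) (auto intro: order.trans[OF abs_ge_zero])
      qed (auto simp: emeasure_lborel_Icc_eq)
      have i2: "set_integrable lborel {0..pi} (\<lambda>x. pker r x *\<^sub>R (2 * f (cis t)))"
        by (intro borel_integrable_atLeastAtMost' continuous_intros cp)
      have "(LINT x:{0..pi}|lborel. pker r x *\<^sub>R ?h x) =
          (LINT x:{0..pi}|lborel. pker r x *\<^sub>R ?g x) - (LINT x:{0..pi}|lborel. pker r x *\<^sub>R (2 * f (cis t)))"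
        using set_integral_diff(2)[OF i1 i2] by (simp only: scaleR_diff_right)
      also have "(LINT x:{0..pi}|lborel. pker r x *\<^sub>R (2 * f (cis t))) =
          (LINT x:{0..pi}|lborel. pker r x) *\<^sub>R (2 * f (cis t))"
        unfolding set_lebesgue_integral_def
        using borel_integrable_atLeastAtMost'[OF cp] unfolding set_integrable_def
        by (subst integral_scaleR_left[symmetric]) simp_all
      finally have "(LINT x:{0..pi}|lborel. pker r x *\<^sub>R ?h x) =
          (LINT x:{0..pi}|lborel. pker r x *\<^sub>R ?g x) - pi *\<^sub>R (2 * f (cis t))"
        unfolding integral_pker[OF r] .
      moreover have c: "(pi *\<^sub>R (2 * c)) /\<^sub>R (2 * pi) = c" for c :: complex
        by (simp add: scaleR_conv_of_real)
      ultimately have "(LINT x:{0..pi}|lborel. pker r x *\<^sub>R ?h x) /\<^sub>R (2 * pi) =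
          (LINT x:{0..pi}|lborel. pker r x *\<^sub>R ?g x) /\<^sub>R (2 * pi) - f (cis t)"
        by (simp only: scaleR_diff_right c)
      thus ?thesis
        using poisson_integral_rotate[OF f r, of "cis t"] by (simp add: cis_mult)
    qed
    show ?case
    proof (rule tendstoI)
      fix e :: real assume e: "e > 0"
      obtain d0 where d0: "d0 > 0" "\<And>h. 0 \<le> h \<Longrightarrow> h < d0 \<Longrightarrow>
          norm (LINT x:{0..h}|lborel. ?h x) \<le> e * h"
        using elim e by blast
      define d where "d = min d0 pi"
      have d: "0 < d" "d \<le> pi" "\<And>h. 0 \<le> h \<Longrightarrow> h < d \<Longrightarrow>
          norm (LINT x:{0..h}|lborel. ?h x) \<le> e * h"
        using d0 by (auto simp: d_def)
      have "((\<lambda>r. 4 * B * pi * pker r pi + 4 * B * pi * pker r d) \<longlongrightarrow> 4 * B * pi * 0 + 4 * B * pi * 0) (at_left 1)"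
        using d by (intro tendsto_intros pker_tendsto_0) auto
      \<comment> \<open>The boundary terms get less than e * pi and the middle term equals e * pi,
        since the kernel has mass pi; dividing by 2 pi leaves less than e.\<close>
      hence "eventually (\<lambda>r. 4 * B * pi * pker r pi + 4 * B * pi * pker r d < e * pi) (at_left 1)"
        using e by (intro order_tendstoD(2)) auto
      moreover have "eventually (\<lambda>r. r \<in> {0<..<1}) (at_left (1::real))"
        by (rule eventually_at_left_real) simp
      ultimately show "eventually (\<lambda>r. dist (\<integral>\<zeta>. poisson_kernel (of_real r * cis t) \<zeta> *\<^sub>R f \<zeta> \<partial>\<mu>)
           (f (cis t)) < e) (at_left 1)"
      proof eventually_elim
        case (elim r)
        hence r: "0 \<le> r" "r < 1" by auto
        have "norm (LINT x:{0..pi}|lborel. pker r x *\<^sub>R ?h x) \<le>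
          4 * B * pi * pker r pi + e * (LINT t:{0..pi}|lborel. pker r t) + 4 * B * pi * pker r d"
          by (rule kernel_integral_bound[OF h h' DERIV_pker[OF r] continuous_on_pker_deriv[OF r]
                pker_deriv_nonneg[OF r] pker_nonneg[OF r] d(1,2) _ d(3)])
             (use e in auto)
        also have "\<dots> < e * (2 * pi)"
          using elim(1) unfolding integral_pker[OF r] by (simp add: algebra_simps)
        finally have "norm ((LINT x:{0..pi}|lborel. pker r x *\<^sub>R ?h x) /\<^sub>R (2 * pi)) < e"
          by (simp add: divide_simps mult_ac)
        thus ?case unfolding dist_norm diff[OF r] .
      qed
    qed
  qed
qed

section \<open>Composition of inner functions\<close>

lemma poisson_integral_tendsto:
  fixes u :: "nat \<Rightarrow> complex \<Rightarrow> complex"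
  assumes z: "norm z < 1"
    and u: "\<And>n. u n \<in> borel_measurable \<mu>" "\<And>n x. norm x = 1 \<Longrightarrow> norm (u n x) \<le> B"
    and v: "v \<in> borel_measurable \<mu>"
    and lim: "AE \<zeta> in \<mu>. (\<lambda>n. u n \<zeta>) \<longlonglongrightarrow> v \<zeta>"
  shows "(\<lambda>n. \<integral>\<zeta>. poisson_kernel z \<zeta> *\<^sub>R u n \<zeta> \<partial>\<mu>) \<longlonglongrightarrow>
    (\<integral>\<zeta>. poisson_kernel z \<zeta> *\<^sub>R v \<zeta> \<partial>\<mu>)"
proof -
  obtain K where K: "\<And>\<zeta>. norm \<zeta> = 1 \<Longrightarrow> \<bar>poisson_kernel z \<zeta>\<bar> \<le> K" "K \<ge> 0"
    using poisson_kernel_bounded[OF z] by metis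
  have [measurable]: "poisson_kernel z \<in> borel_measurable \<mu>"
    by (rule borel_measurable_circle_continuous[OF continuous_on_poisson_kernel[OF z]])
  note [measurable] = u(1) v
  show ?thesis
  proof (rule integral_dominated_convergence[where w = "\<lambda>_. K * B"])
    show "AE \<zeta> in \<mu>. (\<lambda>n. poisson_kernel z \<zeta> *\<^sub>R u n \<zeta>) \<longlonglongrightarrow> poisson_kernel z \<zeta> *\<^sub>R v \<zeta>"
      using lim by eventually_elim (intro tendsto_intros)
    show "AE \<zeta> in \<mu>. norm (poisson_kernel z \<zeta> *\<^sub>R u n \<zeta>) \<le> K * B" for n
      unfolding norm_scaleR using K u(2) by (intro AE_I2 mult_mono) auto
  qed auto
qed

text \<open>The dilation of \<phi> by \<open>rho n\<close> is holomorphic on the disc of radius 1 /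
  \<open>rho n\<close> > 1, so the exact formula applies to it. Boundedness then allows dominated
  convergence on the circle, and continuity of \<phi> at z gives the value.\<close>

lemma poisson_boundary:
  assumes hol: "\<phi> holomorphic_on ball 0 1" and bd: "\<And>z. norm z < 1 \<Longrightarrow> norm (\<phi> z) \<le> B"
    and \<psi>: "\<psi> \<in> borel_measurable \<mu>"
    and lim: "AE \<zeta> in \<mu>. (\<lambda>n. \<phi> (of_real (rho n) * \<zeta>)) \<longlonglongrightarrow> \<psi> \<zeta>"
    and z: "norm z < 1"
  shows "(\<integral>\<zeta>. poisson_kernel z \<zeta> *\<^sub>R \<psi> \<zeta> \<partial>\<mu>) = \<phi> z"
proof (rule LIMSEQ_unique)
  have "(\<lambda>n. \<integral>\<zeta>. poisson_kernel z \<zeta> *\<^sub>R \<phi> (of_real (rho n) * \<zeta>) \<partial>\<mu>) \<longlonglongrightarrow>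
      (\<integral>\<zeta>. poisson_kernel z \<zeta> *\<^sub>R \<psi> \<zeta> \<partial>\<mu>)"
  proof (rule poisson_integral_tendsto[OF z _ _ \<psi> lim])
    show "(\<lambda>\<zeta>. \<phi> (of_real (rho n) * \<zeta>)) \<in> borel_measurable \<mu>" for n
      using rho_pos[of n] rho_less_1[of n] holomorphic_on_imp_continuous_on[OF hol]
      by (intro borel_measurable_circle_continuous continuous_on_radial) auto
    show "norm (\<phi> (of_real (rho n) * x)) \<le> B" if "norm x = 1" for n x
      using norm_rho_mult_less[of x n] that by (intro bd) auto
  qed
  moreover have "(\<integral>\<zeta>. poisson_kernel z \<zeta> *\<^sub>R \<phi> (of_real (rho n) * \<zeta>) \<partial>\<mu>) =
      \<phi> (of_real (rho n) * z)" for n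
  proof (rule poisson_formula_holomorphic[where R = "1 / rho n"])
    have "(\<lambda>w. of_real (rho n) * w) ` ball 0 (1 / rho n) \<subseteq> (ball 0 1 :: complex set)"
      using rho_pos[of n] by (auto simp: norm_mult field_simps)
    thus "(\<lambda>\<zeta>. \<phi> (of_real (rho n) * \<zeta>)) holomorphic_on ball 0 (1 / rho n)"
      by (intro holomorphic_on_compose_gen[OF _ hol, unfolded o_def] holomorphic_intros) auto
    show "1 < 1 / rho n" using rho_pos[of n] rho_less_1[of n] by (simp add: field_simps)
  qed (rule z)
  ultimately show "(\<lambda>n. \<phi> (of_real (rho n) * z)) \<longlonglongrightarrow>
      (\<integral>\<zeta>. poisson_kernel z \<zeta> *\<^sub>R \<psi> \<zeta> \<partial>\<mu>)" by simp
  have "isCont \<phi> z"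
    using holomorphic_on_imp_continuous_on[OF hol] z
    by (simp add: continuous_on_eq_continuous_at)
  moreover have "(\<lambda>n. of_real (rho n) * z) \<longlonglongrightarrow> of_real 1 * z"
    by (intro tendsto_intros rho_tendsto)
  ultimately show "(\<lambda>n. \<phi> (of_real (rho n) * z)) \<longlonglongrightarrow> \<phi> z"
    using isCont_tendsto_compose by fastforce
qed

lemma integral_boundary:
  assumes "\<phi> holomorphic_on ball 0 1" "\<And>z. norm z < 1 \<Longrightarrow> norm (\<phi> z) \<le> B"
    "\<psi> \<in> borel_measurable \<mu>"
    "AE \<zeta> in \<mu>. (\<lambda>n. \<phi> (of_real (rho n) * \<zeta>)) \<longlonglongrightarrow> \<psi> \<zeta>"
  shows "(\<integral>\<zeta>. \<psi> \<zeta> \<partial>\<mu>) = \<phi> 0"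
proof -
  have "(\<integral>\<zeta>. \<psi> \<zeta> \<partial>\<mu>) = (\<integral>\<zeta>. poisson_kernel 0 \<zeta> *\<^sub>R \<psi> \<zeta> \<partial>\<mu>)"
    by (intro Bochner_Integration.integral_cong) (auto simp: poisson_kernel_def)
  thus ?thesis using poisson_boundary[OF assms, of 0] by simp
qed

lemma inner_functionD:
  assumes "inner_function g"
  shows "g holomorphic_on ball 0 1" "\<And>z. norm z < 1 \<Longrightarrow> norm (g z) < 1"
    "continuous_on (ball 0 1) g"
    "AE \<zeta> in \<mu>. has_radial_limit g \<zeta> (boundary_map g \<zeta>)"
proof -
  show "g holomorphic_on ball 0 1" using assms by (simp add: inner_function_def)
  thus "continuous_on (ball 0 1) g" by (rule holomorphic_on_imp_continuous_on)
  show "norm (g z) < 1" if "norm z < 1" for z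
    using assms that by (force simp: inner_function_def)
  have "AE \<zeta> in \<mu>. \<exists>l. norm l = 1 \<and> has_radial_limit g \<zeta> l"
    using assms by (simp add: inner_function_def)
  thus "AE \<zeta> in \<mu>. has_radial_limit g \<zeta> (boundary_map g \<zeta>)"
    by eventually_elim (use boundary_map_eq in blast)
qed

lemma borel_measurable_boundary_map:
  assumes "inner_function g"
  shows "boundary_map g \<in> borel_measurable \<mu>"
proof -
  have "boundary_map g \<in> measurable \<mu> (restrict_space borel (sphere 0 1))"
    using boundary_map_measurable[OF inner_functionD(3)[OF assms]]
    by (simp add: measurable_cong_sets[OF refl sets_circle_measure])
  thus ?thesis by (simp add: measurable_restrict_space2_iff)
qed

text \<open>The k-th moment of the boundary map is the value at 0 of the bounded holomorphic
  function g ^ k, which vanishes for k > 0.\<close>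

lemma circle_preserving_boundary_map:
  assumes g: "inner_function g" "g 0 = 0"
  shows "circle_preserving (boundary_map g)"
proof (rule circle_preservingI)
  show "boundary_map g \<in> measurable \<mu> \<mu>"
    by (rule boundary_map_measurable[OF inner_functionD(3)[OF g(1)]])
  fix k :: nat assume k: "k > 0"
  have "(\<integral>\<zeta>. boundary_map g \<zeta> ^ k \<partial>\<mu>) = g 0 ^ k"
  proof (rule integral_boundary[where B = 1])
    show "(\<lambda>z. g z ^ k) holomorphic_on ball 0 1"
      using inner_functionD(1)[OF g(1)] by (intro holomorphic_intros)
    show "norm (g z ^ k) \<le> 1" if "norm z < 1" for z
      using inner_functionD(2)[OF g(1) that] by (simp add: norm_power power_le_one)
    show "(\<lambda>\<zeta>. boundary_map g \<zeta> ^ k) \<in> borel_measurable \<mu>"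
      using borel_measurable_boundary_map[OF g(1)] by measurable
    show "AE \<zeta> in \<mu>. (\<lambda>n. g (of_real (rho n) * \<zeta>) ^ k) \<longlonglongrightarrow> boundary_map g \<zeta> ^ k"
      using inner_functionD(4)[OF g(1)]
      by eventually_elim (intro tendsto_intros has_radial_limit_rho)
  qed
  thus "(\<integral>\<zeta>. boundary_map g \<zeta> ^ k \<partial>\<mu>) = 0" using g k by simp
qed

text \<open>The composite is the Poisson integral of the composed boundary maps: this is clear for
  \<open>f (s * g z)\<close> with \<open>s < 1\<close>, where \<open>f (s * \<cdot>)\<close> is continuous on the closed disc.\<close>

lemma poisson_integral_compose:
  assumes f: "inner_function f" and g: "inner_function g" "g 0 = 0" and z: "norm z < 1"
  shows "(\<integral>\<zeta>. poisson_kernel z \<zeta> *\<^sub>R boundary_map f (boundary_map g \<zeta>) \<partial>\<mu>) = f (g z)"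
proof (rule LIMSEQ_unique)
  note gp = circle_preserving_boundary_map[OF g]
  have cont: "isCont f w" if "norm w < 1" for w
    using inner_functionD(3)[OF f] that by (simp add: continuous_on_eq_continuous_at)
  have fm: "(\<lambda>\<zeta>. f (of_real (rho n) * \<zeta>)) \<in> borel_measurable \<mu>" for n
    using rho_pos[of n] rho_less_1[of n] inner_functionD(3)[OF f]
    by (intro borel_measurable_circle_continuous continuous_on_radial) auto
  have um: "(\<lambda>\<zeta>. f (of_real (rho n) * boundary_map g \<zeta>)) \<in> borel_measurable \<mu>" for n
    by (rule circle_preserving_borel[OF gp fm])
  have "(\<lambda>n. \<integral>\<zeta>. poisson_kernel z \<zeta> *\<^sub>R f (of_real (rho n) * boundary_map g \<zeta>) \<partial>\<mu>) \<longlonglongrightarrow>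
      (\<integral>\<zeta>. poisson_kernel z \<zeta> *\<^sub>R boundary_map f (boundary_map g \<zeta>) \<partial>\<mu>)"
  proof (rule poisson_integral_tendsto[where B = 1, OF z um])
    show "norm (f (of_real (rho n) * boundary_map g x)) \<le> 1" for n x
      by (rule less_imp_le, rule inner_functionD(2)[OF f], rule norm_rho_mult_less) simp
    show "(\<lambda>\<zeta>. boundary_map f (boundary_map g \<zeta>)) \<in> borel_measurable \<mu>"
      by (rule circle_preserving_borel[OF gp borel_measurable_boundary_map[OF f]])
    \<comment> \<open>The points where f lacks its radial limit form a null set, and the preimage of
      a null set under the measure-preserving boundary map of g is null.\<close>
    have "AE \<zeta> in \<mu>. has_radial_limit f (boundary_map g \<zeta>) (boundary_map f (boundary_map g \<zeta>))"
      by (rule circle_preserving_AE[OF gp inner_functionD(4)[OF f]])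
    thus "AE \<zeta> in \<mu>. (\<lambda>n. f (of_real (rho n) * boundary_map g \<zeta>)) \<longlonglongrightarrow>
        boundary_map f (boundary_map g \<zeta>)"
      by eventually_elim (rule has_radial_limit_rho)
  qed
  moreover have "(\<integral>\<zeta>. poisson_kernel z \<zeta> *\<^sub>R f (of_real (rho n) * boundary_map g \<zeta>) \<partial>\<mu>) =
      f (of_real (rho n) * g z)" for n
  proof (rule poisson_boundary[where B = 1, OF _ _ um _ z])
    have "(\<lambda>z. of_real (rho n) * g z) ` ball 0 1 \<subseteq> (ball 0 1 :: complex set)"
      using norm_rho_mult_less[OF less_imp_le[OF inner_functionD(2)[OF g(1)]]] by auto
    thus "(\<lambda>z. f (of_real (rho n) * g z)) holomorphic_on ball 0 1"
      using inner_functionD(1)[OF g(1)]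
      by (intro holomorphic_on_compose_gen[OF _ inner_functionD(1)[OF f], unfolded o_def] holomorphic_intros)
    show "norm (f (of_real (rho n) * g w)) \<le> 1" if "norm w < 1" for w
      by (intro less_imp_le inner_functionD(2)[OF f] norm_rho_mult_less inner_functionD(2)[OF g(1)] that)
    show "AE \<zeta> in \<mu>. (\<lambda>m. f (of_real (rho n) * g (of_real (rho m) * \<zeta>)))
        \<longlonglongrightarrow> f (of_real (rho n) * boundary_map g \<zeta>)"
      using inner_functionD(4)[OF g(1)]
    proof eventually_elim
      case (elim \<zeta>)
      show ?case
        by (rule isCont_tendsto_compose[OF cont])
           (intro norm_rho_mult_less tendsto_intros has_radial_limit_rho[OF elim] | simp)+
    qed
  qed
  ultimately show "(\<lambda>n. f (of_real (rho n) * g z)) \<longlonglongrightarrow>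
      (\<integral>\<zeta>. poisson_kernel z \<zeta> *\<^sub>R boundary_map f (boundary_map g \<zeta>) \<partial>\<mu>)"
    by simp
  have "(\<lambda>n. of_real (rho n) * g z) \<longlonglongrightarrow> of_real 1 * g z"
    by (intro tendsto_intros rho_tendsto)
  thus "(\<lambda>n. f (of_real (rho n) * g z)) \<longlonglongrightarrow> f (g z)"
    using isCont_tendsto_compose[OF cont[OF inner_functionD(2)[OF g(1) z]]] by simp
qed

text \<open>Fatou's theorem for the composed boundary maps, whose Poisson integral is f (g z). Only
  radii of the composite enter, never the curve traced by \<open>g (r * \<zeta>)\<close>.\<close>

lemma radial_limit_compose:
  assumes f: "inner_function f" and g: "inner_function g" "g 0 = 0"
  shows "AE t in lborel. has_radial_limit (f \<circ> g) (cis t) (boundary_map f (boundary_map g (cis t)))"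
proof -
  have "AE t in lborel.
    ((\<lambda>r::real. \<integral>\<zeta>. poisson_kernel (of_real r * cis t) \<zeta> *\<^sub>R boundary_map f (boundary_map g \<zeta>) \<partial>\<mu>)
      \<longlongrightarrow> boundary_map f (boundary_map g (cis t))) (at_left 1)"
    by (rule fatou_poisson[where B = 1])
       (auto intro: circle_preserving_borel[OF circle_preserving_boundary_map[OF g] borel_measurable_boundary_map[OF f]])
  thus ?thesis
  proof eventually_elim
    case (elim t)
    have "eventually (\<lambda>r. r \<in> {0<..<1}) (at_left (1::real))"
      by (rule eventually_at_left_real) simp
    hence "eventually (\<lambda>r. (\<integral>\<zeta>. poisson_kernel (of_real r * cis t) \<zeta> *\<^sub>R boundary_map f (boundary_map g \<zeta>) \<partial>\<mu>)
        = (f \<circ> g) (of_real r * cis t)) (at_left (1::real))"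
      by eventually_elim
         (simp only: o_def, rule poisson_integral_compose[OF f g], simp add: norm_mult)
    thus ?case
      using elim unfolding has_radial_limit_def by (rule Lim_transform_eventually[rotated])
  qed
qed

lemma inner_function_compose:
  assumes f: "inner_function f" and g: "inner_function g" "g 0 = 0"
  shows "inner_function (f \<circ> g)"
    "AE \<zeta> in \<mu>. boundary_map (f \<circ> g) \<zeta> = boundary_map f (boundary_map g \<zeta>)"
proof -
  have hol: "(f \<circ> g) holomorphic_on ball 0 1"
    using inner_functionD(2)[OF g(1)]
    by (intro holomorphic_on_compose_gen[OF inner_functionD(1)[OF g(1)] inner_functionD(1)[OF f]]) auto
  hence cont: "continuous_on (ball 0 1) (f \<circ> g)"
    by (rule holomorphic_on_imp_continuous_on)
  note AE = radial_limit_compose[OF f g]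
  have "AE \<zeta> in \<mu>. has_unit_radial_limit (f \<circ> g) \<zeta>"
    unfolding AE_circle_measure_iff[OF sets_has_unit_radial_limit[OF cont]]
    using AE by eventually_elim (unfold has_unit_radial_limit_def, use norm_boundary_map in blast)
  moreover have "(f \<circ> g) ` ball 0 1 \<subseteq> ball 0 1"
    using inner_functionD(2)[OF g(1)] inner_functionD(2)[OF f] by auto
  ultimately show inner: "inner_function (f \<circ> g)"
    using hol by (simp add: inner_function_def has_unit_radial_limit_def)
  note [measurable] = borel_measurable_boundary_map[OF inner]
    circle_preserving_borel[OF circle_preserving_boundary_map[OF g] borel_measurable_boundary_map[OF f]]
  have "{\<zeta> \<in> space \<mu>. boundary_map (f \<circ> g) \<zeta> = boundary_map f (boundary_map g \<zeta>)} \<in> sets \<mu>"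
    by measurable
  hence "{\<zeta> \<in> sphere 0 1. boundary_map (f \<circ> g) \<zeta> = boundary_map f (boundary_map g \<zeta>)} \<in> sets \<mu>"
    by (simp only: space_circle_measure)
  thus "AE \<zeta> in \<mu>. boundary_map (f \<circ> g) \<zeta> = boundary_map f (boundary_map g \<zeta>)"
    unfolding AE_circle_measure_iff
    by (subst AE_circle_measure_iff, assumption) (use AE in eventually_elim, auto intro: boundary_map_eq)
qed

section \<open>Derivatives at 0 and correlations of the iterates\<close>

lemma inner_function_factor:
  assumes H: "inner_function H" "H 0 = 0"
  obtains h where "h holomorphic_on ball 0 1" "\<And>z. norm z < 1 \<Longrightarrow> H z = z * h z"
    "h 0 = deriv H 0" "\<And>z. norm z < 1 \<Longrightarrow> norm (h z) \<le> 1"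
proof -
  obtain h where h: "h holomorphic_on ball 0 1" "\<And>z. norm z < 1 \<Longrightarrow> H z = z * h z" "deriv H 0 = h 0"
    using Schwarz3[OF inner_functionD(1)[OF H(1)] H(2)] by blast
  have "norm (h z) \<le> 1" if z: "norm z < 1" for z
  proof (cases "z = 0")
    case True
    thus ?thesis
      using Schwarz_Lemma(2)[OF inner_functionD(1)[OF H(1)] H(2) inner_functionD(2)[OF H(1)], of 0] h(3) by auto
  next
    case False
    have "norm (H z) \<le> norm z"
      using Schwarz_Lemma(1)[OF inner_functionD(1)[OF H(1)] H(2) inner_functionD(2)[OF H(1)]] z by auto
    thus ?thesis using h(2)[OF z] False by (simp add: norm_mult)
  qed
  thus ?thesis using h by (intro that[of h]) auto
qed

lemma integral_boundary_map_power:
  assumes H: "inner_function H" "H 0 = 0"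
  shows "(\<integral>\<zeta>. boundary_map H \<zeta> ^ k * cnj \<zeta> ^ k \<partial>\<mu>) = deriv H 0 ^ k"
proof -
  obtain h where h: "h holomorphic_on ball 0 1" "\<And>z. norm z < 1 \<Longrightarrow> H z = z * h z"
    "h 0 = deriv H 0" "\<And>z. norm z < 1 \<Longrightarrow> norm (h z) \<le> 1"
    using inner_function_factor[OF H] by metis
  have "(\<integral>\<zeta>. boundary_map H \<zeta> ^ k * cnj \<zeta> ^ k \<partial>\<mu>) = h 0 ^ k"
  proof (rule integral_boundary[where B = 1])
    show "(\<lambda>z. h z ^ k) holomorphic_on ball 0 1"
      using h(1) by (intro holomorphic_intros)
    show "norm (h z ^ k) \<le> 1" if "norm z < 1" for z
      using h(4)[OF that] by (simp add: norm_power power_le_one)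
    have "(\<lambda>\<zeta>. cnj \<zeta> ^ k) \<in> borel_measurable \<mu>"
      by (intro borel_measurable_circle_continuous continuous_intros)
    thus "(\<lambda>\<zeta>. boundary_map H \<zeta> ^ k * cnj \<zeta> ^ k) \<in> borel_measurable \<mu>"
      using borel_measurable_boundary_map[OF H(1)] by measurable
    have "AE \<zeta> in \<mu>. norm \<zeta> = 1" by (intro AE_I2) simp
    with inner_functionD(4)[OF H(1)]
    show "AE \<zeta> in \<mu>. (\<lambda>n. h (of_real (rho n) * \<zeta>) ^ k) \<longlonglongrightarrow>
        boundary_map H \<zeta> ^ k * cnj \<zeta> ^ k"
    proof eventually_elim
      case (elim \<zeta>)
      hence \<zeta>: "\<zeta> \<noteq> 0" by auto
      have eq: "h (of_real (rho n) * \<zeta>) = H (of_real (rho n) * \<zeta>) / (of_real (rho n) * \<zeta>)" for n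
        using h(2)[of "of_real (rho n) * \<zeta>"] rho_pos[of n] rho_less_1[of n] elim(2) \<zeta>
        by (simp add: norm_mult)
      have "(\<lambda>n. of_real (rho n) * \<zeta>) \<longlonglongrightarrow> of_real 1 * \<zeta>"
        by (intro tendsto_intros rho_tendsto)
      hence "(\<lambda>n. h (of_real (rho n) * \<zeta>)) \<longlonglongrightarrow> boundary_map H \<zeta> / (of_real 1 * \<zeta>)"
        unfolding eq using \<zeta> has_radial_limit_rho[OF elim(1)] by (intro tendsto_divide) auto
      also have "boundary_map H \<zeta> / (of_real 1 * \<zeta>) = boundary_map H \<zeta> * cnj \<zeta>"
        using inverse_eq_cnj[OF elim(2)] by (simp add: divide_inverse)
      finally show ?case
        unfolding power_mult_distrib[symmetric] by (rule tendsto_power)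
    qed
  qed
  thus ?thesis using h(3) by simp
qed

text \<open>Almost everywhere the integrand is the one for H alone, evaluated at the boundary map of
  G, and that map preserves the measure.\<close>

lemma integral_boundary_map_compose:
  assumes H: "inner_function H" "H 0 = 0" and G: "inner_function G" "G 0 = 0"
  shows "(\<integral>\<zeta>. boundary_map (H \<circ> G) \<zeta> ^ k * cnj (boundary_map G \<zeta>) ^ k \<partial>\<mu>) = deriv H 0 ^ k"
proof -
  note Gp = circle_preserving_boundary_map[OF G]
  note HG = inner_function_compose[OF H(1) G]
  have c: "(\<lambda>\<zeta>. cnj \<zeta> ^ k) \<in> borel_measurable \<mu>"
    by (intro borel_measurable_circle_continuous continuous_intros)
  have m1: "(\<lambda>\<zeta>. boundary_map H \<zeta> ^ k * cnj \<zeta> ^ k) \<in> borel_measurable \<mu>"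
    using borel_measurable_boundary_map[OF H(1)] c by measurable
  have m2: "(\<lambda>\<zeta>. boundary_map (H \<circ> G) \<zeta> ^ k * cnj (boundary_map G \<zeta>) ^ k) \<in> borel_measurable \<mu>"
    using borel_measurable_boundary_map[OF HG(1)] circle_preserving_borel[OF Gp c] by measurable
  have "(\<integral>\<zeta>. boundary_map (H \<circ> G) \<zeta> ^ k * cnj (boundary_map G \<zeta>) ^ k \<partial>\<mu>) =
      (\<integral>\<zeta>. boundary_map H (boundary_map G \<zeta>) ^ k * cnj (boundary_map G \<zeta>) ^ k \<partial>\<mu>)"
    by (rule integral_cong_AE[OF m2 circle_preserving_borel[OF Gp m1]])
       (use HG(2) in eventually_elim, simp)
  also have "\<dots> = deriv H 0 ^ k"
    using circle_preserving_integral[OF Gp m1] integral_boundary_map_power[OF H] by simp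
  finally show ?thesis .
qed

lemma inner_function_id: "inner_function id"
proof -
  have "has_radial_limit id \<zeta> \<zeta>" for \<zeta>
    unfolding has_radial_limit_def by (auto intro!: tendsto_eq_intros)
  thus ?thesis
    unfolding inner_function_def by (auto intro!: AE_I2)
qed

lemma inner_comp_seq:
  assumes "\<And>n. n \<ge> 1 \<Longrightarrow> inner_function (g n)" "\<And>n. n \<ge> 1 \<Longrightarrow> g n 0 = 0"
  shows "inner_function (comp_seq g n)" "comp_seq g n 0 = 0"
proof (induction n)
  case (Suc n)
  show "inner_function (comp_seq g (Suc n))" "comp_seq g (Suc n) 0 = 0"
    using Suc assms by (auto intro!: inner_function_compose)
qed (auto simp: inner_function_id)

lemma comp_seq_add:
  "comp_seq g (m + d) = comp_seq (\<lambda>j. g (m + j)) d \<circ> comp_seq g m"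
  by (induction d) (auto simp: o_assoc)

lemma deriv_comp_seq:
  assumes "\<And>n. n \<ge> 1 \<Longrightarrow> inner_function (g n)" "\<And>n. n \<ge> 1 \<Longrightarrow> g n 0 = 0"
  shows "deriv (comp_seq g n) 0 = (\<Prod>j=1..n. deriv (g j) 0)"
proof (induction n)
  case (Suc n)
  note G = inner_comp_seq[where g = g, OF assms]
  have diff: "f field_differentiable (at 0)" if "inner_function f" for f
    using inner_functionD(1)[OF that] by (rule holomorphic_on_imp_differentiable_at) auto
  have "deriv (comp_seq g (Suc n)) 0 = deriv (g (Suc n)) (comp_seq g n 0) * deriv (comp_seq g n) 0"
    unfolding comp_seq.simps using G assms by (intro deriv_chain diff) (auto intro!: diff)
  also have "\<dots> = deriv (g (Suc n)) 0 * (\<Prod>j=1..n. deriv (g j) 0)"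
    using Suc G by simp
  also have "\<dots> = (\<Prod>j=1..Suc n. deriv (g j) 0)"
    by (simp add: mult.commute)
  finally show ?case .
qed (simp add: id_def)

lemma comp_seq_correlation:
  assumes inner: "\<And>n. n \<ge> 1 \<Longrightarrow> inner_function (g n)" and zero: "\<And>n. n \<ge> 1 \<Longrightarrow> g n 0 = 0"
    and le: "m \<le> n"
  shows "(\<integral>\<zeta>. boundary_map (comp_seq g n) \<zeta> ^ k * cnj (boundary_map (comp_seq g m) \<zeta>) ^ k \<partial>\<mu>)
    = (\<Prod>j=m+1..n. deriv (g j) 0) ^ k"
proof -
  \<comment> \<open>What is applied after time m is again an iterate, of the sequence shifted by m;
    its first factor is g (m + 1), which explains the range of the product.\<close>
  let ?H = "comp_seq (\<lambda>j. g (m + j)) (n - m)"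
  have "comp_seq g n = ?H \<circ> comp_seq g m"
    using comp_seq_add[of g m "n - m"] le by simp
  moreover have H: "inner_function ?H" "?H 0 = 0"
    using inner_comp_seq[of "\<lambda>j. g (m + j)"] inner zero by auto
  moreover have "deriv ?H 0 = (\<Prod>j=1..n-m. deriv (g (m + j)) 0)"
    using deriv_comp_seq[of "\<lambda>j. g (m + j)"] inner zero by auto
  moreover have "(\<Prod>j=1..n-m. deriv (g (m + j)) 0) = (\<Prod>j=m+1..n. deriv (g j) 0)"
    using le by (intro prod.reindex_bij_witness[of _ "\<lambda>j. j - m" "\<lambda>j. m + j"]) auto
  ultimately show ?thesis
    using integral_boundary_map_compose[OF H inner_comp_seq[where g = g, OF inner zero, of m]] by simp
qed

section \<open>Ergodicity in terms of powers\<close>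

lemma norm_add_sq_le: "(norm (a + b :: 'a::real_normed_vector))\<^sup>2 \<le> 2 * (norm a)\<^sup>2 + 2 * (norm b)\<^sup>2"
proof -
  have "(norm (a + b))\<^sup>2 \<le> (norm a + norm b)\<^sup>2"
    by (intro power_mono norm_triangle_ineq) simp
  also have "\<dots> \<le> 2 * (norm a)\<^sup>2 + 2 * (norm b)\<^sup>2"
    using zero_le_power2[of "norm a - norm b"] by (simp add: power2_eq_square algebra_simps)
  finally show ?thesis .
qed

lemma measure_circle_sphere [simp]: "measure \<mu> (sphere 0 1) = 1"
  using circle.prob_space by simp

abbreviation circle_L2 :: "(complex \<Rightarrow> complex) \<Rightarrow> bool" where
  "circle_L2 \<equiv> square_integrable \<mu>"

lemma circle_L2_dominated:
  assumes "f \<in> borel_measurable \<mu>" "integrable \<mu> w"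
    "\<And>x. norm x = 1 \<Longrightarrow> (norm (f x))\<^sup>2 \<le> w x"
  shows "circle_L2 f"
proof -
  note [measurable] = assms(1)
  have "integrable \<mu> (\<lambda>x. (norm (f x))\<^sup>2)"
    using assms(2)
  proof (rule Bochner_Integration.integrable_bound)
    show "AE x in \<mu>. norm ((norm (f x))\<^sup>2) \<le> norm (w x)"
      using assms(3) by (intro AE_I2) (auto intro: order.trans abs_ge_self)
  qed measurable
  thus ?thesis using assms(1) by (simp add: square_integrable_def)
qed

lemma circle_L2_bounded:
  assumes "f \<in> borel_measurable \<mu>" "\<And>x. norm x = 1 \<Longrightarrow> norm (f x) \<le> B"
  shows "circle_L2 f"
  by (rule circle_L2_dominated[where w = "\<lambda>_. B\<^sup>2"]) (use assms in \<open>auto intro: power_mono\<close>)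

lemma circle_L2_add:
  assumes "circle_L2 f" "circle_L2 g"
  shows "circle_L2 (\<lambda>x. f x + g x)"
proof (rule circle_L2_dominated)
  show "integrable \<mu> (\<lambda>x. 2 * (norm (f x))\<^sup>2 + 2 * (norm (g x))\<^sup>2)"
    using assms by (auto simp: square_integrable_def)
  show "(\<lambda>x. f x + g x) \<in> borel_measurable \<mu>"
    using assms by (auto simp: square_integrable_def)
qed (rule norm_add_sq_le)

lemma circle_L2_scale:
  assumes "circle_L2 f"
  shows "circle_L2 (\<lambda>x. c * f x)"
  using assms by (auto simp: square_integrable_def norm_mult power_mult_distrib)

lemma circle_L2_diff:
  assumes "circle_L2 f" "circle_L2 g"
  shows "circle_L2 (\<lambda>x. f x - g x)"
  using circle_L2_add[OF assms(1) circle_L2_scale[OF assms(2), of "-1"]] by simp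

lemma circle_L2_const: "circle_L2 (\<lambda>_. c)"
  by (rule circle_L2_bounded[of _ "norm c"]) auto

lemma circle_L2_sum:
  assumes "finite A" "\<And>i. i \<in> A \<Longrightarrow> circle_L2 (f i)"
  shows "circle_L2 (\<lambda>x. \<Sum>i\<in>A. f i x)"
  using assms by (induction A rule: finite_induct) (auto intro: circle_L2_add circle_L2_const)

lemma circle_L2_compose:
  assumes "circle_preserving T" "circle_L2 f"
  shows "circle_L2 (\<lambda>x. f (T x))"
  using circle_preserving_borel[OF assms(1), of f] circle_preserving_integrable[OF assms(1), of "\<lambda>x. (norm (f x))\<^sup>2"]
    assms(2) by (auto simp: square_integrable_def)

lemma circle_L2_integrable:
  assumes "circle_L2 f"
  shows "integrable \<mu> f"
proof (rule Bochner_Integration.integrable_bound[where f = "\<lambda>x. 1 + (norm (f x))\<^sup>2"])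
  show "integrable \<mu> (\<lambda>x. 1 + (norm (f x))\<^sup>2)"
    using assms by (auto simp: square_integrable_def)
  have "norm (f x) \<le> 1 + (norm (f x))\<^sup>2" for x
  proof -
    have "2 * norm (f x) \<le> 1 + (norm (f x))\<^sup>2"
      using zero_le_power2[of "norm (f x) - 1"] by (simp add: power2_eq_square algebra_simps)
    thus ?thesis using norm_ge_zero[of "f x"] by linarith
  qed
  thus "AE x in \<mu>. norm (f x) \<le> norm (1 + (norm (f x))\<^sup>2)"
    by (intro AE_I2) simp
qed (use assms in \<open>auto simp: square_integrable_def\<close>)

text \<open>The squared norm avoids square roots and expands directly into correlations; the price
  is the factor 2 in place of the triangle inequality.\<close>

definition circle_sq :: "(complex \<Rightarrow> complex) \<Rightarrow> real" where
  "circle_sq f = (\<integral>x. (norm (f x))\<^sup>2 \<partial>\<mu>)"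

lemma circle_sq_nonneg: "circle_sq f \<ge> 0"
  unfolding circle_sq_def by simp

lemma circle_sq_add_le:
  assumes "circle_L2 f" "circle_L2 g"
  shows "circle_sq (\<lambda>x. f x + g x) \<le> 2 * circle_sq f + 2 * circle_sq g"
proof -
  have "circle_sq (\<lambda>x. f x + g x) \<le> (\<integral>x. 2 * (norm (f x))\<^sup>2 + 2 * (norm (g x))\<^sup>2 \<partial>\<mu>)"
    unfolding circle_sq_def using circle_L2_add[OF assms] assms
    by (intro integral_mono) (auto simp: square_integrable_def norm_add_sq_le)
  also have "\<dots> = 2 * circle_sq f + 2 * circle_sq g"
    unfolding circle_sq_def using assms by (auto simp: square_integrable_def)
  finally show ?thesis .
qed

lemma circle_sq_scale: "circle_sq (\<lambda>x. c * f x) = (norm c)\<^sup>2 * circle_sq f"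
  unfolding circle_sq_def by (simp add: norm_mult power_mult_distrib)

lemma circle_sq_compose:
  assumes "circle_preserving T" "f \<in> borel_measurable \<mu>"
  shows "circle_sq (\<lambda>x. f (T x)) = circle_sq f"
  unfolding circle_sq_def
  by (rule circle_preserving_integral[OF assms(1), of "\<lambda>x. (norm (f x))\<^sup>2"]) (use assms(2) in measurable)

text \<open>Nonnegativity of the variance of |f|.\<close>

lemma norm_integral_sq_le:
  assumes "circle_L2 f"
  shows "(norm (\<integral>x. f x \<partial>\<mu>))\<^sup>2 \<le> circle_sq f"
proof -
  have i: "integrable \<mu> (\<lambda>x. norm (f x))" "integrable \<mu> (\<lambda>x. (norm (f x))\<^sup>2)"
    using circle_L2_integrable[OF assms] assms by (auto simp: square_integrable_def)
  have "(norm (\<integral>x. f x \<partial>\<mu>))\<^sup>2 \<le> (\<integral>x. norm (f x) \<partial>\<mu>)\<^sup>2"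
    by (intro power_mono integral_norm_bound) simp
  also have "\<dots> \<le> circle_sq f"
    using circle.variance_positive[of "\<lambda>x. norm (f x)"] circle.variance_eq[OF i]
    by (simp add: circle_sq_def)
  finally show ?thesis .
qed

definition time_average :: "(nat \<Rightarrow> complex \<Rightarrow> complex) \<Rightarrow> (complex \<Rightarrow> complex) \<Rightarrow> nat \<Rightarrow> complex \<Rightarrow> complex" where
  "time_average T \<phi> N x = (\<Sum>n=1..N. \<phi> (T n x)) / of_nat N"

definition ergodic_defect :: "(nat \<Rightarrow> complex \<Rightarrow> complex) \<Rightarrow> (complex \<Rightarrow> complex) \<Rightarrow> nat \<Rightarrow> real" where
  "ergodic_defect T \<phi> N = circle_sq (\<lambda>x. time_average T \<phi> N x - (\<integral>y. \<phi> y \<partial>\<mu>))"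

lemma ergodic_defect_nonneg: "ergodic_defect T \<phi> N \<ge> 0"
  by (simp add: ergodic_defect_def circle_sq_nonneg)

lemma ergodic_seq_iff_defect:
  "ergodic_seq \<mu> T \<longleftrightarrow> (\<forall>\<phi>. circle_L2 \<phi> \<longrightarrow> ergodic_defect T \<phi> \<longlonglongrightarrow> 0)"
proof -
  have eq: "l2_norm \<mu> (\<lambda>x. (\<Sum>n=1..N. \<phi> (T n x)) / of_nat N - (\<integral>y. \<phi> y \<partial>\<mu>)) =
     sqrt (ergodic_defect T \<phi> N)" for \<phi> N
    by (simp add: l2_norm_def ergodic_defect_def time_average_def circle_sq_def)
  have "(\<lambda>N. sqrt (a N)) \<longlonglongrightarrow> 0 \<longleftrightarrow> a \<longlonglongrightarrow> 0" if "\<And>N. a N \<ge> 0" for a :: "nat \<Rightarrow> real"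
  proof
    assume "(\<lambda>N. sqrt (a N)) \<longlonglongrightarrow> 0"
    hence "(\<lambda>N. (sqrt (a N))\<^sup>2) \<longlonglongrightarrow> 0\<^sup>2" by (rule tendsto_power)
    thus "a \<longlonglongrightarrow> 0" using that by simp
  next
    assume "a \<longlonglongrightarrow> 0"
    from tendsto_real_sqrt[OF this] show "(\<lambda>N. sqrt (a N)) \<longlonglongrightarrow> 0" by simp
  qed
  thus ?thesis
    unfolding ergodic_seq_def eq by (simp add: ergodic_defect_nonneg)
qed

context
  fixes T :: "nat \<Rightarrow> complex \<Rightarrow> complex"
  assumes T: "\<And>n. n \<ge> 1 \<Longrightarrow> circle_preserving (T n)"
begin

lemma circle_L2_time_average:
  assumes "circle_L2 \<phi>"
  shows "circle_L2 (time_average T \<phi> N)"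
proof -
  have "circle_L2 (\<lambda>x. (1 / of_nat N) * (\<Sum>n=1..N. \<phi> (T n x)))"
    by (rule circle_L2_scale, rule circle_L2_sum, simp, rule circle_L2_compose[OF T assms]) simp
  thus ?thesis by (simp add: time_average_def[abs_def])
qed

text \<open>Pointwise Cauchy-Schwarz bounds the square of the average by the average of the squares,
  and each \<open>T n\<close> preserves the integral of the square.\<close>

lemma circle_sq_time_average_le:
  assumes \<phi>: "circle_L2 \<phi>"
  shows "circle_sq (time_average T \<phi> N) \<le> circle_sq \<phi>"
proof (cases "N = 0")
  case True
  thus ?thesis using circle_sq_nonneg[of \<phi>] by (simp add: time_average_def circle_sq_def)
next
  case False
  have i: "integrable \<mu> (\<lambda>x. (norm (\<phi> (T n x)))\<^sup>2)" if "n \<in> {1..N}" for n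
    using circle_L2_compose[OF T \<phi>, of n] that by (auto simp: square_integrable_def)
  have pointwise: "(norm (time_average T \<phi> N x))\<^sup>2 \<le> (\<Sum>n=1..N. (norm (\<phi> (T n x)))\<^sup>2) / real N" for x
  proof -
    have "(norm (\<Sum>n=1..N. \<phi> (T n x)))\<^sup>2 \<le> (\<Sum>n=1..N. norm (\<phi> (T n x)))\<^sup>2"
      by (intro power_mono norm_sum) simp
    also have "\<dots> \<le> (\<Sum>n=1..N. (norm (\<phi> (T n x)))\<^sup>2) * real (card {1..N})"
      by (rule sum_squared_le_sum_of_squares)
    finally have "(norm (\<Sum>n=1..N. \<phi> (T n x)))\<^sup>2 \<le> (\<Sum>n=1..N. (norm (\<phi> (T n x)))\<^sup>2) * real N"
      by simp
    thus ?thesis using False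
      by (simp add: time_average_def norm_divide power_divide power2_eq_square field_simps)
  qed
  have "circle_sq (time_average T \<phi> N) \<le> (\<integral>x. (\<Sum>n=1..N. (norm (\<phi> (T n x)))\<^sup>2) / real N \<partial>\<mu>)"
    unfolding circle_sq_def using circle_L2_time_average[OF \<phi>] i pointwise
    by (intro integral_mono Bochner_Integration.integrable_divide Bochner_Integration.integrable_sum) (auto simp: square_integrable_def)
  also have "\<dots> = (\<Sum>n=1..N. circle_sq (\<lambda>x. \<phi> (T n x))) / real N"
    using i by (subst integral_divide_zero, subst Bochner_Integration.integral_sum) (auto simp: circle_sq_def)
  also have "\<dots> = (\<Sum>n=1..N. circle_sq \<phi>) / real N"
    using \<phi> T by (intro arg_cong[where f = "\<lambda>s. s / real N"] sum.cong circle_sq_compose) (auto simp: square_integrable_def)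
  finally show ?thesis using False by simp
qed

text \<open>A bound independent of N: it is what makes the set of observables with vanishing defect
  closed in L2.\<close>

lemma ergodic_defect_le:
  assumes "circle_L2 \<phi>"
  shows "ergodic_defect T \<phi> N \<le> 4 * circle_sq \<phi>"
proof -
  have "ergodic_defect T \<phi> N \<le> 2 * circle_sq (time_average T \<phi> N) +
      2 * circle_sq (\<lambda>_. - (\<integral>y. \<phi> y \<partial>\<mu>))"
    using circle_sq_add_le[OF circle_L2_time_average[OF assms] circle_L2_const[of "- (\<integral>y. \<phi> y \<partial>\<mu>)"], of N]
    by (simp add: ergodic_defect_def)
  also have "circle_sq (\<lambda>_. - (\<integral>y. \<phi> y \<partial>\<mu>)) \<le> circle_sq \<phi>"
    using norm_integral_sq_le[OF assms] by (simp add: circle_sq_def circle.prob_space)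
  finally show ?thesis using circle_sq_time_average_le[OF assms, of N] by linarith
qed

lemma ergodic_defect_add_le:
  assumes "circle_L2 \<phi>" "circle_L2 \<psi>"
  shows "ergodic_defect T (\<lambda>x. \<phi> x + \<psi> x) N \<le> 2 * ergodic_defect T \<phi> N + 2 * ergodic_defect T \<psi> N"
proof -
  have "(\<lambda>x. time_average T (\<lambda>x. \<phi> x + \<psi> x) N x - (\<integral>y. \<phi> y + \<psi> y \<partial>\<mu>)) =
     (\<lambda>x. (time_average T \<phi> N x - (\<integral>y. \<phi> y \<partial>\<mu>)) + (time_average T \<psi> N x - (\<integral>y. \<psi> y \<partial>\<mu>)))"
    using assms[THEN circle_L2_integrable]
    by (simp add: time_average_def sum.distrib add_divide_distrib add_diff_add)
  thus ?thesis unfolding ergodic_defect_def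
    using circle_sq_add_le[OF circle_L2_diff circle_L2_diff, OF circle_L2_time_average circle_L2_const
        circle_L2_time_average circle_L2_const, OF assms]
    by simp
qed

lemma ergodic_defect_scale:
  "ergodic_defect T (\<lambda>x. c * \<phi> x) N = (norm c)\<^sup>2 * ergodic_defect T \<phi> N"
proof -
  have "(\<lambda>x. time_average T (\<lambda>x. c * \<phi> x) N x - (\<integral>y. c * \<phi> y \<partial>\<mu>)) =
     (\<lambda>x. c * (time_average T \<phi> N x - (\<integral>y. \<phi> y \<partial>\<mu>)))"
    by (simp add: time_average_def sum_distrib_left ring_distribs)
  thus ?thesis unfolding ergodic_defect_def by (simp add: circle_sq_scale)
qed

lemma ergodic_defect_limit:
  assumes s: "\<And>i::nat. circle_L2 (s i)" "\<And>i. ergodic_defect T (s i) \<longlonglongrightarrow> 0"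
    and f: "circle_L2 f" and conv: "(\<lambda>i. circle_sq (\<lambda>x. f x - s i x)) \<longlonglongrightarrow> 0"
  shows "ergodic_defect T f \<longlonglongrightarrow> 0"
proof (rule LIMSEQ_I)
  fix e :: real assume e: "e > 0"
  \<comment> \<open>The defect of f - s i is at most 4 times its square norm, so below e / 4;
    doubling both contributions gives less than e.\<close>
  obtain i where i: "circle_sq (\<lambda>x. f x - s i x) < e / 16"
    using order_tendstoD(2)[OF conv, of "e / 16"] e by (auto simp: eventually_sequentially)
  obtain N0 where N0: "\<And>N. N \<ge> N0 \<Longrightarrow> ergodic_defect T (s i) N < e / 4"
    using order_tendstoD(2)[OF s(2)[of i], of "e / 4"] e by (auto simp: eventually_sequentially)
  have "norm (ergodic_defect T f N - 0) < e" if N: "N \<ge> N0" for N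
  proof -
    have d: "circle_L2 (\<lambda>x. f x - s i x)" by (rule circle_L2_diff[OF f s(1)])
    have "ergodic_defect T f N = ergodic_defect T (\<lambda>x. s i x + (f x - s i x)) N" by simp
    also have "\<dots> \<le> 2 * ergodic_defect T (s i) N + 2 * ergodic_defect T (\<lambda>x. f x - s i x) N"
      by (rule ergodic_defect_add_le[OF s(1) d])
    also have "\<dots> < e" using N0[OF N] i ergodic_defect_le[OF d, of N] by linarith
    finally show ?thesis by (simp add: ergodic_defect_def circle_sq_nonneg)
  qed
  thus "\<exists>N0. \<forall>N\<ge>N0. norm (ergodic_defect T f N - 0) < e" by blast
qed

lemma circle_sq_dominated:
  assumes s: "\<And>i::nat. s i \<in> borel_measurable \<mu>" and f: "f \<in> borel_measurable \<mu>"
    and w: "integrable \<mu> w"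
    and le: "\<And>i x. norm x = 1 \<Longrightarrow> (norm (f x - s i x))\<^sup>2 \<le> w x"
    and lim: "\<And>x. norm x = 1 \<Longrightarrow> (\<lambda>i. s i x) \<longlonglongrightarrow> f x"
  shows "(\<lambda>i. circle_sq (\<lambda>x. f x - s i x)) \<longlonglongrightarrow> 0"
proof -
  note [measurable] = s f
  have "(\<lambda>i. \<integral>x. (norm (f x - s i x))\<^sup>2 \<partial>\<mu>) \<longlonglongrightarrow> (\<integral>x. 0 \<partial>\<mu>)"
  proof (rule integral_dominated_convergence[OF _ _ w])
    show "AE x in \<mu>. (\<lambda>i. (norm (f x - s i x))\<^sup>2) \<longlonglongrightarrow> 0"
    proof (intro AE_I2)
      fix x assume "x \<in> space \<mu>"
      hence "(\<lambda>i. (norm (f x - s i x))\<^sup>2) \<longlonglongrightarrow> (norm (f x - f x))\<^sup>2"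
        by (intro tendsto_intros lim) simp
      thus "(\<lambda>i. (norm (f x - s i x))\<^sup>2) \<longlonglongrightarrow> 0" by simp
    qed
    show "AE x in \<mu>. norm ((norm (f x - s i x))\<^sup>2) \<le> w x" for i
      using le by (intro AE_I2) simp
  qed measurable
  thus ?thesis by (simp add: circle_sq_def)
qed

text \<open>Bounded observables with vanishing defect form a \<open>circle_function_class\<close>,
  so they include the simple functions. A square integrable function is then approximated in L2 by
  simple functions that it dominates up to a factor 2.\<close>

lemma ergodic_seq_circle_iff:
  "ergodic_seq \<mu> T \<longleftrightarrow>
   (\<forall>k\<ge>1. (\<lambda>N. circle_sq (\<lambda>x. (\<Sum>n=1..N. T n x ^ k) / of_nat N)) \<longlonglongrightarrow> 0)"
proof -
  have powL2: "circle_L2 (\<lambda>z. z ^ k)" "circle_L2 (\<lambda>z. cnj z ^ k)" for k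
    by (rule circle_L2_bounded[of _ 1];
        auto simp: norm_power intro!: borel_measurable_circle_continuous continuous_intros)+
  have def_pow: "ergodic_defect T (\<lambda>z. z ^ k) = (\<lambda>N. circle_sq (\<lambda>x. (\<Sum>n=1..N. T n x ^ k) / of_nat N))"
    if "k \<ge> 1" for k
    using integral_circle_power(1)[of k] that by (simp add: ergodic_defect_def time_average_def fun_eq_iff)
  show ?thesis unfolding ergodic_seq_iff_defect
  proof (intro iffI allI impI)
    fix k :: nat assume hyp: "\<forall>\<phi>. circle_L2 \<phi> \<longrightarrow> ergodic_defect T \<phi> \<longlonglongrightarrow> 0" and k: "k \<ge> 1"
    show "(\<lambda>N. circle_sq (\<lambda>x. (\<Sum>n=1..N. T n x ^ k) / of_nat N)) \<longlonglongrightarrow> 0"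
      unfolding def_pow[OF k, symmetric] using hyp powL2(1) by blast
  next
    assume hyp: "\<forall>k\<ge>1. (\<lambda>N. circle_sq (\<lambda>x. (\<Sum>n=1..N. T n x ^ k) / of_nat N)) \<longlonglongrightarrow> 0"
    define P where "P \<phi> \<longleftrightarrow> circle_L2 \<phi> \<and> (\<exists>B. \<forall>x. norm x = 1 \<longrightarrow> norm (\<phi> x) \<le> B) \<and>
      ergodic_defect T \<phi> \<longlonglongrightarrow> 0" for \<phi>
    have const: "ergodic_defect T (\<lambda>_. 1) \<longlonglongrightarrow> 0"
    proof (rule tendsto_eventually)
      show "\<forall>\<^sub>F N in sequentially. ergodic_defect T (\<lambda>_. 1) N = 0"
        using eventually_gt_at_top[of 0]
        by eventually_elim (simp add: ergodic_defect_def time_average_def circle_sq_def circle.prob_space)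
    qed
    interpret circle_function_class P
    proof
      fix k :: nat
      have "ergodic_defect T (\<lambda>z. z ^ k) \<longlonglongrightarrow> 0"
      proof (cases "k = 0")
        case False
        hence k: "k \<ge> 1" by simp
        show ?thesis unfolding def_pow[OF k] using hyp k by blast
      qed (use const in simp)
      thus "P (\<lambda>z. z ^ k)"
        unfolding P_def using powL2 by (auto simp: norm_power intro!: exI[of _ 1])
      \<comment> \<open>For k \<ge> 1 the mean is 0 and the averages of the conjugate powers are
        conjugates of the averages of the powers, so nothing new has to be assumed for negative
        exponents.\<close>
      have cnj_pow: "ergodic_defect T (\<lambda>z. cnj z ^ k) = (\<lambda>N. circle_sq (\<lambda>x. (\<Sum>n=1..N. T n x ^ k) / of_nat N))"
        if "k \<ge> 1"
      proof
        fix N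
        have eq: "norm ((\<Sum>n=1..N. cnj (T n x) ^ k) / of_nat N) = norm ((\<Sum>n=1..N. T n x ^ k) / of_nat N)" for x
        proof -
          have "norm ((\<Sum>n=1..N. cnj (T n x) ^ k) / of_nat N) = norm (cnj ((\<Sum>n=1..N. T n x ^ k) / of_nat N))"
            by (simp only: complex_cnj_divide cnj_sum complex_cnj_power complex_cnj_of_nat)
          thus ?thesis by (simp only: complex_mod_cnj)
        qed
        have k0: "k > 0" using that by simp
        show "ergodic_defect T (\<lambda>z. cnj z ^ k) N = circle_sq (\<lambda>x. (\<Sum>n=1..N. T n x ^ k) / of_nat N)"
          unfolding ergodic_defect_def time_average_def circle_sq_def integral_circle_power(2)[OF k0] diff_zero eq ..
      qed
      have "ergodic_defect T (\<lambda>z. cnj z ^ k) \<longlonglongrightarrow> 0"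
      proof (cases "k = 0")
        case False
        hence k: "k \<ge> 1" by simp
        show ?thesis unfolding cnj_pow[OF k] using hyp k by blast
      qed (use const in simp)
      thus "P (\<lambda>z. cnj z ^ k)"
        unfolding P_def using powL2 by (auto simp: norm_power intro!: exI[of _ 1])
    next
      fix f g assume fg: "P f" "P g"
      then obtain B B' where "\<And>x. norm x = 1 \<Longrightarrow> norm (f x) \<le> B" "\<And>x. norm x = 1 \<Longrightarrow> norm (g x) \<le> B'"
        by (auto simp: P_def)
      hence bd: "\<exists>B. \<forall>x. norm x = 1 \<longrightarrow> norm (f x + g x) \<le> B"
        by (intro exI[of _ "B + B'"]) (auto intro!: norm_triangle_le add_mono)
      have "ergodic_defect T (\<lambda>x. f x + g x) \<longlonglongrightarrow> 0"
      proof (rule tendsto_sandwich[OF _ _ tendsto_const])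
        have "(\<lambda>N. 2 * ergodic_defect T f N + 2 * ergodic_defect T g N) \<longlonglongrightarrow> 2 * 0 + 2 * 0"
          using fg unfolding P_def by (intro tendsto_intros) auto
        thus "(\<lambda>N. 2 * ergodic_defect T f N + 2 * ergodic_defect T g N) \<longlonglongrightarrow> 0" by simp
        show "\<forall>\<^sub>F N in sequentially. 0 \<le> ergodic_defect T (\<lambda>x. f x + g x) N"
          by (simp add: ergodic_defect_nonneg)
        show "\<forall>\<^sub>F N in sequentially. ergodic_defect T (\<lambda>x. f x + g x) N \<le>
            2 * ergodic_defect T f N + 2 * ergodic_defect T g N"
          using fg by (simp add: P_def ergodic_defect_add_le)
      qed
      thus "P (\<lambda>z. f z + g z)"
        using fg bd unfolding P_def by (auto intro: circle_L2_add)
    next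
      fix f c assume f: "P f"
      then obtain B where "\<And>x. norm x = 1 \<Longrightarrow> norm (f x) \<le> B"
        by (auto simp: P_def)
      hence "\<exists>B. \<forall>x. norm x = 1 \<longrightarrow> norm (c * f x) \<le> B"
        by (intro exI[of _ "norm c * B"]) (auto simp: norm_mult intro!: mult_left_mono)
      thus "P (\<lambda>z. c * f z)"
        using f unfolding P_def ergodic_defect_scale[abs_def]
        by (auto intro: circle_L2_scale tendsto_mult_right_zero)
    next
      fix f s B
      assume s: "\<And>i::nat. P (s i)" and B: "\<And>i x. norm x = 1 \<Longrightarrow> norm (s i x) \<le> B"
        and lim: "\<And>x. norm x = 1 \<Longrightarrow> (\<lambda>i. s i x) \<longlonglongrightarrow> f x"
      have s_meas: "s i \<in> borel_measurable \<mu>" for i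
        using s by (simp add: P_def square_integrable_def)
      have f_meas: "f \<in> borel_measurable \<mu>"
        by (rule borel_measurable_LIMSEQ_metric[of s]) (use s_meas lim in auto)
      have fB: "norm (f x) \<le> B" if "norm x = 1" for x
        using lim[OF that] B[OF that] by (intro Lim_norm_ubound[of sequentially]) auto
      have f: "circle_L2 f" by (rule circle_L2_bounded[OF f_meas fB])
      have "ergodic_defect T f \<longlonglongrightarrow> 0"
      proof (rule ergodic_defect_limit[OF _ _ f])
        show "(\<lambda>i. circle_sq (\<lambda>x. f x - s i x)) \<longlonglongrightarrow> 0"
        proof (rule circle_sq_dominated[where w = "\<lambda>_. (2 * B)\<^sup>2"])
          show "(norm (f x - s i x))\<^sup>2 \<le> (2 * B)\<^sup>2" if "norm x = 1" for i x
            using fB[OF that] B[OF that, of i] norm_triangle_ineq4[of "f x" "s i x"]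
            by (intro power_mono) auto
        qed (use s_meas f_meas lim in auto)
      qed (use s in \<open>auto simp: P_def\<close>)
      thus "P f" using f fB unfolding P_def by blast
    qed
    fix \<phi> assume \<phi>: "circle_L2 \<phi>"
    hence "\<phi> \<in> borel_measurable \<mu>" by (simp add: square_integrable_def)
    then obtain s where s: "\<And>i. simple_function \<mu> (s i)"
      "\<And>x. x \<in> space \<mu> \<Longrightarrow> (\<lambda>i. s i x) \<longlonglongrightarrow> \<phi> x"
      "\<And>i x. x \<in> space \<mu> \<Longrightarrow> dist (s i x) 0 \<le> 2 * dist (\<phi> x) 0"
      using borel_measurable_implies_sequence_metric[of \<phi> \<mu> 0] by blast
    have Ps: "P (s i)" for i by (rule simple_function[OF s(1)])
    show "ergodic_defect T \<phi> \<longlonglongrightarrow> 0"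
    proof (rule ergodic_defect_limit[OF _ _ \<phi>])
      show "(\<lambda>i. circle_sq (\<lambda>x. \<phi> x - s i x)) \<longlonglongrightarrow> 0"
      \<comment> \<open>The approximants satisfy |s i x| \<le> 2 |\<phi> x|, so the difference is at
        most 3 |\<phi> x|.\<close>
      proof (rule circle_sq_dominated[where w = "\<lambda>x. 9 * (norm (\<phi> x))\<^sup>2"])
        show "(norm (\<phi> x - s i x))\<^sup>2 \<le> 9 * (norm (\<phi> x))\<^sup>2" if "norm x = 1" for i x
        proof -
          have "norm (\<phi> x - s i x) \<le> 3 * norm (\<phi> x)"
            using s(3)[of x i] that norm_triangle_ineq4[of "\<phi> x" "s i x"] by simp
          hence "(norm (\<phi> x - s i x))\<^sup>2 \<le> (3 * norm (\<phi> x))\<^sup>2" by (intro power_mono) auto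
          thus ?thesis by (simp add: power_mult_distrib)
        qed
      qed (use \<phi> Ps s(2) in \<open>auto simp: P_def square_integrable_def\<close>)
    qed (use Ps in \<open>auto simp: P_def\<close>)
  qed
qed

end

section \<open>Real derivatives\<close>

text \<open>Expanding the square reduces the norm of a time average to the correlations of pairs,
  which are the quantities computed from the derivatives.\<close>

lemma circle_sq_average:
  fixes u :: "nat \<Rightarrow> complex \<Rightarrow> complex"
  assumes u: "\<And>n. n \<ge> 1 \<Longrightarrow> u n \<in> borel_measurable \<mu>"
    and bd: "\<And>n x. n \<ge> 1 \<Longrightarrow> norm x = 1 \<Longrightarrow> norm (u n x) \<le> 1"
  shows "complex_of_real (circle_sq (\<lambda>x. (\<Sum>n=1..N. u n x) / of_nat N)) =
    (\<Sum>n=1..N. \<Sum>m=1..N. \<integral>x. u n x * cnj (u m x) \<partial>\<mu>) / (of_nat N)\<^sup>2"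
proof -
  have int: "integrable \<mu> (\<lambda>x. u n x * cnj (u m x))" if "n \<in> {1..N}" "m \<in> {1..N}" for n m
  proof (rule integrable_circle_bounded[where B = "1 * 1"])
    show "(\<lambda>x. u n x * cnj (u m x)) \<in> borel_measurable \<mu>"
      using u[of n] u[of m] that by (auto intro!: borel_measurable_times borel_measurable_continuous_on[of cnj] continuous_intros)
    show "norm (u n x * cnj (u m x)) \<le> 1 * 1" if "norm x = 1" for x
      unfolding norm_mult complex_mod_cnj using bd \<open>n \<in> _\<close> \<open>m \<in> _\<close> that by (intro mult_mono) auto
  qed
  have pw: "complex_of_real ((norm ((\<Sum>n=1..N. u n x) / of_nat N))\<^sup>2) =
      (\<Sum>n=1..N. \<Sum>m=1..N. u n x * cnj (u m x)) / (of_nat N)\<^sup>2" for x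
    unfolding complex_norm_square by (simp add: sum_product power2_eq_square)
  have "complex_of_real (circle_sq (\<lambda>x. (\<Sum>n=1..N. u n x) / of_nat N)) =
      (\<integral>x. (\<Sum>n=1..N. \<Sum>m=1..N. u n x * cnj (u m x)) / (of_nat N)\<^sup>2 \<partial>\<mu>)"
    unfolding circle_sq_def integral_complex_of_real[symmetric] pw ..
  also have "\<dots> = (\<integral>x. (\<Sum>n=1..N. \<Sum>m=1..N. u n x * cnj (u m x)) \<partial>\<mu>) / (of_nat N)\<^sup>2"
    by (rule integral_divide_zero)
  also have "(\<integral>x. (\<Sum>n=1..N. \<Sum>m=1..N. u n x * cnj (u m x)) \<partial>\<mu>) =
      (\<Sum>n=1..N. \<integral>x. (\<Sum>m=1..N. u n x * cnj (u m x)) \<partial>\<mu>)"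
    by (rule Bochner_Integration.integral_sum, rule Bochner_Integration.integrable_sum, rule int)
  also have "\<dots> = (\<Sum>n=1..N. \<Sum>m=1..N. \<integral>x. u n x * cnj (u m x) \<partial>\<mu>)"
    by (rule sum.cong, rule refl, rule Bochner_Integration.integral_sum, rule int)
  finally show ?thesis .
qed

lemma norm_deriv_inner_le:
  assumes "inner_function g" "g 0 = 0"
  shows "norm (deriv g 0) \<le> 1"
proof -
  obtain h where "h holomorphic_on ball 0 1" "\<And>z. norm z < 1 \<Longrightarrow> g z = z * h z"
    "h 0 = deriv g 0" "\<And>z. norm z < 1 \<Longrightarrow> norm (h z) \<le> 1"
    using inner_function_factor[OF assms] by metis
  from this(3) this(4)[of 0] show ?thesis by simp
qed

section \<open>Double Cesaro means of products of numbers in (0, 1]\<close>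

definition span_prod :: "(nat \<Rightarrow> 'a::comm_monoid_mult) \<Rightarrow> nat \<Rightarrow> nat \<Rightarrow> 'a" where
  "span_prod a m n = (\<Prod>j=Suc (min m n)..max m n. a j)"

text \<open>With a the sequence of derivatives, \<open>span_prod a m n\<close> is the correlation of
  the m-th and n-th iterates, whichever comes first, and 1 on the diagonal. So this is the squared
  norm of the time average of the boundary maps along the index sequence r.\<close>

definition mean_span :: "(nat \<Rightarrow> real) \<Rightarrow> (nat \<Rightarrow> nat) \<Rightarrow> nat \<Rightarrow> real" where
  "mean_span a r N = (\<Sum>n=1..N. \<Sum>m=1..N. span_prod a (r m) (r n)) / (real N)\<^sup>2"

lemma span_prod_commute: "span_prod a m n = span_prod a n m"
  by (simp add: span_prod_def min.commute max.commute)

lemma span_prod_le: "m \<le> n \<Longrightarrow> span_prod a m n = (\<Prod>j=Suc m..n. a j)"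
  by (simp add: span_prod_def min_def max_def)

context
  fixes a :: "nat \<Rightarrow> real"
  assumes a: "\<And>j. j \<ge> 1 \<Longrightarrow> 0 < a j" "\<And>j. j \<ge> 1 \<Longrightarrow> a j \<le> 1"
begin

lemma span_prod_bounds: "0 \<le> span_prod a m n" "span_prod a m n \<le> 1"
  unfolding span_prod_def using a
  by (auto intro!: prod_nonneg prod_le_1 simp: less_imp_le)

text \<open>Omitting factors at most 1 can only enlarge a product. One block product thus bounds all
  pairs of indices inside the block from below.\<close>

lemma span_prod_ge:
  assumes "L \<ge> 1" "m \<in> {L..U}" "n \<in> {L..U}"
  shows "(\<Prod>j=L..U. a j) \<le> span_prod a m n"
proof -
  let ?S = "{Suc (min m n)..max m n}"
  have S: "?S \<subseteq> {L..U}" using assms by auto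
  have "(\<Prod>j=L..U. a j) = (\<Prod>j\<in>{L..U} - ?S. a j) * (\<Prod>j\<in>?S. a j)"
    using S by (intro prod.subset_diff) auto
  also have "\<dots> \<le> 1 * (\<Prod>j\<in>?S. a j)"
    using assms a by (intro mult_right_mono prod_le_1 prod_nonneg) (auto simp: less_imp_le)
  finally show ?thesis by (simp add: span_prod_def)
qed

lemma span_prod_le_prod:
  assumes "m < L" "L \<ge> 1" "L \<le> n"
  shows "span_prod a m n \<le> (\<Prod>j=L..n. a j)"
proof -
  have S: "{L..n} \<subseteq> {Suc m..n}" using assms by auto
  have "(\<Prod>j=Suc m..n. a j) = (\<Prod>j\<in>{Suc m..n} - {L..n}. a j) * (\<Prod>j=L..n. a j)"
    using S by (intro prod.subset_diff) auto
  also have "\<dots> \<le> 1 * (\<Prod>j=L..n. a j)"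
    using assms a by (intro mult_right_mono prod_le_1 prod_nonneg) (auto simp: less_imp_le)
  finally show ?thesis using assms by (simp add: span_prod_le)
qed

lemma mean_span_nonneg: "mean_span a r N \<ge> 0"
  unfolding mean_span_def using span_prod_bounds
  by (intro divide_nonneg_nonneg sum_nonneg) auto

text \<open>By symmetry the square {1..N} x {1..N} is covered by two triangles, counting the
  nonnegative diagonal twice; hence rows up to the diagonal suffice, with a factor 2.\<close>

lemma mean_span_row_bound:
  assumes row: "\<And>n. n \<in> {1..N} \<Longrightarrow> (\<Sum>m=1..n. span_prod a (r m) (r n)) \<le> K" and N: "N \<ge> 1"
  shows "mean_span a r N \<le> 2 * K / real N"
proof -
  let ?c = "\<lambda>n m. span_prod a (r m) (r n)"
  have split: "(\<Sum>m=1..N. ?c n m) \<le> (\<Sum>m=1..n. ?c n m) + (\<Sum>m=n..N. ?c n m)" if "n \<in> {1..N}" for n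
  proof -
    have "(\<Sum>m=1..N. ?c n m) = (\<Sum>m\<in>{1..n} \<union> {Suc n..N}. ?c n m)"
      using that by (intro sum.cong) auto
    also have "\<dots> = (\<Sum>m=1..n. ?c n m) + (\<Sum>m=Suc n..N. ?c n m)"
      by (intro sum.union_disjoint) auto
    also have "(\<Sum>m=Suc n..N. ?c n m) \<le> (\<Sum>m=n..N. ?c n m)"
      using span_prod_bounds by (intro sum_mono2) auto
    finally show ?thesis by simp
  qed
  have swap: "(\<Sum>n=1..N. \<Sum>m=n..N. ?c n m) = (\<Sum>m=1..N. \<Sum>n=1..m. ?c m n)"
  proof -
    have "(\<Sum>n=1..N. \<Sum>m=n..N. ?c n m) = (\<Sum>n=1..N. \<Sum>m\<in>{m \<in> {1..N}. n \<le> m}. ?c n m)"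
      by (intro sum.cong) auto
    also have "\<dots> = (\<Sum>m=1..N. \<Sum>n\<in>{n \<in> {1..N}. n \<le> m}. ?c n m)"
      by (intro sum.swap_restrict) auto
    also have "\<dots> = (\<Sum>m=1..N. \<Sum>n=1..m. ?c m n)"
      by (intro sum.cong) (auto simp: span_prod_commute)
    finally show ?thesis .
  qed
  have "(\<Sum>n=1..N. \<Sum>m=1..N. ?c n m) \<le> (\<Sum>n=1..N. (\<Sum>m=1..n. ?c n m) + (\<Sum>m=n..N. ?c n m))"
    by (intro sum_mono split)
  also have "\<dots> = 2 * (\<Sum>n=1..N. \<Sum>m=1..n. ?c n m)"
    unfolding sum.distrib swap by simp
  also have "\<dots> \<le> 2 * (\<Sum>n=1..N. K)"
    using row by (intro mult_left_mono sum_mono) auto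
  also have "\<dots> = 2 * (real N * K)" by simp
  finally show ?thesis
    using N by (simp add: mean_span_def power2_eq_square field_simps)
qed

text \<open>The pairs inside {L..N} contribute at least e each and all other terms are
  nonnegative.\<close>

lemma mean_span_block_bound:
  assumes "L \<ge> 1" and block: "\<And>m n. m \<in> {L..N} \<Longrightarrow> n \<in> {L..N} \<Longrightarrow> e \<le> span_prod a (r m) (r n)"
  shows "(real (N + 1 - L) / real N)\<^sup>2 * e \<le> mean_span a r N"
proof -
  have "(real (N + 1 - L))\<^sup>2 * e = (\<Sum>n=L..N. \<Sum>m=L..N. e)"
    by (simp only: sum_constant card_atLeastAtMost Suc_eq_plus1 power2_eq_square mult.assoc)
  also have "\<dots> \<le> (\<Sum>n=L..N. \<Sum>m=L..N. span_prod a (r m) (r n))"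
    using block by (intro sum_mono) auto
  also have "\<dots> \<le> (\<Sum>n=L..N. \<Sum>m=1..N. span_prod a (r m) (r n))"
    using assms(1) span_prod_bounds by (intro sum_mono sum_mono2) auto
  also have "\<dots> \<le> (\<Sum>n=1..N. \<Sum>m=1..N. span_prod a (r m) (r n))"
    using assms(1) span_prod_bounds by (intro sum_mono2 sum_nonneg) auto
  finally show ?thesis
    by (simp add: mean_span_def power_divide divide_right_mono)
qed

text \<open>Each row sum is split at the level \<open>e\<close>; the exceptional terms are at most \<open>1\<close>.\<close>

lemma mean_span_tendsto_0:
  assumes "\<And>e::real. 0 < e \<Longrightarrow> e < 1 \<Longrightarrow> \<exists>C::real. \<forall>N\<ge>1. \<forall>n\<in>{1..N}.
    real (card {m \<in> {1..n}. \<not> span_prod a (r m) (r n) \<le> e}) \<le> e * real N + C"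
  shows "mean_span a r \<longlonglongrightarrow> 0"
proof (rule LIMSEQ_I)
  fix e' :: real assume e': "e' > 0"
  \<comment> \<open>The row bound leads to 4 * e + 2 * C / N; each summand is to be at most half of
    e'. The cap 1/2 provides e < 1.\<close>
  define e where "e = min (1/2) (e' / 8)"
  have e: "0 < e" "e < 1" "e \<le> e' / 8" using e' by (auto simp: e_def)
  obtain C :: real where C: "\<And>N n. N \<ge> 1 \<Longrightarrow> n \<in> {1..N} \<Longrightarrow>
    real (card {m \<in> {1..n}. \<not> span_prod a (r m) (r n) \<le> e}) \<le> e * real N + C"
    using assms[OF e(1,2)] by blast
  have row: "(\<Sum>m=1..n. span_prod a (r m) (r n)) \<le> 2 * e * real N + C" if N: "N \<ge> 1" "n \<in> {1..N}" for N n
  proof -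
    let ?B = "{m \<in> {1..n}. \<not> span_prod a (r m) (r n) \<le> e}"
    have "(\<Sum>m=1..n. span_prod a (r m) (r n)) \<le> (\<Sum>m=1..n. e + (if m \<in> ?B then 1 else 0))"
      using span_prod_bounds e by (intro sum_mono) (auto intro: add_increasing)
    also have "\<dots> = real n * e + real (card ?B)"
      by (simp add: sum.distrib sum.If_cases Int_def)
    also have "\<dots> \<le> real N * e + (e * real N + C)"
      using C[OF N] N e by (intro add_mono mult_right_mono) auto
    finally show ?thesis by (simp add: mult_ac)
  qed
  obtain N0 :: nat where N0: "real N0 > 4 * \<bar>C\<bar> / e'" using reals_Archimedean2 by blast
  have "norm (mean_span a r N - 0) < e'" if N: "N \<ge> max 1 N0" for N
  proof -
    have "mean_span a r N \<le> 2 * (2 * e * real N + C) / real N"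
      using N by (intro mean_span_row_bound row) auto
    also have "\<dots> = 4 * e + 2 * C / real N" using N by (simp add: field_simps)
    also have "\<dots> < e'"
    proof -
      have "real N > 4 * \<bar>C\<bar> / e'" using N0 N by linarith
      hence "2 * C / real N < e' / 2" using N e' by (simp add: field_simps)
      thus ?thesis using e by linarith
    qed
    finally show ?thesis using mean_span_nonneg[of r N] by simp
  qed
  thus "\<exists>N0. \<forall>N\<ge>N0. norm (mean_span a r N - 0) < e'" by blast
qed

text \<open>Forwards, the last block holds at least a fraction \<epsilon> of the indices, so the
  mean is at least \<epsilon> squared times the block product. Backwards, with e both as threshold
  and as \<epsilon>, a block product below e makes \<open>span_prod a m n\<close> at most e for all
  m before the block, so only about e * n indices are exceptional.\<close>

lemma mean_span_id_iff:
  "mean_span a (\<lambda>n. n) \<longlonglongrightarrow> 0 \<longleftrightarrow> (\<forall>\<epsilon>::real. 0 < \<epsilon> \<and> \<epsilon> < 1 \<longrightarrow>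
      (\<lambda>N. \<Prod>k = nat \<lfloor>real N * (1 - \<epsilon>)\<rfloor>..N. a k) \<longlonglongrightarrow> 0)"
proof (intro iffI allI impI; (elim conjE)?)
  fix \<epsilon> :: real
  assume lim: "mean_span a (\<lambda>n. n) \<longlonglongrightarrow> 0" and \<epsilon>: "0 < \<epsilon>" "\<epsilon> < 1"
  let ?L = "\<lambda>N. nat \<lfloor>real N * (1 - \<epsilon>)\<rfloor>"
  \<comment> \<open>From N0 on the block starts at 1 or later; the value of a at 0 is not
    controlled.\<close>
  obtain N0 :: nat where N0: "real N0 > 1 / (1 - \<epsilon>)" using reals_Archimedean2 by blast
  have bounds: "0 \<le> (\<Prod>k=?L N..N. a k) \<and> (\<Prod>k=?L N..N. a k) \<le> mean_span a (\<lambda>n. n) N / \<epsilon>\<^sup>2" if N: "N \<ge> max 1 N0" for N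
  proof -
    have "real N > 1 / (1 - \<epsilon>)" using N N0 by linarith
    hence ge1: "real N * (1 - \<epsilon>) > 1" using \<epsilon> by (simp add: field_simps)
    hence L: "?L N \<ge> 1" by linarith
    have "real N * (1 - \<epsilon>) \<le> real N * 1" using \<epsilon> by (intro mult_left_mono) auto
    hence LN: "?L N \<le> N" by linarith
    have P: "0 \<le> (\<Prod>k=?L N..N. a k)" using a L by (intro prod_nonneg) (auto simp: less_imp_le)
    have "real (?L N) \<le> real N * (1 - \<epsilon>)" using ge1 by simp
    hence "\<epsilon> * real N \<le> real (N + 1 - ?L N)" using LN by (simp add: algebra_simps of_nat_diff)
    hence "\<epsilon> \<le> real (N + 1 - ?L N) / real N" using N by (simp add: pos_le_divide_eq)
    moreover have "0 \<le> \<epsilon>" using \<epsilon> by simp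
    ultimately have "\<epsilon>\<^sup>2 * (\<Prod>k=?L N..N. a k) \<le> (real (N + 1 - ?L N) / real N)\<^sup>2 * (\<Prod>k=?L N..N. a k)"
      using P by (intro mult_right_mono power_mono)
    also have "\<dots> \<le> mean_span a (\<lambda>n. n) N"
      by (rule mean_span_block_bound[OF L]) (rule span_prod_ge[OF L])
    finally show ?thesis using P \<epsilon> by (simp add: field_simps)
  qed
  have ev: "\<forall>\<^sub>F N in sequentially. 0 \<le> (\<Prod>k=?L N..N. a k)"
    "\<forall>\<^sub>F N in sequentially. (\<Prod>k=?L N..N. a k) \<le> mean_span a (\<lambda>n. n) N / \<epsilon>\<^sup>2"
    using bounds unfolding eventually_sequentially by blast+
  show "(\<lambda>N. \<Prod>k=?L N..N. a k) \<longlonglongrightarrow> 0"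
  proof (rule tendsto_sandwich[OF _ _ tendsto_const])
    show "(\<lambda>N. mean_span a (\<lambda>n. n) N / \<epsilon>\<^sup>2) \<longlonglongrightarrow> 0"
      using tendsto_divide[OF lim tendsto_const[of "\<epsilon>\<^sup>2"]] \<epsilon> by simp
  qed (rule ev)+
next
  assume cond: "\<forall>\<epsilon>::real. 0 < \<epsilon> \<and> \<epsilon> < 1 \<longrightarrow>
      (\<lambda>N. \<Prod>k = nat \<lfloor>real N * (1 - \<epsilon>)\<rfloor>..N. a k) \<longlonglongrightarrow> 0"
  show "mean_span a (\<lambda>n. n) \<longlonglongrightarrow> 0"
  proof (rule mean_span_tendsto_0)
    fix e :: real assume e: "0 < e" "e < 1"
    let ?L = "\<lambda>N. nat \<lfloor>real N * (1 - e)\<rfloor>"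
    have "(\<lambda>N. \<Prod>k = ?L N..N. a k) \<longlonglongrightarrow> 0" using cond e by blast
    then obtain n0 where n0: "\<And>n. n \<ge> n0 \<Longrightarrow> (\<Prod>k = ?L n..n. a k) < e"
      using order_tendstoD(2)[of "\<lambda>N. \<Prod>k = ?L N..N. a k" 0 sequentially e] e
      by (auto simp: eventually_sequentially)
    \<comment> \<open>The constant n0 pays for the rows n < n0; the 2 pays for the rounding of the
      lower end and for the closed block containing both ends.\<close>
    have "real (card {m \<in> {1..n}. \<not> span_prod a m n \<le> e}) \<le> e * real N + (real n0 + 2)"
      if N: "N \<ge> 1" "n \<in> {1..N}" for N n
    proof (cases "n < n0")
      case True
      have "card {m \<in> {1..n}. \<not> span_prod a m n \<le> e} \<le> card {1..n}"
        by (intro card_mono) auto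
      moreover have "e * real N \<ge> 0" using e by simp
      ultimately show ?thesis using True by simp
    next
      case False
      have "real n * (1 - e) \<le> real n * 1" using e by (intro mult_left_mono) auto
      hence Ln: "?L n \<le> n" by linarith
      have "{m \<in> {1..n}. \<not> span_prod a m n \<le> e} \<subseteq> {?L n..n}"
      proof
        fix m assume m: "m \<in> {m \<in> {1..n}. \<not> span_prod a m n \<le> e}"
        have "\<not> m < ?L n"
        proof
          assume "m < ?L n"
          hence "span_prod a m n \<le> (\<Prod>k=?L n..n. a k)"
            using m Ln by (intro span_prod_le_prod) auto
          thus False using n0[of n] False m by auto
        qed
        thus "m \<in> {?L n..n}" using m by auto
      qed
      hence "card {m \<in> {1..n}. \<not> span_prod a m n \<le> e} \<le> n + 1 - ?L n"
        using card_mono[of "{?L n..n}"] by fastforce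
      hence "real (card {m \<in> {1..n}. \<not> span_prod a m n \<le> e}) \<le> real n + 1 - real (?L n)"
        using Ln by linarith
      also have "\<dots> \<le> real n + 1 - (real n * (1 - e) - 1)" by linarith
      also have "\<dots> = e * real n + 2" by (simp add: algebra_simps)
      also have "\<dots> \<le> e * real N + (real n0 + 2)"
        using N e by (intro add_mono mult_left_mono) auto
      finally show ?thesis .
    qed
    thus "\<exists>C::real. \<forall>N\<ge>1. \<forall>n\<in>{1..N}. real (card {m \<in> {1..n}. \<not> span_prod a m n \<le> e}) \<le> e * real N + C"
      by blast
  qed
qed

lemma strict_mono_diff_le:
  fixes r :: "nat \<Rightarrow> nat"
  assumes "strict_mono r" "m \<le> n"
  shows "n - m \<le> r n - r m"
  using assms(2)
proof (induction n rule: dec_induct)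
  case (step n)
  have "r n < r (Suc n)" "r m \<le> r n"
    using assms(1) step by (auto simp: strict_mono_def strict_mono_leD[OF assms(1)])
  thus ?case using step by linarith
qed simp

text \<open>If long products are small, then along any subsequence only the M0 + 2 most recent
  indices can be exceptional, because gaps of the subsequence lengthen products. If not, there are
  arbitrarily long blocks with product at least e, and a subsequence is steered so that one block
  always occupies the later half of the elapsed time.\<close>

lemma mean_span_all_iff:
  "(\<forall>r::nat \<Rightarrow> nat. strict_mono r \<longrightarrow> mean_span a r \<longlonglongrightarrow> 0) \<longleftrightarrow>
   (\<forall>\<epsilon>::real. \<epsilon> > 0 \<longrightarrow> (\<exists>M0::nat. \<forall>M N. N > M \<and> M > M0 \<longrightarrow> (\<Prod>k = N - M..N. a k) < \<epsilon>))"
proof (intro iffI allI impI)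
  fix r :: "nat \<Rightarrow> nat"
  assume cond: "\<forall>\<epsilon>::real. \<epsilon> > 0 \<longrightarrow> (\<exists>M0::nat. \<forall>M N. N > M \<and> M > M0 \<longrightarrow> (\<Prod>k = N - M..N. a k) < \<epsilon>)"
    and r: "strict_mono r"
  show "mean_span a r \<longlonglongrightarrow> 0"
  proof (rule mean_span_tendsto_0)
    fix e :: real assume e: "0 < e" "e < 1"
    obtain M0 where M0: "\<And>M N. N > M \<Longrightarrow> M > M0 \<Longrightarrow> (\<Prod>k = N - M..N. a k) < e"
      using cond e by blast
    have "real (card {m \<in> {1..n}. \<not> span_prod a (r m) (r n) \<le> e}) \<le> e * real N + (real M0 + 2)"
      if N: "N \<ge> 1" "n \<in> {1..N}" for N n
    proof -
      have "{m \<in> {1..n}. \<not> span_prod a (r m) (r n) \<le> e} \<subseteq> {n - (M0 + 1)..n}"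
      proof
        fix m assume m: "m \<in> {m \<in> {1..n}. \<not> span_prod a (r m) (r n) \<le> e}"
        have "\<not> m < n - (M0 + 1)"
        proof
          assume lt: "m < n - (M0 + 1)"
          have d: "n - m \<le> r n - r m" using m by (intro strict_mono_diff_le r) auto
          \<comment> \<open>Chosen so that {r n - M..r n} is exactly the range {Suc (r m)..r n} of
            the correlation product.\<close>
          define M where "M = r n - Suc (r m)"
          have M: "M > M0" "r n > M" "r n - M = Suc (r m)" "r m \<le> r n"
            using d lt by (auto simp: M_def)
          have "(\<Prod>k = r n - M..r n. a k) < e" using M0[OF M(2,1)] .
          thus False using m M by (simp add: span_prod_le)
        qed
        thus "m \<in> {n - (M0 + 1)..n}" using m by auto
      qed
      hence "card {m \<in> {1..n}. \<not> span_prod a (r m) (r n) \<le> e} \<le> card {n - (M0 + 1)..n}"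
        by (intro card_mono) auto
      also have "\<dots> \<le> M0 + 2" by simp
      finally have "real (card {m \<in> {1..n}. \<not> span_prod a (r m) (r n) \<le> e}) \<le> real M0 + 2" by linarith
      moreover have "e * real N \<ge> 0" using e by simp
      ultimately show ?thesis by linarith
    qed
    thus "\<exists>C::real. \<forall>N\<ge>1. \<forall>n\<in>{1..N}. real (card {m \<in> {1..n}. \<not> span_prod a (r m) (r n) \<le> e}) \<le> e * real N + C"
      by blast
  qed
next
  fix e :: real
  assume all: "\<forall>r::nat \<Rightarrow> nat. strict_mono r \<longrightarrow> mean_span a r \<longlonglongrightarrow> 0" and e: "e > 0"
  show "\<exists>M0::nat. \<forall>M N. N > M \<and> M > M0 \<longrightarrow> (\<Prod>k = N - M..N. a k) < e"
  proof (rule ccontr)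
    assume "\<not> ?thesis"
    hence "\<forall>M0. \<exists>M N. N > M \<and> M > M0 \<and> e \<le> (\<Prod>k = N - M..N. a k)"
      by (simp add: not_less)
    then obtain MM NN where MN: "\<And>x. NN x > (MM x :: nat)" "\<And>x. MM x > x"
      "\<And>x. e \<le> (\<Prod>k = NN x - MM x..NN x. a k)"
      by metis
    \<comment> \<open>The \<open>k\<close>-th dyadic block of indices is sent to a run of consecutive integers ending at \<open>F k\<close>.\<close>
    define F where "F = rec_nat 0 (\<lambda>k x. NN (2 ^ Suc k + x))"
    have F_Suc: "F (Suc k) = NN (2 ^ Suc k + F k)" for k by (simp add: F_def)
    \<comment> \<open>The argument 2 ^ Suc k + F k of \<open>NN\<close> does two jobs: the block is
      longer than the 2 ^ k indices to be placed in it, and those indices, ending at F (Suc k),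
      still lie beyond F k.\<close>
    have F_gt: "F (Suc k) > 2 ^ Suc k + F k" for k
      using MN(1,2)[of "2 ^ Suc k + F k"] by (simp add: F_Suc)
    have F_ge: "F k + 1 \<ge> 2 ^ k" for k
      using F_gt[of "k - 1"] by (cases k) (auto simp: F_def)
    \<comment> \<open>For 2 ^ (k - 1) \<le> n < 2 ^ k the value of \<open>floorlog\<close> is k, and
      the last such index n = 2 ^ k - 1 is sent to F k.\<close>
    define r where "r n = F (floorlog 2 n) + n + 1 - 2 ^ floorlog 2 n" for n
    have fl: "floorlog 2 n = k" if "2 ^ (k - 1) \<le> n" "n < 2 ^ k" "k \<ge> 1" for n k :: nat
      using that by (intro antisym floorlog_leI floorlog_geI) auto
    have flb: "2 ^ (floorlog 2 n - 1) \<le> n" "n < 2 ^ floorlog 2 n" "floorlog 2 n \<ge> 1" if "n \<ge> 1" for n :: nat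
      using floorlog_bounds[where b = 2 and x = n] that by (auto simp: floorlog_def)
    have "r n < r (Suc n)" for n
    proof (cases "n = 0")
      case True
      have "floorlog 2 (Suc 0) = 1" by (intro fl) auto
      moreover have "floorlog 2 0 = 0" by (simp add: floorlog_def)
      ultimately show ?thesis using True F_gt[of 0] by (simp add: r_def F_def)
    next
      case False
      define k where "k = floorlog 2 n"
      have k: "2 ^ (k - 1) \<le> n" "n < 2 ^ k" "k \<ge> 1" using flb[of n] False by (auto simp: k_def)
      show ?thesis
      proof (cases "Suc n < 2 ^ k")
        case True
        hence "floorlog 2 (Suc n) = k" using k by (intro fl) auto
        thus ?thesis using F_ge[of k] by (simp add: r_def k_def)
      next
        case False
        hence n: "Suc n = 2 ^ k" using k by linarith
        hence "floorlog 2 (Suc n) = Suc k" by (intro fl) auto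
        thus ?thesis using F_gt[of k] F_ge[of k] n by (simp add: r_def flip: k_def)
      qed
    qed
    hence r: "strict_mono r" by (simp add: strict_mono_Suc_iff)
    hence lim: "mean_span a r \<longlonglongrightarrow> 0" using all by blast
    \<comment> \<open>At time 2 ^ Suc k - 1 the indices from 2 ^ k on are at least half of all and
      are sent into one block with product at least e; squaring the fraction 1 / 2 gives e /
      4.\<close>
    have low: "e / 4 \<le> mean_span a r (2 ^ Suc k - 1)" for k
    proof -
      let ?x = "2 ^ Suc k + F k"
      define N :: nat where "N = 2 ^ Suc k - 1"
      have N: "N + 1 = 2 ^ Suc k" by (simp add: N_def)
      have blk: "e \<le> span_prod a (r m) (r n)" if mn: "m \<in> {2 ^ k..N}" "n \<in> {2 ^ k..N}" for m n
      proof -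
        have rr: "r i \<in> {NN ?x - MM ?x..NN ?x}" if i: "i \<in> {2 ^ k..N}" for i
        proof -
          have "floorlog 2 i = Suc k" using i N by (intro fl) auto
          hence "r i = NN ?x + i + 1 - 2 ^ Suc k" by (simp add: r_def F_Suc)
          thus ?thesis using i N MN(1,2)[of ?x] by auto
        qed
        have "(\<Prod>k = NN ?x - MM ?x..NN ?x. a k) \<le> span_prod a (r m) (r n)"
          using MN(1)[of ?x] by (intro span_prod_ge rr mn) auto
        thus ?thesis using MN(3)[of ?x] by linarith
      qed
      have "(real (N + 1 - 2 ^ k) / real N)\<^sup>2 * e \<le> mean_span a r N"
        by (rule mean_span_block_bound) (use blk in auto)
      moreover have "(1 / 2)\<^sup>2 * e \<le> (real (N + 1 - 2 ^ k) / real N)\<^sup>2 * e"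
      proof (intro mult_right_mono power_mono)
        have "N > 0" using N by (cases N) auto
        moreover have "real N \<le> 2 * 2 ^ k" using arg_cong[OF N, of real] by simp
        moreover have "N + 1 - 2 ^ k = 2 ^ k" using N by simp
        ultimately show "1 / 2 \<le> real (N + 1 - 2 ^ k) / real N" by (simp add: field_simps)
      qed (use e in auto)
      ultimately have "(1 / 2)\<^sup>2 * e \<le> mean_span a r N" by (rule order.trans[rotated])
      thus ?thesis unfolding N_def by (simp add: power2_eq_square)
    qed
    have "filterlim (\<lambda>k. 2 ^ Suc k - 1 :: nat) at_top sequentially"
    proof (rule filterlim_at_top_mono[OF filterlim_ident], intro always_eventually allI)
      fix k :: nat
      have "Suc k < 2 ^ Suc k" by (rule less_exp)
      thus "k \<le> 2 ^ Suc k - 1" by linarith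
    qed
    hence "(\<lambda>k. mean_span a r (2 ^ Suc k - 1)) \<longlonglongrightarrow> 0"
      using lim by (rule filterlim_compose[rotated])
    hence "eventually (\<lambda>k. mean_span a r (2 ^ Suc k - 1) < e / 4) sequentially"
      using e by (intro order_tendstoD(2)) auto
    thus False using low by (auto simp: eventually_sequentially not_less[symmetric])
  qed
qed

end

text \<open>The k-th correlations are k-th powers of numbers in [0, 1], so they are dominated by
  those for k = 1. Pairs in the wrong order are reduced to the ordered case by conjugation, which
  fixes real products.\<close>

lemma ergodic_boundary_iff_mean_span:
  assumes inner: "\<And>n. n \<ge> 1 \<Longrightarrow> inner_function (g n)" and zero: "\<And>n. n \<ge> 1 \<Longrightarrow> g n 0 = 0"
    and real: "\<And>n. n \<ge> 1 \<Longrightarrow> deriv (g n) 0 \<in> \<real>" and pos: "\<And>n. n \<ge> 1 \<Longrightarrow> Re (deriv (g n) 0) > 0"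
    and r: "mono r"
  shows "ergodic_seq \<mu> (\<lambda>n. boundary_map (comp_seq g (r n))) \<longleftrightarrow>
    mean_span (\<lambda>j. Re (deriv (g j) 0)) r \<longlonglongrightarrow> 0"
proof -
  define a where "a j = Re (deriv (g j) 0)" for j
  have da: "deriv (g j) 0 = of_real (a j)" if "j \<ge> 1" for j
    using real[OF that] by (simp add: a_def of_real_Re)
  have a: "0 < a j" "a j \<le> 1" if "j \<ge> 1" for j
    using pos[OF that] norm_deriv_inner_le[OF inner zero, of j] abs_Re_le_cmod[of "deriv (g j) 0"] that
    by (auto simp: a_def)
  let ?T = "\<lambda>n. boundary_map (comp_seq g (r n))"
  note G = inner_comp_seq[where g = g, OF inner zero]
  have T: "circle_preserving (?T n)" for n
    by (rule circle_preserving_boundary_map[OF G])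
  have prod_real: "(\<Prod>j=m+1..n. deriv (g j) 0) = of_real (span_prod a m n)" if "m \<le> n" for m n
    using that by (simp add: span_prod_le da)
  have corr: "(\<integral>x. ?T n x ^ k * cnj (?T m x ^ k) \<partial>\<mu>) = of_real (span_prod a (r m) (r n) ^ k)" for m n k
  proof (cases "m \<le> n")
    case True
    hence "r m \<le> r n" using r by (simp add: monoD)
    thus ?thesis using comp_seq_correlation[where g = g and m = "r m" and n = "r n" and k = k, OF inner zero] prod_real[of "r m" "r n"] by simp
  next
    case False
    hence le: "r n \<le> r m" using r by (simp add: monoD)
    have "(\<integral>x. ?T n x ^ k * cnj (?T m x ^ k) \<partial>\<mu>) =
        (\<integral>x. cnj (?T m x ^ k * cnj (?T n x) ^ k) \<partial>\<mu>)"
      by (simp add: mult.commute)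
    also have "\<dots> = cnj (of_real (span_prod a (r n) (r m)) ^ k)"
      using comp_seq_correlation[where g = g and k = k, OF inner zero le] prod_real[OF le]
      by (subst Bochner_Integration.integral_cnj) simp
    finally show ?thesis by (simp add: span_prod_commute)
  qed
  have sq: "circle_sq (\<lambda>x. (\<Sum>n=1..N. ?T n x ^ k) / of_nat N) =
      (\<Sum>n=1..N. \<Sum>m=1..N. span_prod a (r m) (r n) ^ k) / (real N)\<^sup>2" for k N
  proof -
    have m: "(\<lambda>x. ?T n x ^ k) \<in> borel_measurable \<mu>" for n
      using borel_measurable_boundary_map[OF G(1)] by measurable
    have "complex_of_real (circle_sq (\<lambda>x. (\<Sum>n=1..N. ?T n x ^ k) / of_nat N)) =
        (\<Sum>n=1..N. \<Sum>m=1..N. of_real (span_prod a (r m) (r n) ^ k)) / (of_nat N)\<^sup>2"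
      using circle_sq_average[of "\<lambda>n x. ?T n x ^ k" N, OF m] unfolding corr by (simp add: norm_power)
    also have "\<dots> = of_real ((\<Sum>n=1..N. \<Sum>m=1..N. span_prod a (r m) (r n) ^ k) / (real N)\<^sup>2)"
      by simp
    finally show ?thesis by (simp only: of_real_eq_iff)
  qed
  have "(\<forall>k\<ge>1. (\<lambda>N. circle_sq (\<lambda>x. (\<Sum>n=1..N. ?T n x ^ k) / of_nat N)) \<longlonglongrightarrow> 0) \<longleftrightarrow>
      mean_span a r \<longlonglongrightarrow> 0"
  proof (intro iffI allI impI)
    assume "\<forall>k\<ge>1. (\<lambda>N. circle_sq (\<lambda>x. (\<Sum>n=1..N. ?T n x ^ k) / of_nat N)) \<longlonglongrightarrow> 0"
    hence "(\<lambda>N. circle_sq (\<lambda>x. (\<Sum>n=1..N. ?T n x ^ 1) / of_nat N)) \<longlonglongrightarrow> 0" by blast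
    thus "mean_span a r \<longlonglongrightarrow> 0" unfolding sq by (simp add: mean_span_def[abs_def])
  next
    fix k :: nat assume lim: "mean_span a r \<longlonglongrightarrow> 0" and k: "k \<ge> 1"
    have le: "span_prod a m n ^ k \<le> span_prod a m n" for m n
      using power_decreasing[OF k span_prod_bounds[OF a]] by simp
    show "(\<lambda>N. circle_sq (\<lambda>x. (\<Sum>n=1..N. ?T n x ^ k) / of_nat N)) \<longlonglongrightarrow> 0"
    proof (rule tendsto_sandwich[OF _ _ tendsto_const lim])
      show "\<forall>\<^sub>F N in sequentially. circle_sq (\<lambda>x. (\<Sum>n=1..N. ?T n x ^ k) / of_nat N) \<le> mean_span a r N"
        unfolding sq mean_span_def using le by (intro always_eventually allI divide_right_mono sum_mono) auto
    qed (simp add: circle_sq_nonneg)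
  qed
  thus ?thesis
    using ergodic_seq_circle_iff[of ?T] T unfolding a_def[abs_def] by simp
qed

section \<open>Weyl's criterion\<close>

definition seq_average :: "(nat \<Rightarrow> complex) \<Rightarrow> (complex \<Rightarrow> complex) \<Rightarrow> nat \<Rightarrow> complex" where
  "seq_average z \<phi> N = (\<Sum>j=1..N. \<phi> (z j)) / of_nat N"

lemma seq_average_add: "seq_average z (\<lambda>x. f x + g x) N = seq_average z f N + seq_average z g N"
  by (simp add: seq_average_def sum.distrib add_divide_distrib)

lemma seq_average_diff: "seq_average z (\<lambda>x. f x - g x) N = seq_average z f N - seq_average z g N"
  by (simp add: seq_average_def sum_subtractf diff_divide_distrib)

lemma seq_average_scale: "seq_average z (\<lambda>x. c * f x) N = c * seq_average z f N"
  by (simp add: seq_average_def sum_distrib_left)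

lemma norm_seq_average_le:
  assumes "\<And>j. norm (f (z j)) \<le> e" "e \<ge> 0"
  shows "norm (seq_average z f N) \<le> e"
proof (cases "N = 0")
  case False
  have "norm (\<Sum>j=1..N. f (z j)) \<le> real (card {1..N}) * e"
    by (rule sum_norm_bound) (rule assms(1))
  thus ?thesis using False by (simp add: seq_average_def norm_divide field_simps)
qed (use assms in \<open>simp add: seq_average_def\<close>)

text \<open>The points z n form a null set, so pointwise or almost everywhere limits give no control
  of averages along them; uniform closeness does so for all N at once.\<close>

lemma seq_average_uniform_limit:
  assumes z: "\<And>n. norm (z n) = 1"
    and s: "\<And>i::nat. s i \<in> borel_measurable \<mu>" "\<And>i x. norm x = 1 \<Longrightarrow> norm (s i x) \<le> B"
      "\<And>i. seq_average z (s i) \<longlonglongrightarrow> (\<integral>x. s i x \<partial>\<mu>)"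
    and lim: "uniform_limit (sphere 0 1) s f sequentially"
  shows "seq_average z f \<longlonglongrightarrow> (\<integral>x. f x \<partial>\<mu>)"
proof (rule LIMSEQ_I)
  fix e :: real assume e: "e > 0"
  have pw: "(\<lambda>i. s i x) \<longlonglongrightarrow> f x" if "norm x = 1" for x
    using tendsto_uniform_limitI[OF lim, of x] that by simp
  have f: "f \<in> borel_measurable \<mu>"
    by (rule borel_measurable_LIMSEQ_metric[of s]) (use s pw in auto)
  have fB: "norm (f x) \<le> B" if "norm x = 1" for x
    using pw[OF that] s(2)[OF that] by (intro Lim_norm_ubound[of sequentially]) auto
  \<comment> \<open>Three errors of at most e / 4: between the averages of f and s i, between the
    average and the integral of s i, and between the two integrals.\<close>
  have "eventually (\<lambda>i. \<forall>x\<in>sphere 0 1. dist (s i x) (f x) < e / 4) sequentially"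
    using e by (intro uniform_limitD[OF lim]) auto
  then obtain i where "\<forall>x\<in>sphere 0 1. dist (s i x) (f x) < e / 4"
    unfolding eventually_sequentially by blast
  hence i: "norm (f x - s i x) \<le> e / 4" if "norm x = 1" for x
    using that by (auto simp: dist_norm norm_minus_commute less_imp_le)
  obtain N0 where N0: "\<And>N. N \<ge> N0 \<Longrightarrow> norm (seq_average z (s i) N - (\<integral>x. s i x \<partial>\<mu>)) < e / 4"
    using LIMSEQ_D[OF s(3)[of i], of "e / 4"] e by auto
  have int: "integrable \<mu> f" "integrable \<mu> (s i)"
    by (rule integrable_circle_bounded[of _ B]; use f s fB in simp)+
  have "norm ((\<integral>x. f x \<partial>\<mu>) - (\<integral>x. s i x \<partial>\<mu>)) \<le> (\<integral>x. e / 4 \<partial>\<mu>)"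
    unfolding Bochner_Integration.integral_diff[OF int, symmetric]
    by (rule order.trans[OF integral_norm_bound integral_mono]) (use int i in auto)
  hence 1: "norm ((\<integral>x. f x \<partial>\<mu>) - (\<integral>x. s i x \<partial>\<mu>)) \<le> e / 4" by simp
  have "norm (seq_average z f N - (\<integral>x. f x \<partial>\<mu>)) < e" if "N \<ge> N0" for N
  proof -
    have 2: "norm (seq_average z f N - seq_average z (s i) N) \<le> e / 4"
      unfolding seq_average_diff[symmetric]
      by (rule norm_seq_average_le) (use i z e in auto)
    have "seq_average z f N - (\<integral>x. f x \<partial>\<mu>) =
        (seq_average z f N - seq_average z (s i) N) + (seq_average z (s i) N - (\<integral>x. s i x \<partial>\<mu>))
        - ((\<integral>x. f x \<partial>\<mu>) - (\<integral>x. s i x \<partial>\<mu>))" by simp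
    hence "norm (seq_average z f N - (\<integral>x. f x \<partial>\<mu>)) \<le>
        norm (seq_average z f N - seq_average z (s i) N) + norm (seq_average z (s i) N - (\<integral>x. s i x \<partial>\<mu>))
        + norm ((\<integral>x. f x \<partial>\<mu>) - (\<integral>x. s i x \<partial>\<mu>))"
      by (metis norm_triangle_ineq norm_triangle_ineq4 add_right_mono order.trans)
    thus ?thesis using 1 2 N0[OF that] e by linarith
  qed
  thus "\<exists>N0. \<forall>N\<ge>N0. norm (seq_average z f N - (\<integral>x. f x \<partial>\<mu>)) < e" by blast
qed

lemma seq_average_continuous:
  assumes z: "\<And>n. norm (z n) = 1" and pow: "\<And>k. k \<ge> 1 \<Longrightarrow> seq_average z (\<lambda>x. x ^ k) \<longlonglongrightarrow> 0"
    and f: "continuous_on (sphere 0 1) f"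
  shows "seq_average z f \<longlonglongrightarrow> (\<integral>x. f x \<partial>\<mu>)"
proof -
  define P where "P \<phi> \<longleftrightarrow> \<phi> \<in> borel_measurable \<mu> \<and> (\<exists>B. \<forall>x. norm x = 1 \<longrightarrow> norm (\<phi> x) \<le> B) \<and>
    seq_average z \<phi> \<longlonglongrightarrow> (\<integral>x. \<phi> x \<partial>\<mu>)" for \<phi>
  have int: "integrable \<mu> \<phi>" if \<phi>: "P \<phi>" for \<phi>
  proof -
    obtain B where "\<And>x. norm x = 1 \<Longrightarrow> norm (\<phi> x) \<le> B" using \<phi> by (auto simp: P_def)
    thus ?thesis using \<phi> by (intro integrable_circle_bounded[of _ B]) (auto simp: P_def)
  qed
  interpret circle_uniform_class P
  proof
    fix k :: nat
    have m: "(\<lambda>x. x ^ k) \<in> borel_measurable \<mu>" "(\<lambda>x. cnj x ^ k) \<in> borel_measurable \<mu>"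
      by (intro borel_measurable_circle_continuous continuous_intros)+
    have one: "seq_average z (\<lambda>_. 1) \<longlonglongrightarrow> 1"
    proof (rule tendsto_eventually)
      show "\<forall>\<^sub>F N in sequentially. seq_average z (\<lambda>_. 1) N = 1"
        using eventually_gt_at_top[of 0] by eventually_elim (simp add: seq_average_def)
    qed
    have 1: "seq_average z (\<lambda>x. x ^ k) \<longlonglongrightarrow> (\<integral>x. x ^ k \<partial>\<mu>)"
      using one pow[of k] integral_circle_power(1)[of k] by (cases "k = 0") auto
    thus "P (\<lambda>z. z ^ k)"
      unfolding P_def using m by (auto simp: norm_power intro!: exI[of _ 1])
    have "seq_average z (\<lambda>x. cnj x ^ k) = (\<lambda>N. cnj (seq_average z (\<lambda>x. x ^ k) N))"
      by (simp add: seq_average_def fun_eq_iff)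
    moreover have "(\<integral>x. cnj x ^ k \<partial>\<mu>) = cnj (\<integral>x. x ^ k \<partial>\<mu>)"
      by (subst Bochner_Integration.integral_cnj[symmetric]) simp
    ultimately have "seq_average z (\<lambda>x. cnj x ^ k) \<longlonglongrightarrow> (\<integral>x. cnj x ^ k \<partial>\<mu>)"
      using tendsto_cnj[OF 1] by simp
    thus "P (\<lambda>z. cnj z ^ k)"
      unfolding P_def using m by (auto simp: norm_power intro!: exI[of _ 1])
  next
    fix f g assume fg: "P f" "P g"
    then obtain B B' where "\<And>x. norm x = 1 \<Longrightarrow> norm (f x) \<le> B" "\<And>x. norm x = 1 \<Longrightarrow> norm (g x) \<le> B'"
      by (auto simp: P_def)
    hence bd: "\<exists>B. \<forall>x. norm x = 1 \<longrightarrow> norm (f x + g x) \<le> B"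
      by (intro exI[of _ "B + B'"]) (auto intro!: norm_triangle_le add_mono)
    have "(\<lambda>N. seq_average z f N + seq_average z g N) \<longlonglongrightarrow> (\<integral>x. f x \<partial>\<mu>) + (\<integral>x. g x \<partial>\<mu>)"
      using fg by (intro tendsto_add) (auto simp: P_def)
    thus "P (\<lambda>z. f z + g z)"
      using fg bd int[OF fg(1)] int[OF fg(2)] unfolding P_def by (simp add: seq_average_add[abs_def])
  next
    fix f c assume f: "P f"
    then obtain B where "\<And>x. norm x = 1 \<Longrightarrow> norm (f x) \<le> B"
      by (auto simp: P_def)
    hence bd: "\<exists>B. \<forall>x. norm x = 1 \<longrightarrow> norm (c * f x) \<le> B"
      by (intro exI[of _ "norm c * B"]) (auto simp: norm_mult intro!: mult_left_mono)
    have "(\<lambda>N. c * seq_average z f N) \<longlonglongrightarrow> c * (\<integral>x. f x \<partial>\<mu>)"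
      using f by (intro tendsto_mult tendsto_const) (auto simp: P_def)
    thus "P (\<lambda>z. c * f z)"
      using f bd int[OF f] unfolding P_def by (simp add: seq_average_scale[abs_def])
  next
    fix f s B
    assume s: "\<And>i::nat. P (s i)" and B: "\<And>i x. norm x = 1 \<Longrightarrow> norm (s i x) \<le> B"
      and lim: "uniform_limit (sphere 0 1) s f sequentially"
    have pw: "(\<lambda>i. s i x) \<longlonglongrightarrow> f x" if "norm x = 1" for x
      using tendsto_uniform_limitI[OF lim, of x] that by simp
    have s_meas: "s i \<in> borel_measurable \<mu>" for i
      using s by (simp add: P_def)
    have "f \<in> borel_measurable \<mu>"
      by (rule borel_measurable_LIMSEQ_metric[of s]) (use s_meas pw in auto)
    moreover have "norm (f x) \<le> B" if "norm x = 1" for x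
      using pw[OF that] B[OF that] by (intro Lim_norm_ubound[of sequentially]) auto
    moreover have "seq_average z f \<longlonglongrightarrow> (\<integral>x. f x \<partial>\<mu>)"
      by (rule seq_average_uniform_limit[OF z s_meas B _ lim]) (use s in \<open>auto simp: P_def\<close>)
    ultimately show "P f" unfolding P_def by blast
  qed
  show ?thesis using continuous[OF f] by (simp add: P_def)
qed

section \<open>Frequencies of visits to sets\<close>

definition seq_freq :: "(nat \<Rightarrow> complex) \<Rightarrow> complex set \<Rightarrow> nat \<Rightarrow> real" where
  "seq_freq z S N = real (card {j \<in> {1..N}. z j \<in> S}) / real N"

lemma equidistributed_iff: "equidistributed z \<longleftrightarrow>
    (\<forall>S. circle_arc S \<longrightarrow> seq_freq z S \<longlonglongrightarrow> measure \<mu> S)"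
  by (simp add: equidistributed_def seq_freq_def[abs_def])

lemma seq_freq_eq_sum: "seq_freq z S N = (\<Sum>j=1..N. indicator S (z j)) / real N"
proof -
  have "(\<Sum>j=1..N. indicator S (z j)) = (\<Sum>j=1..N. if z j \<in> S then 1 else (0 :: real))"
    by (intro sum.cong) (auto simp: indicator_def)
  also have "\<dots> = (\<Sum>j\<in>{j\<in>{1..N}. z j \<in> S}. 1)"
    by (rule sum.inter_filter[symmetric]) simp
  finally show ?thesis by (simp add: seq_freq_def)
qed

lemma sets_circle_closed: "closed C \<Longrightarrow> C \<subseteq> sphere 0 1 \<Longrightarrow> C \<in> sets \<mu>"
  by (auto simp: sets_circle_measure sets_restrict_space_iff)

text \<open>A continuous function above the indicator, with nearly the same integral, bounds the
  frequency. For closed sets only this upper bound is available; the lower bound for an arc comes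
  from its complement.\<close>

lemma seq_freq_closed:
  assumes z: "\<And>n. norm (z n) = 1" and pow: "\<And>k. k \<ge> 1 \<Longrightarrow> seq_average z (\<lambda>x. x ^ k) \<longlonglongrightarrow> 0"
    and C: "closed C" "C \<subseteq> sphere 0 1" and e: "e > 0"
  shows "\<forall>\<^sub>F N in sequentially. seq_freq z C N < measure \<mu> C + e"
proof (cases "C = {}")
  case True
  thus ?thesis using e by (simp add: seq_freq_def)
next
  case False
  define \<phi> where "\<phi> i x = max 0 (1 - real i * infdist x C)" for i x
  have lim: "(\<lambda>i. \<phi> i x) \<longlonglongrightarrow> indicator C x" for x
    unfolding \<phi>_def using C(1) False by (rule infdist_bump_tendsto)
  have cont: "continuous_on A (\<phi> i)" for A i
    unfolding \<phi>_def[abs_def] by (intro continuous_intros)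
  have bd: "\<bar>\<phi> i x\<bar> \<le> 1" "indicator C x \<le> \<phi> i x" for i x
    using C infdist_nonneg[of x C] by (auto simp: \<phi>_def indicator_def)
  have meas: "\<phi> i \<in> borel_measurable \<mu>" for i
    by (rule borel_measurable_circle_continuous[OF cont])
  note [measurable] = sets_circle_closed[OF C] meas
  have "(\<lambda>i. \<integral>x. \<phi> i x \<partial>\<mu>) \<longlonglongrightarrow> (\<integral>x. indicator C x \<partial>\<mu>)"
    by (rule integral_dominated_convergence[where w = "\<lambda>_. 1"]) (use lim bd in auto)
  hence "(\<lambda>i. \<integral>x. \<phi> i x \<partial>\<mu>) \<longlonglongrightarrow> measure \<mu> C"
    using C(2) by (simp add: Int_absorb2)
  hence "\<forall>\<^sub>F i in sequentially. (\<integral>x. \<phi> i x \<partial>\<mu>) < measure \<mu> C + e"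
    using e by (intro order_tendstoD(2)) auto
  then obtain i where i: "(\<integral>x. \<phi> i x \<partial>\<mu>) < measure \<mu> C + e"
    by (auto simp: eventually_sequentially)
  have "seq_average z (\<lambda>x. of_real (\<phi> i x)) \<longlonglongrightarrow> (\<integral>x. complex_of_real (\<phi> i x) \<partial>\<mu>)"
    by (rule seq_average_continuous[OF z pow]) (auto intro!: continuous_intros cont)
  hence "(\<lambda>N. Re (seq_average z (\<lambda>x. of_real (\<phi> i x)) N)) \<longlonglongrightarrow> Re (complex_of_real (\<integral>x. \<phi> i x \<partial>\<mu>))"
    unfolding integral_complex_of_real by (rule tendsto_Re)
  hence "\<forall>\<^sub>F N in sequentially. Re (seq_average z (\<lambda>x. of_real (\<phi> i x)) N) < measure \<mu> C + e"
    using i by (intro order_tendstoD(2)) auto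
  thus ?thesis
  proof eventually_elim
    case (elim N)
    have "seq_freq z C N \<le> (\<Sum>j=1..N. \<phi> i (z j)) / real N"
      unfolding seq_freq_eq_sum using bd(2) by (intro divide_right_mono sum_mono) auto
    also have "\<dots> = Re (seq_average z (\<lambda>x. of_real (\<phi> i x)) N)"
      by (simp add: seq_average_def Re_divide_of_nat)
    finally show ?case using elim by simp
  qed
qed

section \<open>Arcs of the circle and their measure\<close>

lemma cis_eq_iff: "cis s = cis t \<longleftrightarrow> (\<exists>n::int. s = t + 2 * pi * n)"
  using sin_cos_eq_iff[of s t] by (auto simp: complex_eq_iff)

lemma cis_representative:
  assumes "norm w = 1"
  obtains t where "a \<le> t" "t < a + 2 * pi" "cis t = w"
proof -
  define \<theta> where "\<theta> = Arg w"
  define k where "k = \<lceil>(a - \<theta>) / (2 * pi)\<rceil>"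
  define t where "t = \<theta> + 2 * pi * of_int k"
  have "w \<noteq> 0" using assms by auto
  hence w: "cis \<theta> = w"
    using assms cis_Arg[of w] by (simp add: \<theta>_def sgn_div_norm)
  have k: "(a - \<theta>) / (2 * pi) \<le> of_int k" "of_int k < (a - \<theta>) / (2 * pi) + 1"
    unfolding k_def by linarith+
  have "a - \<theta> \<le> 2 * pi * of_int k" "2 * pi * of_int k < a - \<theta> + 2 * pi"
    using k pi_gt_zero by (simp_all add: field_simps)
  moreover have "cis t = cis \<theta>" unfolding cis_eq_iff t_def by blast
  ultimately show ?thesis using w by (intro that[of t]) (auto simp: t_def)
qed

text \<open>Each point has countably many angles, so a finite set pulls back to a Lebesgue null
  set.\<close>

lemma measure_circle_finite:
  assumes "finite F"
  shows "F \<inter> sphere 0 1 \<in> sets \<mu>" "measure \<mu> (F \<inter> sphere 0 1) = 0"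
proof -
  have cl: "closed (F \<inter> sphere 0 1)" using assms by (intro finite_imp_closed) simp
  show F: "F \<inter> sphere 0 1 \<in> sets \<mu>"
    by (rule sets_circle_closed[OF cl]) simp
  have "countable {t. cis t = w}" for w
  proof (cases "\<exists>t0. cis t0 = w")
    case True
    then obtain t0 where "w = cis t0" by blast
    hence "{t. cis t = w} = range (\<lambda>n::int. t0 + 2 * pi * n)" by (auto simp: cis_eq_iff)
    thus ?thesis by simp
  qed simp
  hence "countable (\<Union>w\<in>F. {t. cis t = w})"
    using assms by (intro countable_UN) (auto intro: countable_finite)
  hence "AE t in lborel. t \<notin> (\<Union>w\<in>F. {t. cis t = w})"
    by (intro AE_not_in countable_imp_null_set_lborel)
  hence "AE t in lborel. t \<in> {0..<2 * pi} \<longrightarrow> cis t \<notin> F"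
    by eventually_elim auto
  moreover have "{x \<in> sphere 0 1. x \<notin> F} \<in> sets \<mu>"
  proof -
    have "{x \<in> sphere 0 1. x \<notin> F} = space \<mu> - (F \<inter> sphere 0 1)" by auto
    thus ?thesis using F by (metis sets.compl_sets)
  qed
  ultimately have "AE x in \<mu>. x \<notin> F" by (simp add: AE_circle_measure_iff)
  hence "AE x in \<mu>. x \<notin> F \<inter> sphere 0 1" by eventually_elim auto
  thus "measure \<mu> (F \<inter> sphere 0 1) = 0"
    using F circle.prob_eq_0 by blast
qed

text \<open>Open, closed, half-open and degenerate arcs are treated together: S and its complement
  are enclosed in closed sets that overlap at most in the end points. An interval of length at least
  2 pi covers the circle.\<close>

lemma circle_arc_sandwich:
  assumes "circle_arc S"
  obtains C D where "closed C" "C \<subseteq> sphere 0 1" "closed D" "D \<subseteq> sphere 0 1"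
    "S \<subseteq> C" "sphere 0 1 - S \<subseteq> D" "finite (C \<inter> D)"
proof -
  obtain I where I: "is_interval I" and S: "S = cis ` I"
    using assms by (auto simp: circle_arc_def)
  have S_sub: "S \<subseteq> sphere 0 1" by (auto simp: S)
  have compact_arc: "closed (cis ` {a..b})" for a b
    by (intro compact_imp_closed compact_continuous_image continuous_intros) auto
  show ?thesis
  proof (cases "I = {}")
    case True
    thus ?thesis using S by (intro that[of "{}" "sphere 0 1"]) auto
  next
    case ne: False
    show ?thesis
    proof (cases "\<exists>a\<in>I. \<exists>b\<in>I. b - a \<ge> 2 * pi")
      case True
      then obtain a b where ab: "a \<in> I" "b \<in> I" "b - a \<ge> 2 * pi" by blast
      have "w \<in> S" if w: "w \<in> sphere 0 1" for w
      proof -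
        have "norm w = 1" using w by simp
        then obtain t where t: "a \<le> t" "t < a + 2 * pi" "cis t = w" using cis_representative by metis
        have "t \<le> b" using ab t by linarith
        hence "t \<in> I" using I ab t(1) unfolding is_interval_1 by blast
        thus ?thesis using t(3) S by auto
      qed
      thus ?thesis by (intro that[of "sphere 0 1" "{}"]) (use S_sub in auto)
    next
      case False
      hence len: "b - a < 2 * pi" if "a \<in> I" "b \<in> I" for a b using that by (meson not_le)
      obtain x0 where x0: "x0 \<in> I" using ne by blast
      have bdd: "bdd_below I" "bdd_above I"
        using len[OF _ x0] len[OF x0] by (auto intro!: bdd_belowI[of _ "x0 - 2 * pi"] bdd_aboveI[of _ "x0 + 2 * pi"])
           (smt (verit))+
      define a b where "a = Inf I" and "b = Sup I"
      have ab: "a \<le> x" "x \<le> b" if "x \<in> I" for x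
        using that bdd by (auto simp: a_def b_def cInf_lower cSup_upper)
      have inI: "x \<in> I" if "a < x" "x < b" for x
      proof -
        obtain y where y: "y \<in> I" "y < x" using cInf_lessD[OF ne, of x] \<open>a < x\<close> by (auto simp: a_def)
        obtain y' where y': "y' \<in> I" "x < y'" using less_cSupD[OF ne, of x] \<open>x < b\<close> by (auto simp: b_def)
        show ?thesis using I y y' less_imp_le[OF y(2)] less_imp_le[OF y'(2)] unfolding is_interval_1 by blast
      qed
      have "b \<le> x + 2 * pi" if "x \<in> I" for x
        unfolding b_def using len[OF that] by (intro cSup_least[OF ne]) (smt (verit))
      hence "b - 2 * pi \<le> a"
        unfolding a_def by (intro cInf_greatest[OF ne]) (smt (verit))
      hence ba: "b \<le> a + 2 * pi" by simp
      show ?thesis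
      \<comment> \<open>With a and b the ends of the interval and b \<le> a + 2 pi, the
        complementary closed arc continues from b to the next occurrence of the starting
        point.\<close>
      proof (rule that[of "cis ` {a..b}" "cis ` {b..a + 2 * pi}"])
        show "S \<subseteq> cis ` {a..b}" using ab by (auto simp: S)
        show "sphere 0 1 - S \<subseteq> cis ` {b..a + 2 * pi}"
        proof
          fix w assume w: "w \<in> sphere 0 1 - S"
          hence "norm w = 1" by simp
          then obtain t where t: "a \<le> t" "t < a + 2 * pi" "cis t = w" using cis_representative by metis
          show "w \<in> cis ` {b..a + 2 * pi}"
          proof (cases "b \<le> t")
            case True
            thus ?thesis using t by auto
          next
            case False
            \<comment> \<open>Angles strictly between a and b belong to S. The remaining angle a is
              represented on the second arc by a + 2 pi.\<close>
            have "\<not> a < t" using inI[of t] False w t S by auto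
            hence "t = a" using t by simp
            moreover have "cis a = cis (a + 2 * pi)" by (simp flip: cis_mult)
            ultimately have "w = cis (a + 2 * pi)" using t by simp
            thus ?thesis using ba by auto
          qed
        qed
        have "cis ` {a..b} \<inter> cis ` {b..a + 2 * pi} \<subseteq> {cis a, cis b}"
        proof
          fix w assume "w \<in> cis ` {a..b} \<inter> cis ` {b..a + 2 * pi}"
          then obtain s t where st: "s \<in> {a..b}" "t \<in> {b..a + 2 * pi}" "w = cis s" "cis s = cis t" by auto
          then obtain n :: int where n: "t = s + 2 * pi * n" using cis_eq_iff[of t s] by metis
          have "2 * pi * 0 \<le> 2 * pi * n" "2 * pi * n \<le> 2 * pi * 1"
            using st(1,2) n unfolding atLeastAtMost_iff by linarith+
          hence "0 \<le> real_of_int n" "real_of_int n \<le> 1"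
            by (simp_all only: mult_le_cancel_left_pos[of "2 * pi"] pi_gt_zero zero_less_mult_iff zero_less_numeral simp_thms)
          hence "n = 0 \<or> n = 1" by auto
          thus "w \<in> {cis a, cis b}"
          proof
            assume "n = 0"
            hence "s = b" using n st(1,2) by simp
            thus ?thesis using st(3) by simp
          next
            assume "n = 1"
            hence "s = a" using n st(1,2) by simp
            thus ?thesis using st(3) by simp
          qed
        qed
        thus "finite (cis ` {a..b} \<inter> cis ` {b..a + 2 * pi})" by (rule finite_subset) simp
      qed (auto intro: compact_arc)
    qed
  qed
qed

text \<open>C and D cover the circle with a null overlap, so their measures add up to 1; together
  with the inclusions this forces equality for S and its complement. S is measurable because it
  differs from the complement of D by a finite set.\<close>

lemma circle_arc_measure:
  assumes "circle_arc S" "closed C" "C \<subseteq> sphere 0 1" "closed D" "D \<subseteq> sphere 0 1"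
    "S \<subseteq> C" "sphere 0 1 - S \<subseteq> D" "finite (C \<inter> D)"
  shows "S \<in> sets \<mu>" "measure \<mu> C = measure \<mu> S"
    "measure \<mu> D = 1 - measure \<mu> S"
proof -
  have C: "C \<in> sets \<mu>" and D: "D \<in> sets \<mu>"
    using assms sets_circle_closed by blast+
  have "finite (S - (sphere 0 1 - D))"
    using assms by (auto intro: finite_subset[OF _ assms(8)])
  note fin = measure_circle_finite[OF this]
  have "S = (space \<mu> - D) \<union> ((S - (sphere 0 1 - D)) \<inter> sphere 0 1)"
    using assms by auto
  thus S: "S \<in> sets \<mu>"
    using D fin(1) by (metis sets.Un sets.compl_sets)
  have CD: "measure \<mu> (C \<inter> D) = 0"
    using measure_circle_finite(2)[OF assms(8)] assms(3) by (simp add: Int_absorb2 le_infI1)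
  have "C \<union> D = space \<mu>" using assms by auto
  hence "measure \<mu> (C \<union> D) = 1" using circle.prob_space by simp
  hence 1: "measure \<mu> C + measure \<mu> D = 1"
    using measure_Un3[of C \<mu> D] C D CD by (simp add: circle.fmeasurable_eq_sets)
  have "measure \<mu> S \<le> measure \<mu> C"
    using C assms by (intro circle.finite_measure_mono) auto
  moreover have "measure \<mu> (space \<mu> - S) \<le> measure \<mu> D"
    using D assms by (intro circle.finite_measure_mono) auto
  ultimately show "measure \<mu> C = measure \<mu> S"
    "measure \<mu> D = 1 - measure \<mu> S"
    using 1 circle.prob_compl[OF S] by auto
qed

text \<open>The frequency of S lies between one minus that of D and that of C, and both have the
  right upper bounds.\<close>

lemma equidistributed_if_averages:
  assumes z: "\<And>n. norm (z n) = 1" and pow: "\<And>k. k \<ge> 1 \<Longrightarrow> seq_average z (\<lambda>x. x ^ k) \<longlonglongrightarrow> 0"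
  shows "equidistributed z"
  unfolding equidistributed_iff
proof (intro allI impI)
  fix S assume S: "circle_arc S"
  obtain C D where CD: "closed C" "C \<subseteq> sphere 0 1" "closed D" "D \<subseteq> sphere 0 1"
    "S \<subseteq> C" "sphere 0 1 - S \<subseteq> D" "finite (C \<inter> D)"
    using circle_arc_sandwich[OF S] by metis
  note m = circle_arc_measure[OF S CD]
  show "seq_freq z S \<longlonglongrightarrow> measure \<mu> S"
  proof (rule LIMSEQ_I)
    fix e :: real assume e: "e > 0"
    have "\<forall>\<^sub>F N in sequentially. seq_freq z C N < measure \<mu> C + e"
      by (rule seq_freq_closed[OF z pow CD(1,2) e])
    moreover have "\<forall>\<^sub>F N in sequentially. seq_freq z D N < measure \<mu> D + e"
      by (rule seq_freq_closed[OF z pow CD(3,4) e])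
    ultimately have "\<forall>\<^sub>F N in sequentially. norm (seq_freq z S N - measure \<mu> S) < e"
      using eventually_gt_at_top[of 0]
    proof eventually_elim
      case (elim N)
      have 1: "seq_freq z S N \<le> seq_freq z C N"
        unfolding seq_freq_eq_sum using CD(5)
        by (intro divide_right_mono sum_mono) (auto simp: indicator_def)
      have "1 = (\<Sum>j=1..N. 1) / real N" using elim by simp
      also have "\<dots> \<le> (\<Sum>j=1..N. indicator S (z j) + indicator D (z j)) / real N"
        using CD(6) z by (intro divide_right_mono sum_mono) (auto simp: indicator_def subset_eq)
      also have "\<dots> = seq_freq z S N + seq_freq z D N"
        unfolding seq_freq_eq_sum by (simp add: sum.distrib add_divide_distrib)
      finally show ?case using 1 elim m(2,3) by simp
    qed
    thus "\<exists>N0. \<forall>N\<ge>N0. norm (seq_freq z S N - measure \<mu> S) < e"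
      by (simp add: eventually_sequentially)
  qed
qed

lemma norm_cis_diff_le: "norm (cis t - cis s) \<le> \<bar>t - s\<bar>"
proof -
  have "(norm (cis t - cis s))\<^sup>2 = (cos t - cos s)\<^sup>2 + (sin t - sin s)\<^sup>2"
    by (simp add: cmod_power2)
  also have "\<dots> = ((sin t)\<^sup>2 + (cos t)\<^sup>2) + ((sin s)\<^sup>2 + (cos s)\<^sup>2) - 2 * (cos t * cos s + sin t * sin s)"
    by (simp add: power2_eq_square algebra_simps)
  also have "\<dots> = 2 - 2 * cos (t - s)"
    by (simp add: cos_diff)
  also have "cos (t - s) = cos (2 * ((t - s) / 2))"
    by (rule arg_cong[where f = cos]) (simp add: field_simps)
  also have "2 - 2 * \<dots> = (2 * sin ((t - s) / 2))\<^sup>2"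
    unfolding cos_double_sin by (simp add: power_mult_distrib)
  also have "\<dots> \<le> (t - s)\<^sup>2"
  proof -
    have "\<bar>2 * sin ((t - s) / 2)\<bar> \<le> \<bar>t - s\<bar>"
      using abs_sin_x_le_abs_x[of "(t - s) / 2"] by (simp add: abs_mult)
    thus ?thesis unfolding abs_le_square_iff .
  qed
  finally show ?thesis by (simp add: abs_le_square_iff[symmetric])
qed

text \<open>The power x ^ k is a uniform limit of step functions over K + 1 equal half-open arcs,
  and for step functions convergence of averages is the definition of equidistribution.\<close>

lemma averages_if_equidistributed:
  assumes z: "\<And>n. norm (z n) = 1" and eq: "equidistributed z" and k: "k \<ge> 1"
  shows "seq_average z (\<lambda>x. x ^ k) \<longlonglongrightarrow> 0"
proof -
  define arc where "arc K j = cis ` {2 * pi * real j / real (Suc K)..<2 * pi * real (Suc j) / real (Suc K)}" for K j :: nat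
  define s where "s K x = (\<Sum>j\<le>K. cis (2 * pi * real j / real (Suc K)) ^ k * indicator (arc K j) x)" for K x
  have arc: "circle_arc (arc K j)" for K j
    unfolding circle_arc_def arc_def by (intro exI conjI refl) (auto simp: is_interval_1)
  have arc_sets: "arc K j \<in> sets \<mu>" for K j
    using circle_arc_sandwich[OF arc] circle_arc_measure(1)[OF arc] by metis
  have s_eq: "\<exists>t j. x = cis t \<and> s K x = cis (2 * pi * real j / real (Suc K)) ^ k \<and>
      \<bar>t - 2 * pi * real j / real (Suc K)\<bar> \<le> 2 * pi / real (Suc K)" if x: "norm x = 1" for K x
  proof -
    obtain t where t: "0 \<le> t" "t < 0 + 2 * pi" "cis t = x" using cis_representative[OF x] by metis
    \<comment> \<open>The index of the unique arc that contains the angle t.\<close>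
    define j where "j = nat \<lfloor>t * real (Suc K) / (2 * pi)\<rfloor>"
    have q: "t * real (Suc K) / (2 * pi) \<ge> 0" using t by simp
    have j: "real j \<le> t * real (Suc K) / (2 * pi)" "t * real (Suc K) / (2 * pi) < real (Suc j)"
      using q unfolding j_def by linarith+
    have "t * real (Suc K) / (2 * pi) < real (Suc K)"
      using t by (simp add: divide_less_eq mult.commute)
    hence jK: "j \<le> K" using j(1) by linarith
    have tj: "2 * pi * real i / real (Suc K) \<le> t \<longleftrightarrow> real i \<le> t * real (Suc K) / (2 * pi)"
      "t < 2 * pi * real i / real (Suc K) \<longleftrightarrow> t * real (Suc K) / (2 * pi) < real i" for i
      by (simp_all add: field_simps del: of_nat_Suc)
    have mem: "x \<in> arc K i \<longleftrightarrow> i = j" if i: "i \<le> K" for i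
    proof
      assume "i = j"
      thus "x \<in> arc K i" using t j tj unfolding arc_def by (metis atLeastLessThan_iff image_eqI)
    next
      assume "x \<in> arc K i"
      then obtain u where u: "2 * pi * real i / real (Suc K) \<le> u" "u < 2 * pi * real (Suc i) / real (Suc K)" "x = cis u"
        by (auto simp: arc_def)
      have "2 * pi * real (Suc i) / real (Suc K) \<le> 2 * pi"
        using i pi_gt_zero by (simp add: divide_le_eq)
      hence u2: "0 \<le> u" "u < 2 * pi" using u(1,2) by (auto intro: order.trans[rotated])
      have "cis u = cis t" using u t by simp
      then obtain n :: int where n: "u = t + 2 * pi * n" using cis_eq_iff by metis
      have "2 * pi * n < 2 * pi * 1" "2 * pi * (-1) < 2 * pi * n" using n t u2 by linarith+
      hence "of_int n < (1::real)" "(-1::real) < of_int n"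
        by (simp_all only: mult_less_cancel_left_pos[of "2 * pi"] pi_gt_zero zero_less_mult_iff zero_less_numeral simp_thms)
      hence "n = 0" by linarith
      hence "u = t" using n by simp
      hence "real i \<le> t * real (Suc K) / (2 * pi)" "t * real (Suc K) / (2 * pi) < real (Suc i)"
        using u(1,2) tj by blast+
      thus "i = j" using j by linarith
    qed
    have "s K x = (\<Sum>i\<le>K. if i = j then cis (2 * pi * real j / real (Suc K)) ^ k else 0)"
      unfolding s_def using mem by (intro sum.cong refl) (auto simp: indicator_def)
    hence sx: "s K x = cis (2 * pi * real j / real (Suc K)) ^ k" using jK by simp
    have "2 * pi * real j / real (Suc K) \<le> t" "t < 2 * pi * real (Suc j) / real (Suc K)"
      using tj j by blast+
    moreover have "2 * pi * real (Suc j) / real (Suc K) = 2 * pi * real j / real (Suc K) + 2 * pi / real (Suc K)"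
      by (simp add: add_divide_distrib ring_distribs)
    ultimately have "\<bar>t - 2 * pi * real j / real (Suc K)\<bar> \<le> 2 * pi / real (Suc K)"
      by linarith
    thus ?thesis using sx t(3) by blast
  qed
  have dist: "norm (s K x - x ^ k) \<le> real k * (2 * pi / real (Suc K))" and sB: "norm (s K x) \<le> 1"
    if x: "norm x = 1" for K x
  proof -
    obtain t j where tj: "x = cis t" "s K x = cis (2 * pi * real j / real (Suc K)) ^ k"
      "\<bar>t - 2 * pi * real j / real (Suc K)\<bar> \<le> 2 * pi / real (Suc K)"
      using s_eq[OF x] by blast
    \<comment> \<open>On the closed unit disc the k-th power is Lipschitz with constant k, and the
      chord is at most the difference of angles.\<close>
    have "norm (s K x - x ^ k) \<le> real k * norm (cis (2 * pi * real j / real (Suc K)) - cis t)"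
      unfolding tj(2) unfolding tj(1) by (rule norm_power_diff) auto
    also have "\<dots> \<le> real k * (2 * pi / real (Suc K))"
      using norm_cis_diff_le[of "2 * pi * real j / real (Suc K)" t] tj(3) 
      by (intro mult_left_mono) (auto simp: abs_minus_commute simp del: of_nat_Suc)
    finally show "norm (s K x - x ^ k) \<le> real k * (2 * pi / real (Suc K))" .
    show "norm (s K x) \<le> 1" unfolding tj(2) by (simp add: norm_power)
  qed
  have unif: "uniform_limit (sphere 0 1) s (\<lambda>x. x ^ k) sequentially"
  proof (rule uniform_limitI)
    fix e :: real assume e: "e > 0"
    have "(\<lambda>K. real k * (2 * pi / real (Suc K))) \<longlonglongrightarrow> 0" by real_asymp
    hence "\<forall>\<^sub>F K in sequentially. real k * (2 * pi / real (Suc K)) < e"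
      using e by (rule order_tendstoD(2))
    thus "\<forall>\<^sub>F K in sequentially. \<forall>x\<in>sphere 0 1. dist (s K x) (x ^ k) < e"
    proof eventually_elim
      case (elim K)
      show ?case
      proof
        fix x :: complex assume "x \<in> sphere 0 1"
        hence "norm (s K x - x ^ k) \<le> real k * (2 * pi / real (Suc K))" by (intro dist) simp
        thus "dist (s K x) (x ^ k) < e" unfolding dist_norm using elim by (rule le_less_trans)
      qed
    qed
  qed
  have ind: "(\<integral>x. indicator (arc K j) x \<partial>\<mu>) = complex_of_real (measure \<mu> (arc K j))" for K j
  proof -
    have "(\<integral>x. complex_of_real (indicator (arc K j) x) \<partial>\<mu>) = of_real (measure \<mu> (arc K j))"
      using arc_sets sets.sets_into_space[OF arc_sets[of K j]]
      by (subst integral_complex_of_real) (simp add: Int_absorb1 Int_absorb2)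
    thus ?thesis by (simp add: of_real_indicator)
  qed
  have iint: "integrable \<mu> (\<lambda>x. indicator (arc K j) x :: complex)" for K j
    using arc_sets by (intro integrable_circle_bounded[of _ 1]) (auto simp: indicator_def)
  have s_meas: "s K \<in> borel_measurable \<mu>" for K
    unfolding s_def[abs_def] using arc_sets by measurable
  have s_conv: "seq_average z (s K) \<longlonglongrightarrow> (\<integral>x. s K x \<partial>\<mu>)" for K
  proof -
    let ?c = "\<lambda>j. cis (2 * pi * real j / real (Suc K)) ^ k"
    have "(\<lambda>N. \<Sum>j\<le>K. ?c j * of_real (seq_freq z (arc K j) N)) \<longlonglongrightarrow>
        (\<Sum>j\<le>K. ?c j * of_real (measure \<mu> (arc K j)))"
      using eq arc unfolding equidistributed_iff by (intro tendsto_intros) blast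
    also have "(\<lambda>N. \<Sum>j\<le>K. ?c j * of_real (seq_freq z (arc K j) N)) = seq_average z (s K)"
    proof
      fix N
      have "seq_average z (s K) N = (\<Sum>j\<le>K. \<Sum>n=1..N. ?c j * indicator (arc K j) (z n)) / of_nat N"
        unfolding seq_average_def s_def by (subst sum.swap) (rule refl)
      also have "\<dots> = (\<Sum>j\<le>K. ?c j * of_real (seq_freq z (arc K j) N))"
        unfolding seq_freq_eq_sum
        by (simp only: of_real_divide of_real_sum of_real_indicator of_real_of_nat_eq
            sum_divide_distrib sum_distrib_left times_divide_eq_right)
      finally show "(\<Sum>j\<le>K. ?c j * of_real (seq_freq z (arc K j) N)) = seq_average z (s K) N" by simp
    qed
    also have "(\<Sum>j\<le>K. ?c j * of_real (measure \<mu> (arc K j))) = (\<integral>x. s K x \<partial>\<mu>)"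
      unfolding s_def using iint
      by (subst Bochner_Integration.integral_sum) (auto simp: ind simp del: of_nat_Suc)
    finally show ?thesis .
  qed
  have "seq_average z (\<lambda>x. x ^ k) \<longlonglongrightarrow> (\<integral>x. x ^ k \<partial>\<mu>)"
    by (rule seq_average_uniform_limit[OF z s_meas sB s_conv unif])
  thus ?thesis using integral_circle_power(1)[of k] k by simp
qed

lemma weyl_criterion:
  assumes "\<And>n. norm (z n) = 1"
  shows "equidistributed z \<longleftrightarrow> (\<forall>k\<ge>1. seq_average z (\<lambda>x. x ^ k) \<longlonglongrightarrow> 0)"
  using equidistributed_if_averages[where z = z, OF assms] averages_if_equidistributed[where z = z, OF assms] by blast

section \<open>Non-contracting sequences\<close>

text \<open>Schwarz's lemma for the composite of \<open>h\<close> with the disc automorphism moving \<open>h 0\<close> to 0.\<close>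

lemma schwarz_pick_at_0:
  assumes hol: "h holomorphic_on ball 0 1" and lt: "\<And>w. norm w < 1 \<Longrightarrow> norm (h w) < 1" and z: "norm z < 1"
  shows "(1 - (norm (h 0))\<^sup>2) * (1 - (norm z)\<^sup>2) / 4 \<le> 1 - (norm (h z))\<^sup>2"
proof -
  define a where "a = h 0"
  have a: "norm a < 1" using lt[of 0] by (simp add: a_def)
  \<comment> \<open>This identity shows that the automorphism maps the disc into itself, and later
    turns Schwarz's bound for \<open>f\<close> into one for 1 - |h z| ^ 2.\<close>
  have ident: "(norm (1 - cnj a * u))\<^sup>2 - (norm (u - a))\<^sup>2 = (1 - (norm a)\<^sup>2) * (1 - (norm u)\<^sup>2)" for u
    unfolding cmod_power2 by (simp add: power2_eq_square algebra_simps)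
  have a2: "1 - (norm a)\<^sup>2 > 0" using a by (simp add: power_less_one_iff)
  have den: "norm (u - a) < norm (1 - cnj a * u)" if "norm u < 1" for u
  proof -
    have "(1 - (norm a)\<^sup>2) * (1 - (norm u)\<^sup>2) > 0"
      using a2 that by (intro mult_pos_pos) (auto simp: power_less_one_iff)
    hence "(norm (u - a))\<^sup>2 < (norm (1 - cnj a * u))\<^sup>2" using ident[of u] by linarith
    thus ?thesis by (rule power2_less_imp_less) simp
  qed
  have nz: "1 - cnj a * u \<noteq> 0" if "norm u < 1" for u
    using den[OF that] by auto
  define f where "f w = (h w - a) / (1 - cnj a * h w)" for w
  have "f holomorphic_on ball 0 1"
    unfolding f_def[abs_def] using hol lt nz by (intro holomorphic_intros) auto
  moreover have "f 0 = 0" by (simp add: f_def a_def)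
  moreover have "norm (f w) < 1" if "norm w < 1" for w
    using den[OF lt[OF that]] nz[OF lt[OF that]] by (simp add: f_def norm_divide divide_less_eq)
  ultimately have "norm (f z) \<le> norm z"
    using Schwarz_Lemma(1)[of f z] z by blast
  hence "norm (h z - a) \<le> norm z * norm (1 - cnj a * h z)"
    using nz[OF lt[OF z]] by (simp add: f_def norm_divide divide_le_eq)
  hence "(norm (h z - a))\<^sup>2 \<le> (norm z)\<^sup>2 * (norm (1 - cnj a * h z))\<^sup>2"
    using power_mono[of _ _ 2] by (fastforce simp: power_mult_distrib)
  hence 1: "(1 - (norm z)\<^sup>2) * (norm (1 - cnj a * h z))\<^sup>2 \<le> (1 - (norm a)\<^sup>2) * (1 - (norm (h z))\<^sup>2)"
    using ident[of "h z"] by (simp add: algebra_simps)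
  have z2: "1 - (norm z)\<^sup>2 \<ge> 0" using z by (simp add: power_le_one)
  have "norm (cnj a * h z) \<le> norm a * 1"
    unfolding norm_mult complex_mod_cnj using lt[OF z] by (intro mult_left_mono) auto
  hence "1 - norm a \<le> norm (1 - cnj a * h z)"
    using norm_triangle_ineq2[of 1 "cnj a * h z"] by simp
  hence "(1 - norm a)\<^sup>2 \<le> (norm (1 - cnj a * h z))\<^sup>2"
    using a by (intro power_mono) auto
  hence "(1 - (norm z)\<^sup>2) * (1 - norm a)\<^sup>2 \<le> (1 - (norm a)\<^sup>2) * (1 - (norm (h z))\<^sup>2)"
    using 1 z2 by (meson mult_left_mono order.trans)
  \<comment> \<open>Source of the factor 1 / 4: since 1 + |a| \<le> 2, the square of 1 - |a| ^ 2 is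
    at most 4 times the square of 1 - |a|. One factor 1 - |a| ^ 2 is cancelled at the end.\<close>
  moreover have "(1 - norm a)\<^sup>2 * 4 \<ge> (1 - (norm a)\<^sup>2)\<^sup>2"
  proof -
    have "(1 + norm a)\<^sup>2 \<le> 2\<^sup>2" using a by (intro power_mono) auto
    hence "(1 - norm a)\<^sup>2 * (1 + norm a)\<^sup>2 \<le> (1 - norm a)\<^sup>2 * 4" by (intro mult_left_mono) auto
    moreover have "(1 - norm a)\<^sup>2 * (1 + norm a)\<^sup>2 = (1 - (norm a)\<^sup>2)\<^sup>2"
      by (simp add: power2_eq_square algebra_simps)
    ultimately show ?thesis by simp
  qed
  ultimately have "(1 - (norm z)\<^sup>2) * ((1 - (norm a)\<^sup>2)\<^sup>2 / 4) \<le> (1 - (norm a)\<^sup>2) * (1 - (norm (h z))\<^sup>2)"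
    using z2 by (meson mult_left_mono order.trans divide_le_eq_numeral1(1))
  hence "(1 - (norm a)\<^sup>2) * ((1 - (norm a)\<^sup>2) * (1 - (norm z)\<^sup>2) / 4) \<le> (1 - (norm a)\<^sup>2) * (1 - (norm (h z))\<^sup>2)"
    by (simp add: power2_eq_square mult_ac)
  thus ?thesis using a2 by (simp add: a_def mult_le_cancel_left_pos)
qed

text \<open>Applied to \<open>rho n\<close> * h, which stays strictly inside the disc, and passed to
  the limit. The closed bound is needed because the quotient g z / z may be a unimodular
  constant.\<close>

lemma schwarz_pick_at_0_closed:
  assumes hol: "h holomorphic_on ball 0 1" and le: "\<And>w. norm w < 1 \<Longrightarrow> norm (h w) \<le> 1" and z: "norm z < 1"
  shows "(1 - (norm (h 0))\<^sup>2) * (1 - (norm z)\<^sup>2) / 4 \<le> 1 - (norm (h z))\<^sup>2"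
proof (rule LIMSEQ_le)
  show "(\<lambda>n. (1 - (rho n * norm (h 0))\<^sup>2) * (1 - (norm z)\<^sup>2) / 4) \<longlonglongrightarrow>
      (1 - (norm (h 0))\<^sup>2) * (1 - (norm z)\<^sup>2) / 4"
    by (auto intro!: tendsto_eq_intros rho_tendsto)
  show "(\<lambda>n. 1 - (rho n * norm (h z))\<^sup>2) \<longlonglongrightarrow> 1 - (norm (h z))\<^sup>2"
    by (auto intro!: tendsto_eq_intros rho_tendsto)
  have "(1 - (rho n * norm (h 0))\<^sup>2) * (1 - (norm z)\<^sup>2) / 4 \<le> 1 - (rho n * norm (h z))\<^sup>2" for n
  proof -
    have n: "norm (of_real (rho n) * w) = rho n * norm w" for w :: complex
      using rho_pos[of n] by (simp add: norm_mult)
    have lt: "norm (of_real (rho n) * h w) < 1" if "norm w < 1" for w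
    proof -
      have "rho n * norm (h w) \<le> rho n * 1"
        using rho_pos[of n] le[OF that] by (intro mult_left_mono) auto
      thus ?thesis unfolding n using rho_less_1[of n] by simp
    qed
    have "(\<lambda>w. of_real (rho n) * h w) holomorphic_on ball 0 1"
      using hol by (intro holomorphic_intros)
    from schwarz_pick_at_0[OF this lt z] show ?thesis unfolding n .
  qed
  thus "\<exists>N. \<forall>n\<ge>N. (1 - (rho n * norm (h 0))\<^sup>2) * (1 - (norm z)\<^sup>2) / 4 \<le> 1 - (rho n * norm (h z))\<^sup>2"
    by blast
qed

text \<open>The quotient h = g z / z has the value g'(0) at 0, so the estimate for h bounds the
  shrinking of |z| by a factor depending only on |g'(0)| and R. Such factors can be multiplied along
  the sequence, as the disc of radius R is mapped into itself.\<close>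

lemma inner_norm_sq_le:
  assumes g: "inner_function g" "g 0 = 0" and z: "norm z \<le> R" "R < 1"
  shows "(norm (g z))\<^sup>2 \<le> (norm z)\<^sup>2 * (1 - (1 - (norm (deriv g 0))\<^sup>2) * ((1 - R\<^sup>2) / 4))"
    and "norm (g z) \<le> norm z"
proof -
  obtain h where h: "h holomorphic_on ball 0 1" "\<And>z. norm z < 1 \<Longrightarrow> g z = z * h z"
    "h 0 = deriv g 0" "\<And>z. norm z < 1 \<Longrightarrow> norm (h z) \<le> 1"
    using inner_function_factor[OF g] by metis
  have z1: "norm z < 1" using z by simp
  have "norm (g z) = norm z * norm (h z)" using h(2)[OF z1] by (simp add: norm_mult)
  also have "\<dots> \<le> norm z * 1" using h(4)[OF z1] by (intro mult_left_mono) auto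
  finally show "norm (g z) \<le> norm z" by simp
  have "(norm z)\<^sup>2 \<le> R\<^sup>2" using z by (intro power_mono) auto
  hence "(1 - (norm (h 0))\<^sup>2) * ((1 - R\<^sup>2) / 4) \<le> (1 - (norm (h 0))\<^sup>2) * ((1 - (norm z)\<^sup>2) / 4)"
    using h(4)[of 0] by (intro mult_left_mono) (auto simp: power_le_one)
  hence "(norm (h z))\<^sup>2 \<le> 1 - (1 - (norm (deriv g 0))\<^sup>2) * ((1 - R\<^sup>2) / 4)"
    using schwarz_pick_at_0_closed[OF h(1,4) z1] h(3) by simp
  hence "(norm z)\<^sup>2 * (norm (h z))\<^sup>2 \<le> (norm z)\<^sup>2 * (1 - (1 - (norm (deriv g 0))\<^sup>2) * ((1 - R\<^sup>2) / 4))"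
    by (intro mult_left_mono) auto
  thus "(norm (g z))\<^sup>2 \<le> (norm z)\<^sup>2 * (1 - (1 - (norm (deriv g 0))\<^sup>2) * ((1 - R\<^sup>2) / 4))"
    using h(2)[OF z1] by (simp add: norm_mult power_mult_distrib)
qed

text \<open>The factors 1 - c * x are replaced by exp (- c * x), which turns their product into a
  sum that can be compared with a divergent series.\<close>

lemma comp_seq_norm_sq_le:
  assumes inner: "\<And>n. n \<ge> 1 \<Longrightarrow> inner_function (g n)" and zero: "\<And>n. n \<ge> 1 \<Longrightarrow> g n 0 = 0"
    and z: "norm z \<le> R" "R < 1"
  shows "(norm (comp_seq g n z))\<^sup>2 \<le> exp (- ((1 - R\<^sup>2) / 4) * (\<Sum>i<n. 1 - (norm (deriv (g (Suc i)) 0))\<^sup>2))"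
    and "norm (comp_seq g n z) \<le> R"
proof (induction n)
  case 0
  have "norm z \<ge> 0" by simp
  hence "(norm z)\<^sup>2 \<le> 1" using z by (intro power_le_one) linarith+
  thus "(norm (comp_seq g 0 z))\<^sup>2 \<le> exp (- ((1 - R\<^sup>2) / 4) * (\<Sum>i<0. 1 - (norm (deriv (g (Suc i)) 0))\<^sup>2))"
    by simp
  show "norm (comp_seq g 0 z) \<le> R" using z by simp
next
  case (Suc n)
  let ?x = "1 - (norm (deriv (g (Suc n)) 0))\<^sup>2" and ?c = "(1 - R\<^sup>2) / 4"
  note b = inner_norm_sq_le[OF inner zero Suc.IH(2) z(2), of "Suc n"]
  show "norm (comp_seq g (Suc n) z) \<le> R" using b(2) Suc.IH(2) by simp
  have "(norm (comp_seq g (Suc n) z))\<^sup>2 \<le> (norm (comp_seq g n z))\<^sup>2 * (1 - ?x * ?c)"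
    using b(1) by simp
  also have "\<dots> \<le> (norm (comp_seq g n z))\<^sup>2 * exp (- ?c * ?x)"
    using exp_ge_add_one_self[of "- ?c * ?x"] by (intro mult_left_mono) (auto simp: mult.commute)
  also have "\<dots> \<le> exp (- ?c * (\<Sum>i<n. 1 - (norm (deriv (g (Suc i)) 0))\<^sup>2)) * exp (- ?c * ?x)"
    using Suc.IH(1) by (intro mult_right_mono) auto
  also have "\<dots> = exp (- ?c * (\<Sum>i<Suc n. 1 - (norm (deriv (g (Suc i)) 0))\<^sup>2))"
    by (simp only: exp_add[symmetric] sum.lessThan_Suc ring_distribs)
  finally show "(norm (comp_seq g (Suc n) z))\<^sup>2 \<le>
      exp (- ?c * (\<Sum>i<Suc n. 1 - (norm (deriv (g (Suc i)) 0))\<^sup>2))" .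
qed

text \<open>With x i = 1 - |g'(0)| ^ 2 for the (i + 1)-st map, a convergent sum of the x i would
  give the product of the nonzero numbers 1 - x i a nonzero limit. Hence the sum diverges, and the
  exponential bound tends to 0 uniformly on each smaller disc.\<close>

lemma contracting_if_deriv_tendsto_0:
  assumes inner: "\<And>n. n \<ge> 1 \<Longrightarrow> inner_function (g n)" and zero: "\<And>n. n \<ge> 1 \<Longrightarrow> g n 0 = 0"
    and nz: "\<And>n. n \<ge> 1 \<Longrightarrow> deriv (g n) 0 \<noteq> 0"
    and lim: "(\<lambda>n. norm (deriv (comp_seq g n) 0)) \<longlonglongrightarrow> 0"
  shows "contracting g"
  unfolding contracting_def
proof (intro allI impI; elim conjE)
  fix K :: "complex set" assume K: "compact K" "K \<subseteq> ball 0 1"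
  define x where "x i = 1 - (norm (deriv (g (Suc i)) 0))\<^sup>2" for i
  have x0: "x i \<ge> 0" for i
    using norm_deriv_inner_le[OF inner zero, of "Suc i"] by (simp add: x_def power_le_one)
  have x1: "x i < 1" for i using nz[of "Suc i"] by (simp add: x_def)
  have not_summable: "\<not> summable x"
  proof
    assume "summable x"
    hence "convergent_prod (\<lambda>i. 1 + (- x i))"
      using x0 x1 by (intro summable_imp_convergent_prod_real) (auto simp: less_imp_neq)
    moreover have "1 + - x i \<noteq> 0" for i using x1[of i] by simp
    ultimately obtain L where L: "(\<lambda>n. \<Prod>i\<le>n. 1 + - x i) \<longlonglongrightarrow> L" "L \<noteq> 0"
      using convergent_prod_iff_nz_lim[of "\<lambda>i. 1 + - x i"] by blast
    have "(\<Prod>i\<le>n. 1 + - x i) = (norm (deriv (comp_seq g (Suc n)) 0))\<^sup>2" for n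
    proof -
      have "norm (deriv (comp_seq g (Suc n)) 0) = (\<Prod>j=1..Suc n. norm (deriv (g j) 0))"
        by (simp only: deriv_comp_seq[where g = g, OF inner zero] prod_norm)
      also have "\<dots> = (\<Prod>i\<le>n. norm (deriv (g (Suc i)) 0))"
        by (rule prod.reindex_bij_witness[of _ Suc "\<lambda>j. j - 1"]) auto
      finally show ?thesis by (simp add: x_def prod_power_distrib)
    qed
    hence "(\<lambda>n. (norm (deriv (comp_seq g (Suc n)) 0))\<^sup>2) \<longlonglongrightarrow> L" using L(1) by simp
    moreover have "(\<lambda>n. (norm (deriv (comp_seq g (Suc n)) 0))\<^sup>2) \<longlonglongrightarrow> 0\<^sup>2"
      by (intro tendsto_power LIMSEQ_Suc lim)
    ultimately have "L = 0\<^sup>2" by (rule LIMSEQ_unique)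
    thus False using L(2) by simp
  qed
  obtain R where R: "\<And>z. z \<in> K \<Longrightarrow> norm z \<le> R" "R < 1"
  proof (cases "K = {}")
    case True
    thus ?thesis by (intro that[of 0]) auto
  next
    case False
    then obtain w where w: "w \<in> K" "\<And>z. z \<in> K \<Longrightarrow> norm z \<le> norm w"
      using continuous_attains_sup[OF K(1) _ continuous_on_norm_id] by metis
    thus ?thesis using K(2) by (intro that[of "norm w"]) auto
  qed
  show "uniform_limit K (comp_seq g) (\<lambda>_. 0) sequentially"
  proof (cases "K = {}")
    case False
    then obtain z0 where "z0 \<in> K" by blast
    hence R0: "R \<ge> 0" using R(1)[of z0] norm_ge_zero[of z0] by linarith
    define c where "c = (1 - R\<^sup>2) / 4"
    have c: "c > 0" using R(2) R0 by (simp add: c_def power_less_one_iff)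
    show ?thesis
    proof (rule uniform_limitI)
      fix e :: real assume e: "e > 0"
      \<comment> \<open>The threshold is the one for which exp (- c * sum) falls below the square of
        e.\<close>
      have "\<exists>n0. (\<Sum>i<n0. x i) > - ln (e\<^sup>2) / c"
      proof (rule ccontr)
        assume "\<not> ?thesis"
        hence "summable x" using x0 by (intro summableI_nonneg_bounded) (auto simp: not_less)
        thus False using not_summable by blast
      qed
      then obtain n0 where n0: "(\<Sum>i<n0. x i) > - ln (e\<^sup>2) / c" by blast
      show "\<forall>\<^sub>F n in sequentially. \<forall>z\<in>K. dist (comp_seq g n z) 0 < e"
        using eventually_ge_at_top[of n0]
      proof (eventually_elim, intro ballI)
        fix n z assume n: "n \<ge> n0" and z: "z \<in> K"
        have "(\<Sum>i<n0. x i) \<le> (\<Sum>i<n. x i)" using n x0 by (intro sum_mono2) auto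
        hence "- ln (e\<^sup>2) / c < (\<Sum>i<n. x i)" using n0 by simp
        hence "- c * (\<Sum>i<n. x i) < ln (e\<^sup>2)" using c by (simp add: field_simps)
        hence "exp (- c * (\<Sum>i<n. x i)) < e\<^sup>2" using e by (metis exp_less_mono exp_ln zero_less_power)
        hence "(norm (comp_seq g n z))\<^sup>2 < e\<^sup>2"
          using comp_seq_norm_sq_le(1)[where g = g and n = n, OF inner zero R(1)[OF z] R(2)]
          unfolding x_def c_def by linarith
        thus "dist (comp_seq g n z) 0 < e" using e by (simp add: power2_less_imp_less)
      qed
    qed
  qed simp
qed

lemma cesaro_tendsto_0:
  fixes d :: "nat \<Rightarrow> real"
  assumes d: "d \<longlonglongrightarrow> 0" and nonneg: "\<And>n. d n \<ge> 0"
  shows "(\<lambda>N. (\<Sum>n=1..N. d n) / real N) \<longlonglongrightarrow> 0"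
proof (rule LIMSEQ_I)
  fix e :: real assume e: "e > 0"
  obtain n0 where n0: "\<And>n. n \<ge> n0 \<Longrightarrow> d n < e / 2"
    using order_tendstoD(2)[OF d, of "e / 2"] e by (auto simp: eventually_sequentially)
  define C where "C = (\<Sum>n=1..n0. d n)"
  have C: "C \<ge> 0" unfolding C_def by (intro sum_nonneg nonneg)
  have bound: "(\<Sum>n=1..N. d n) \<le> C + real N * (e / 2)" for N
  proof -
    have "(\<Sum>n=1..N. d n) \<le> (\<Sum>n=1..N. (if n \<in> {1..n0} then d n else 0) + e / 2)"
      using n0 e nonneg by (intro sum_mono) (auto simp: not_le intro: less_imp_le)
    also have "\<dots> = (\<Sum>n\<in>{1..N} \<inter> {1..n0}. d n) + real N * (e / 2)"
      unfolding sum.distrib sum.inter_restrict[OF finite_atLeastAtMost] by simp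
    also have "(\<Sum>n\<in>{1..N} \<inter> {1..n0}. d n) \<le> C"
      unfolding C_def by (intro sum_mono2) (auto simp: nonneg)
    finally show ?thesis by simp
  qed
  obtain N0 :: nat where N0: "real N0 > 2 * C / e" using reals_Archimedean2 by blast
  have "norm ((\<Sum>n=1..N. d n) / real N - 0) < e" if N: "N \<ge> max 1 N0" for N
  proof -
    have N': "real N > 0" "real N > 2 * C / e" using N N0 by auto
    have "(\<Sum>n=1..N. d n) / real N \<le> (C + real N * (e / 2)) / real N"
      using bound by (intro divide_right_mono) auto
    also have "\<dots> = C / real N + e / 2" using N' by (simp add: field_simps)
    also have "C / real N < e / 2" using N' e by (simp add: field_simps)
    finally have "(\<Sum>n=1..N. d n) / real N < e" by simp
    moreover have "(\<Sum>n=1..N. d n) / real N \<ge> 0" by (intro divide_nonneg_nonneg sum_nonneg nonneg) simp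
    ultimately show ?thesis by simp
  qed
  thus "\<exists>N0. \<forall>N\<ge>N0. norm ((\<Sum>n=1..N. d n) / real N - 0) < e" by blast
qed

text \<open>For m \<le> n the k-th correlation is (R n / R m) ^ k times that of the arguments. The
  ratio lies between L / R m and 1, so the error is controlled by the earlier index alone and
  disappears in the double Cesaro mean. The mean of the argument correlations is the squared modulus
  of a Weyl sum.\<close>

lemma ergodic_boundary_iff_equidistributed:
  assumes inner: "\<And>n. n \<ge> 1 \<Longrightarrow> inner_function (g n)" and zero: "\<And>n. n \<ge> 1 \<Longrightarrow> g n 0 = 0"
    and nc: "\<not> contracting g" and nz: "\<And>n. n \<ge> 1 \<Longrightarrow> deriv (comp_seq g n) 0 \<noteq> 0"
  shows "ergodic_seq \<mu> (\<lambda>n. boundary_map (comp_seq g n)) \<longleftrightarrow>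
    equidistributed (\<lambda>n. cis (Arg (deriv (comp_seq g n) 0)))"
proof -
  define d where "d n = deriv (comp_seq g n) 0" for n
  define R where "R n = norm (d n)" for n
  define z where "z n = cis (Arg (d n))" for n
  have d_prod: "d n = (\<Prod>j=1..n. deriv (g j) 0)" for n
    unfolding d_def by (rule deriv_comp_seq[where g = g, OF inner zero])
  \<comment> \<open>For n = 0 the iterate is the identity, with derivative 1.\<close>
  have dnz: "d n \<noteq> 0" for n
    using nz[of n] by (cases "n = 0") (auto simp: d_def id_def)
  have R_pos: "R n > 0" for n using dnz by (simp add: R_def)
  have dz: "d n = of_real (R n) * z n" for n
    using cis_Arg[OF dnz[of n]] dnz[of n] by (simp add: z_def R_def sgn_eq)
  have z: "norm (z n) = 1" for n by (simp add: z_def)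
  have gnz: "deriv (g n) 0 \<noteq> 0" if "n \<ge> 1" for n
    using dnz[of n] that by (auto simp: d_prod)
  have R_Suc: "R (Suc n) \<le> R n" for n
  proof -
    have "R (Suc n) = R n * norm (deriv (g (Suc n)) 0)" by (simp add: R_def d_prod norm_mult mult.commute)
    also have "\<dots> \<le> R n * 1"
      using norm_deriv_inner_le[OF inner zero, of "Suc n"] R_pos[of n] by (intro mult_left_mono) auto
    finally show ?thesis by simp
  qed
  hence dec: "decseq R" by (simp add: decseq_Suc_iff)
  obtain L where L: "R \<longlonglongrightarrow> L" "\<And>n. L \<le> R n"
    using decseq_convergent[OF dec, of 0] R_pos less_imp_le by metis
  have "L \<ge> 0" using L(1) R_pos by (intro LIMSEQ_le_const[of R]) (auto intro: less_imp_le)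
  moreover have "L \<noteq> 0"
  proof
    assume "L = 0"
    hence "(\<lambda>n. norm (deriv (comp_seq g n) 0)) \<longlonglongrightarrow> 0" using L(1) by (simp add: R_def[abs_def] d_def)
    from contracting_if_deriv_tendsto_0[where g = g, OF inner zero gnz this] nc show False by blast
  qed
  ultimately have L0: "L > 0" by simp
  let ?T = "\<lambda>n. boundary_map (comp_seq g n)"
  note G = inner_comp_seq[where g = g, OF inner zero]
  have T: "circle_preserving (?T n)" for n
    by (rule circle_preserving_boundary_map[OF G])
  define C where "C k m n = (\<integral>x. ?T n x ^ k * cnj (?T m x ^ k) \<partial>\<mu>)" for k m n
  have corr_le: "C k m n = of_real ((R n / R m) ^ k) * (z n ^ k * cnj (z m ^ k))"
    if le: "m \<le> n" for m n k
  proof -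
    have "d n = d m * (\<Prod>j=m+1..n. deriv (g j) 0)"
      using prod.ub_add_nat[of 1 m "\<lambda>j. deriv (g j) 0" "n - m"] le unfolding d_prod by simp
    hence "(\<Prod>j=m+1..n. deriv (g j) 0) = d n / d m" using dnz[of m] by simp
    also have "\<dots> = of_real (R n / R m) * (z n * inverse (z m))"
      unfolding dz[of n] dz[of m] by (simp add: divide_inverse)
    also have "inverse (z m) = cnj (z m)" by (rule inverse_eq_cnj[OF z])
    finally have p: "(\<Prod>j=m+1..n. deriv (g j) 0) = of_real (R n / R m) * (z n * cnj (z m))" .
    show ?thesis
      using comp_seq_correlation[where g = g and m = m and n = n and k = k, OF inner zero le]
      unfolding p C_def by (simp add: power_mult_distrib power_divide)
  qed
  have corr_swap: "C k m n = cnj (C k n m)" for m n k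
    unfolding C_def by (subst Bochner_Integration.integral_cnj[symmetric]) (simp add: mult.commute)
  \<comment> \<open>The largest possible deviation of (R n / R m) ^ k from 1 over all n after m,
    with the earlier index as argument; it tends to 0 because L > 0.\<close>
  define \<delta> where "\<delta> k n = 1 - (L / R n) ^ k" for k n
  have \<delta>0: "\<delta> k n \<ge> 0" for k n
    using L(2)[of n] R_pos[of n] L0 by (simp add: \<delta>_def power_le_one)
  have \<delta>_lim: "\<delta> k \<longlonglongrightarrow> 0" for k
  proof -
    have "\<delta> k \<longlonglongrightarrow> 1 - (L / L) ^ k"
      unfolding \<delta>_def[abs_def] using L0 by (intro tendsto_intros L(1)) auto
    thus ?thesis using L0 by simp
  qed
  have diff_le: "norm (C k m n - z n ^ k * cnj (z m ^ k)) \<le> \<delta> k m"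
    if le: "m \<le> n" for m n k
  proof -
    have "R n \<le> R m" using dec le by (simp add: decseq_def)
    hence q: "L / R m \<le> R n / R m" "R n / R m \<le> 1" "0 \<le> L / R m"
      using L(2)[of n] R_pos[of m] L0 by (auto simp: divide_right_mono)
    have "C k m n - z n ^ k * cnj (z m ^ k) =
        of_real ((R n / R m) ^ k - 1) * (z n ^ k * cnj (z m ^ k))"
      unfolding corr_le[OF le] by (simp add: ring_distribs)
    hence "norm (C k m n - z n ^ k * cnj (z m ^ k)) = \<bar>(R n / R m) ^ k - 1\<bar>"
      by (simp only: norm_mult norm_of_real complex_mod_cnj norm_power z power_one mult_1_right)
    also have "\<dots> = 1 - (R n / R m) ^ k"
      using q power_le_one[of "R n / R m" k] by simp
    also have "\<dots> \<le> \<delta> k m"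
      unfolding \<delta>_def using q by (intro diff_left_mono power_mono) auto
    finally show ?thesis .
  qed
  \<comment> \<open>Adding both errors avoids keeping track of which index is earlier and makes the
    double sum factor into single Cesaro means.\<close>
  have diff: "norm (C k m n - z n ^ k * cnj (z m ^ k)) \<le> \<delta> k n + \<delta> k m" for m n k
  proof (cases "m \<le> n")
    case True
    thus ?thesis using diff_le[OF True, of k] \<delta>0[of k n] by linarith
  next
    case False
    hence le: "n \<le> m" by simp
    have "C k m n - z n ^ k * cnj (z m ^ k) =
        cnj (C k n m - z m ^ k * cnj (z n ^ k))"
      by (subst corr_swap) (simp add: mult.commute)
    hence "norm (C k m n - z n ^ k * cnj (z m ^ k)) =
        norm (C k n m - z m ^ k * cnj (z n ^ k))"
      by (simp only: complex_mod_cnj)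
    thus ?thesis using diff_le[OF le, of k] \<delta>0[of k m] by linarith
  qed
  define S where "S k N = circle_sq (\<lambda>x. (\<Sum>n=1..N. ?T n x ^ k) / of_nat N)" for k N
  define A where "A k = seq_average z (\<lambda>x. x ^ k)" for k
  have close: "\<bar>S k N - (norm (A k N))\<^sup>2\<bar> \<le> 2 * ((\<Sum>n=1..N. \<delta> k n) / real N)" for k N
  proof -
    have m: "(\<lambda>x. ?T n x ^ k) \<in> borel_measurable \<mu>" for n
      using borel_measurable_boundary_map[OF G(1)] by measurable
    have S: "complex_of_real (S k N) =
      (\<Sum>n=1..N. \<Sum>m=1..N. C k m n) / (of_nat N)\<^sup>2"
      unfolding S_def C_def by (rule circle_sq_average[of "\<lambda>n x. ?T n x ^ k", OF m]) (simp add: norm_power)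
    have A: "complex_of_real ((norm (A k N))\<^sup>2) = (\<Sum>n=1..N. \<Sum>m=1..N. z n ^ k * cnj (z m ^ k)) / (of_nat N)\<^sup>2"
      unfolding complex_norm_square by (simp add: A_def seq_average_def sum_product power2_eq_square)
    have "complex_of_real (S k N - (norm (A k N))\<^sup>2) =
      (\<Sum>n=1..N. \<Sum>m=1..N. C k m n - z n ^ k * cnj (z m ^ k)) / (of_nat N)\<^sup>2"
      unfolding of_real_diff S A by (simp add: sum_subtractf diff_divide_distrib)
    from arg_cong[OF this, of norm] have "\<bar>S k N - (norm (A k N))\<^sup>2\<bar> =
      norm (\<Sum>n=1..N. \<Sum>m=1..N. C k m n - z n ^ k * cnj (z m ^ k)) / (real N)\<^sup>2"
      unfolding norm_divide norm_power norm_of_nat norm_of_real .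
    also have "\<dots> \<le> (\<Sum>n=1..N. \<Sum>m=1..N. \<delta> k n + \<delta> k m) / (real N)\<^sup>2"
      by (intro divide_right_mono order.trans[OF norm_sum] sum_mono diff) auto
    also have "(\<Sum>n=1..N. \<Sum>m=1..N. \<delta> k n + \<delta> k m) = 2 * (real N * (\<Sum>n=1..N. \<delta> k n))"
      by (simp add: sum.distrib sum_distrib_left)
    also have "2 * (real N * (\<Sum>n=1..N. \<delta> k n)) / (real N)\<^sup>2 = 2 * ((\<Sum>n=1..N. \<delta> k n) / real N)"
      by (cases "N = 0") (simp_all add: power2_eq_square)
    finally show ?thesis .
  qed
  have close_lim: "(\<lambda>N. S k N - (norm (A k N))\<^sup>2) \<longlonglongrightarrow> 0" for k
  proof (rule Lim_null_comparison)
    show "\<forall>\<^sub>F N in sequentially. norm (S k N - (norm (A k N))\<^sup>2) \<le> 2 * ((\<Sum>n=1..N. \<delta> k n) / real N)"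
      using close by simp
    show "(\<lambda>N. 2 * ((\<Sum>n=1..N. \<delta> k n) / real N)) \<longlonglongrightarrow> 0"
      using tendsto_mult_right_zero[OF cesaro_tendsto_0[OF \<delta>_lim \<delta>0]] .
  qed
  have "S k \<longlonglongrightarrow> 0 \<longleftrightarrow> A k \<longlonglongrightarrow> 0" for k
  proof
    assume "S k \<longlonglongrightarrow> 0"
    from tendsto_diff[OF this close_lim[of k]] have "(\<lambda>N. (norm (A k N))\<^sup>2) \<longlonglongrightarrow> 0" by simp
    from tendsto_real_sqrt[OF this] have "(\<lambda>N. norm (A k N)) \<longlonglongrightarrow> 0" by simp
    thus "A k \<longlonglongrightarrow> 0" by (rule tendsto_norm_zero_cancel)
  next
    assume "A k \<longlonglongrightarrow> 0"
    hence "(\<lambda>N. (norm (A k N))\<^sup>2) \<longlonglongrightarrow> 0\<^sup>2" by (intro tendsto_power tendsto_norm_zero)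
    from tendsto_add[OF close_lim[of k] this] show "S k \<longlonglongrightarrow> 0" by simp
  qed
  hence "(\<forall>k\<ge>1. S k \<longlonglongrightarrow> 0) \<longleftrightarrow> equidistributed z"
    using weyl_criterion[of z] z by (simp add: A_def)
  thus ?thesis
    using ergodic_seq_circle_iff[of ?T] T unfolding S_def[abs_def] z_def[abs_def] d_def by simp
qed

text \<open>Positivity of a complex derivative is expressed as being real with positive real part,
  and the products are taken over real parts. In (i) the index 0 occurs for only finitely many N,
  which does not affect the limit; in (ii) N > M keeps it out. In (iii) the derivatives of the
  iterates are nonzero so that their arguments are defined.\<close>

theorem theorem1p3:
  fixes g :: "nat \<Rightarrow> complex \<Rightarrow> complex"
  assumes inner: "\<And>n. n \<ge> 1 \<Longrightarrow> inner_function (g n)"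
    and zero: "\<And>n. n \<ge> 1 \<Longrightarrow> g n 0 = 0"
  shows
    "((\<forall>n\<ge>1. deriv (g n) 0 \<in> \<real> \<and> Re (deriv (g n) 0) > 0) \<longrightarrow>
       (ergodic_seq circle_measure (\<lambda>n. boundary_map (comp_seq g n)) \<longleftrightarrow>
        (\<forall>\<epsilon>::real. 0 < \<epsilon> \<and> \<epsilon> < 1 \<longrightarrow>
          (\<lambda>N. \<Prod>k = nat \<lfloor>real N * (1 - \<epsilon>)\<rfloor>..N. Re (deriv (g k) 0)) \<longlonglongrightarrow> 0)))
     \<and> ((\<forall>n\<ge>1. deriv (g n) 0 \<in> \<real> \<and> Re (deriv (g n) 0) > 0) \<longrightarrow>
       (mixing_seq circle_measure (\<lambda>n. boundary_map (comp_seq g n)) \<longleftrightarrow>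
        (\<forall>\<epsilon>::real. \<epsilon> > 0 \<longrightarrow>
          (\<exists>M0::nat. \<forall>M N. N > M \<and> M > M0 \<longrightarrow>
            (\<Prod>k = N - M..N. Re (deriv (g k) 0)) < \<epsilon>))))
     \<and> (\<not> contracting g \<and> (\<forall>n\<ge>1. deriv (comp_seq g n) 0 \<noteq> 0) \<longrightarrow>
       (ergodic_seq circle_measure (\<lambda>n. boundary_map (comp_seq g n)) \<longleftrightarrow>
        equidistributed (\<lambda>n. exp (\<i> * of_real (Arg (deriv (comp_seq g n) 0))))))"
proof (intro conjI impI)
  let ?a = "\<lambda>j. Re (deriv (g j) 0)"
  assume pos: "\<forall>n\<ge>1. deriv (g n) 0 \<in> \<real> \<and> Re (deriv (g n) 0) > 0"
  have real: "deriv (g n) 0 \<in> \<real>" and apos: "0 < ?a n" and ale: "?a n \<le> 1" if "n \<ge> 1" for n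
    using pos norm_deriv_inner_le[OF inner[OF that] zero[OF that]] abs_Re_le_cmod[of "deriv (g n) 0"] that
    by auto
  have iff: "ergodic_seq circle_measure (\<lambda>n. boundary_map (comp_seq g (r n))) \<longleftrightarrow> mean_span ?a r \<longlonglongrightarrow> 0"
    if "mono r" for r
    by (rule ergodic_boundary_iff_mean_span[where g = g, OF inner zero real apos that])
  show "ergodic_seq circle_measure (\<lambda>n. boundary_map (comp_seq g n)) \<longleftrightarrow>
        (\<forall>\<epsilon>::real. 0 < \<epsilon> \<and> \<epsilon> < 1 \<longrightarrow>
          (\<lambda>N. \<Prod>k = nat \<lfloor>real N * (1 - \<epsilon>)\<rfloor>..N. ?a k) \<longlonglongrightarrow> 0)"
    using iff[of "\<lambda>n. n"] mean_span_id_iff[where a = ?a, OF apos ale] by (simp add: mono_def)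
  have "mixing_seq circle_measure (\<lambda>n. boundary_map (comp_seq g n)) \<longleftrightarrow>
      (\<forall>r. strict_mono r \<longrightarrow> mean_span ?a r \<longlonglongrightarrow> 0)"
    unfolding mixing_seq_def using iff strict_mono_mono by blast
  thus "mixing_seq circle_measure (\<lambda>n. boundary_map (comp_seq g n)) \<longleftrightarrow>
        (\<forall>\<epsilon>::real. \<epsilon> > 0 \<longrightarrow>
          (\<exists>M0::nat. \<forall>M N. N > M \<and> M > M0 \<longrightarrow> (\<Prod>k = N - M..N. ?a k) < \<epsilon>))"
    using mean_span_all_iff[where a = ?a, OF apos ale] by blast
next
  assume "\<not> contracting g \<and> (\<forall>n\<ge>1. deriv (comp_seq g n) 0 \<noteq> 0)"
  thus "ergodic_seq circle_measure (\<lambda>n. boundary_map (comp_seq g n)) \<longleftrightarrow>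
        equidistributed (\<lambda>n. exp (\<i> * of_real (Arg (deriv (comp_seq g n) 0))))"
    using ergodic_boundary_iff_equidistributed[where g = g, OF inner zero] by (simp add: cis_conv_exp)
qed

end
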